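(* Let $\Bbbk$ be a field of characteristic $0$, let $(P,\cdot,[-,-],\Delta,\delta)$ be a finite-dimensional Poisson bialgebra over $\Bbbk$, and let $(B=\bigoplus_{i\in\mathbb Z}B_i,\circ_B,\omega)$ be a quadratic $\mathbb Z$-graded perm algebra. Equip $P\otimes B$ with the $\mathbb Z$-graded DPP algebra structure $$(p_1\otimes b_1)\circ(p_2\otimes b_2)=(p_1p_2)\otimes(b_1\circ_B b_2),\qquad (p_1\otimes b_1)\ast(p_2\otimes b_2)=[p_1,p_2]\otimes(b_1\circ_B b_2).$$ Let $\nu_\omega:B\to B\,\hat\otimes\,B$ be the linear map determined by $\hat\omega(\nu_\omega(b_1),b_2\otimes b_3)=-\omega(b_1,b_2\circ_B b_3)$ for all $b_1,b_2,b_3\in B$, and define linear maps $\nu,\vartheta:P\otimes B\to(P\otimes B)\,\hat\otimes\,(P\otimes B)$ by $$\nu(p\otimes b)=\Delta(p)\bullet\nu_\omega(b),\qquad \vartheta(p\otimes b)=\delta(p)\bullet\nu_\omega(b).$$ Then $(P\otimes B,\circ,\ast,\nu,\vartheta)$ is a completed DPP bialgebra.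
   Context: **Poisson bialgebras.** A Poisson algebra $(P,\cdot,[-,-])$ is a commutative associative (not necessarily unital) algebra and a Lie algebra with $[p_1,p_2p_3]=[p_1,p_2]p_3+p_2[p_1,p_3]$. Let $u(p)q=pq$, $\mathrm{ad}(p)q=[p,q]$, $\tau(x\otimes y)=y\otimes x$. A Poisson coalgebra $(P,\Delta,\delta)$ satisfies: $\tau\Delta=\Delta$, $(\Delta\otimes\mathrm{id})\Delta=(\mathrm{id}\otimes\Delta)\Delta$, $\tau\delta=-\delta$, $(\mathrm{id}\otimes\delta)\delta-(\tau\otimes\mathrm{id})(\mathrm{id}\otimes\delta)\delta=(\delta\otimes\mathrm{id})\delta$, $(\mathrm{id}\otimes\Delta)\delta=(\delta\otimes\mathrm{id})\Delta+(\tau\otimes\mathrm{id})(\mathrm{id}\otimes\delta)\Delta$. A Poisson bialgebra $(P,\cdot,[-,-],\Delta,\delta)$ is a Poisson algebra and Poisson coalgebra such that for all $p_1,p_2$: $\Delta(p_1p_2)=(u(p_2)\otimes\mathrm{id})\Delta(p_1)+(\mathrm{id}\otimes u(p_1))\Delta(p_2)$; $\delta([p_1,p_2])=(\mathrm{ad}(p_1)\otimes\mathrm{id}+\mathrm{id}\otimes\mathrm{ad}(p_1))\delta(p_2)-(\mathrm{ad}(p_2)\otimes\mathrm{id}+\mathrm{id}\otimes\mathrm{ad}(p_2))\delta(p_1)$; $\Delta([p_1,p_2])=(\mathrm{ad}(p_1)\otimes\mathrm{id}+\mathrm{id}\otimes\mathrm{ad}(p_1))\Delta(p_2)+(u(p_2)\otimes\mathrm{id}-\mathrm{id}\otimes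 u(p_2))\delta(p_1)$; $\delta(p_1p_2)=(u(p_1)\otimes\mathrm{id})\delta(p_2)+(u(p_2)\otimes\mathrm{id})\delta(p_1)+(\mathrm{id}\otimes\mathrm{ad}(p_1))\Delta(p_2)+(\mathrm{id}\otimes\mathrm{ad}(p_2))\Delta(p_1)$. **Algebras.** A perm algebra $(B,\circ)$ satisfies $b_1\circ(b_2\circ b_3)=(b_1\circ b_2)\circ b_3=(b_2\circ b_1)\circ b_3$; a (left) Leibniz algebra $(A,\ast)$ satisfies $a_1\ast(a_2\ast a_3)=(a_1\ast a_2)\ast a_3+a_2\ast(a_1\ast a_3)$. A DPP algebra $(A,\circ,\ast)$ is a perm algebra and a Leibniz algebra with $(a_1\circ a_2)\ast a_3=a_1\circ(a_2\ast a_3)+a_2\circ(a_1\ast a_3)$ and $(a_1\ast a_2)\circ a_3=a_1\ast(a_2\circ a_3)-a_2\circ(a_1\ast a_3)=-(a_2\ast a_1)\circ a_3$. It is $\mathbb Z$-graded if $A=\bigoplus_{i\in\mathbb Z}A_i$ with every $A_i$ finite-dimensional, $A_i\circ A_j\subseteq A_{i+j}$, $A_i\ast A_j\subseteq A_{i+j}$; similarly for perm algebras. $P\otimes B$ is graded by $(P\otimes B)_i=P\otimes B_i$. A quadratic $\mathbb Z$-graded perm algebra $(B,\circ_B,\omega)$ is a $\mathbb Z$-graded perm algebra with a skew-symmetric nondegenerate bilinear form $\omega$ that is invariant, $\omega(b_1\circ_B b_2,b_3)=\omega(b_1,b_2\circ_B b_3-b_3\circ_B b_2)$, and graded: there is $m\in\mathbb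 Z$ with $\omega(B_i,B_j)=0$ whenever $i+j+m\ne0$. **Completed tensor products.** For $\mathbb Z$-graded spaces $U,V$, $U\hat\otimes V=\prod_{i,j}U_i\otimes V_j$, whose elements are written as formal sums $\sum_{i,j,\alpha}u_{i,\alpha}\otimes v_{j,\alpha}$ ($\alpha$ in a finite set depending on $i,j$); similarly for more factors. $f\hat\otimes g$ and the flip $\hat\tau$ are defined termwise, and for $\nu:V\to V\hat\otimes V$ the composites $(\nu\hat\otimes\mathrm{id})\nu$, $(\mathrm{id}\hat\otimes\nu)\nu$, etc. are defined termwise with values in $V\hat\otimes V\hat\otimes V$ (each homogeneous component is required to receive only finitely many nonzero contributions). $\hat\omega:(B\hat\otimes B)\otimes(B\otimes B)\to\Bbbk$ is $\hat\omega(\sum x_{i,\alpha}\otimes y_{j,\alpha},\,b\otimes b')=\sum\omega(x_{i,\alpha},b)\omega(y_{j,\alpha},b')$. For $\sum_l p'_l\otimes p''_l\in P\otimes P$ and $\sum b_{1,i,\alpha}\otimes b_{2,j,\alpha}\in B\hat\otimes B$, $(\sum_l p'_l\otimes p''_l)\bullet(\sum b_{1,i,\alpha}\otimes b_{2,j,\alpha})=\sum_l\sum_{i,j,\alpha}(p'_l\otimes b_{1,i,\alpha})\otimes(p''_l\otimes b_{2,j,\alpha})$. **Completed DPP bialgebras.** A completed DPP coalgebra is $(A,\nu,\vartheta)$, $A$ $\mathbb Z$-graded, $\nu,\vartheta:A\to A\hat\otimes A$ linear, with $(\nu\hat\otimes\mathrm{id})\nu=(\mathrm{id}\hat\otimes\nu)\nu=(\hat\tau\hat\otimes\mathrm{id})(\nu\hat\otimes\mathrm{id})\nu$,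 $(\mathrm{id}\hat\otimes\vartheta)\vartheta=(\vartheta\hat\otimes\mathrm{id})\vartheta+(\hat\tau\hat\otimes\mathrm{id})(\mathrm{id}\hat\otimes\vartheta)\vartheta$, $(\mathrm{id}\hat\otimes\nu)\vartheta=(\vartheta\hat\otimes\mathrm{id})\nu+(\hat\tau\hat\otimes\mathrm{id})(\mathrm{id}\hat\otimes\vartheta)\nu$, $(\nu\hat\otimes\mathrm{id})\vartheta=(\mathrm{id}\hat\otimes\vartheta)\nu+(\hat\tau\hat\otimes\mathrm{id})(\mathrm{id}\hat\otimes\vartheta)\nu$, $(\vartheta\hat\otimes\mathrm{id})\nu=-(\hat\tau\hat\otimes\mathrm{id})(\vartheta\hat\otimes\mathrm{id})\nu$. Write $L(a)b=a\circ b$, $R(a)b=b\circ a$, $\tilde L(a)b=a\ast b$, $\tilde R(a)b=b\ast a$, $\nu^-=\nu-\hat\tau\nu$, $\vartheta^+=\vartheta+\hat\tau\vartheta$. A completed DPP bialgebra $(A,\circ,\ast,\nu,\vartheta)$ is a $\mathbb Z$-graded DPP algebra $(A,\circ,\ast)$ with a completed DPP coalgebra $(A,\nu,\vartheta)$ such that for all $a_1,a_2\in A$: (perm bialgebra) $(R(a_1)\hat\otimes\mathrm{id})\nu(a_2)=\hat\tau((R(a_2)\hat\otimes\mathrm{id})\nu(a_1))$; $\nu(a_1\circ a_2)=((L-R)(a_1)\hat\otimes\mathrm{id})\nu(a_2)+(\mathrm{id}\hat\otimes R(a_2))\nu(a_1)$; $\nu(a_1\circ a_2)=(\mathrm{id}\hat\otimes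 L(a_1))\nu(a_2)+((L-R)(a_2)\hat\otimes\mathrm{id})\nu^-(a_1)$; (Leibniz bialgebra) $\hat\tau((\tilde R(a_2)\hat\otimes\mathrm{id})\vartheta(a_1))=(\tilde R(a_1)\hat\otimes\mathrm{id})\vartheta(a_2)$; $\vartheta(a_1\ast a_2)=(\mathrm{id}\hat\otimes\tilde R(a_2)-(\tilde L+\tilde R)(a_2)\hat\otimes\mathrm{id})\vartheta^+(a_1)+(\mathrm{id}\hat\otimes\tilde L(a_1)+\tilde L(a_1)\hat\otimes\mathrm{id})\vartheta(a_2)$; 1. $\nu(a_1\ast a_2)=(\mathrm{id}\hat\otimes\tilde L(a_1)+\tilde L(a_1)\hat\otimes\mathrm{id})\nu(a_2)+((L-R)(a_2)\hat\otimes\mathrm{id}-\mathrm{id}\hat\otimes R(a_2))\vartheta^+(a_1)$; 2. $\vartheta(a_1\circ a_2)=(\mathrm{id}\hat\otimes L(a_1))\vartheta(a_2)+(\mathrm{id}\hat\otimes R(a_2))\vartheta(a_1)-((\tilde L+\tilde R)(a_1)\hat\otimes\mathrm{id})\nu(a_2)-((\tilde L+\tilde R)(a_2)\hat\otimes\mathrm{id})\nu^-(a_1)$; 3. $(\mathrm{id}\hat\otimes\tilde R(a_1))\hat\tau\nu(a_2)=-(R(a_2)\hat\otimes\mathrm{id})\vartheta(a_1)$; 4. $\nu(a_1\ast a_2)=(\mathrm{id}\hat\otimes L(a_1)-L(a_1)\hat\otimes\mathrm{id})\vartheta(a_2)+(\mathrm{id}\hat\otimes\tilde R(a_2)-(\tilde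 L+\tilde R)(a_2)\hat\otimes\mathrm{id})\nu^-(a_1)$; 5. $\vartheta^+(a_1\circ a_2)=(\mathrm{id}\hat\otimes L(a_1))\vartheta^+(a_2)+(\mathrm{id}\hat\otimes L(a_2))\vartheta^+(a_1)-(\tilde L(a_1)\hat\otimes\mathrm{id})\nu^-(a_2)-(\tilde L(a_2)\hat\otimes\mathrm{id})\nu^-(a_1)$; 6. $\vartheta(a_1\circ a_2)=(L(a_1)\hat\otimes\mathrm{id})\vartheta(a_2)-(\mathrm{id}\hat\otimes\tilde R(a_2))\nu^-(a_1)+(\mathrm{id}\hat\otimes\tilde L(a_1))\nu(a_2)+((L-R)(a_2)\hat\otimes\mathrm{id})\vartheta^+(a_1)$; 7. $\nu(a_1\ast a_2+a_2\ast a_1)=(\mathrm{id}\hat\otimes(\tilde L+\tilde R)(a_1))\nu(a_2)+((\tilde L+\tilde R)(a_1)\hat\otimes\mathrm{id})\hat\tau\nu(a_2)+(\mathrm{id}\hat\otimes(L-R)(a_2))\vartheta(a_1)+((L-R)(a_2)\hat\otimes\mathrm{id})\hat\tau\vartheta(a_1)$. *)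

theory Defs
  imports
    Complex_Main
    "HOL-Library.Function_Algebras"
    "HOL-Library.Groups_Big_Fun"
begin

section \<open>Linear maps on subspaces and tensor products\<close>

text \<open>
  Vector spaces over a field \<open>'k\<close> are given by an ambient type with a scalar multiplication
  (locale \<^locale>\<open>vector_space\<close>); a space that is not the whole type is a subspace of it.
  Addition of functions is pointwise.
\<close>

definition linear_on ::
  "('k::field \<Rightarrow> 'a::ab_group_add \<Rightarrow> 'a) \<Rightarrow> ('k \<Rightarrow> 'b::ab_group_add \<Rightarrow> 'b) \<Rightarrow> 'a set \<Rightarrow> ('a \<Rightarrow> 'b) \<Rightarrow> bool"
  where "linear_on s t S f \<longleftrightarrow>
    (\<forall>x\<in>S. \<forall>y\<in>S. f (x + y) = f x + f y) \<and> (\<forall>c. \<forall>x\<in>S. f (s c x) = t c (f x))"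

definition bilinear_on ::
  "('k::field \<Rightarrow> 'a::ab_group_add \<Rightarrow> 'a) \<Rightarrow> ('k \<Rightarrow> 'b::ab_group_add \<Rightarrow> 'b) \<Rightarrow>
   ('k \<Rightarrow> 'c::ab_group_add \<Rightarrow> 'c) \<Rightarrow> 'a set \<Rightarrow> 'b set \<Rightarrow> ('a \<Rightarrow> 'b \<Rightarrow> 'c) \<Rightarrow> bool"
  where "bilinear_on s t r S T f \<longleftrightarrow>
    (\<forall>x\<in>S. linear_on t r T (f x)) \<and> (\<forall>y\<in>T. linear_on s r S (\<lambda>x. f x y))"

definition fin_dim :: "('k::field \<Rightarrow> 'a::ab_group_add \<Rightarrow> 'a) \<Rightarrow> 'a set \<Rightarrow> bool"
  where "fin_dim s S \<longleftrightarrow> (\<exists>X. finite X \<and> S = module.span s X)"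

definition fscale :: "'k::field \<Rightarrow> ('x \<Rightarrow> 'k) \<Rightarrow> 'x \<Rightarrow> 'k"
  where "fscale c f = (\<lambda>x. c * f x)"

text \<open>
  \<open>U \<otimes> V\<close> is realised inside the dual of the space of bilinear forms on \<open>U \<times> V\<close>: the pure tensor
  \<open>u \<otimes> v\<close> is evaluation at \<open>(u, v)\<close>, and for subspaces \<open>S\<close> of \<open>U\<close> and \<open>T\<close> of \<open>V\<close> the space
  \<open>S \<otimes> T\<close> is the span of the pure tensors \<open>u \<otimes> v\<close> with \<open>u \<in> S\<close>, \<open>v \<in> T\<close>. That this is the
  tensor product, i.e. that every bilinear map on \<open>S \<times> T\<close> factors through it, is lemma
  \<open>tlift_sum_list\<close> below.
\<close>

type_synonym ('u, 'v, 'k) tensor = "('u \<Rightarrow> 'v \<Rightarrow> 'k) \<Rightarrow> 'k"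

definition tensor ::
  "('k::field \<Rightarrow> 'u::ab_group_add \<Rightarrow> 'u) \<Rightarrow> ('k \<Rightarrow> 'v::ab_group_add \<Rightarrow> 'v) \<Rightarrow> 'u \<Rightarrow> 'v \<Rightarrow> ('u, 'v, 'k) tensor"
  where "tensor sU sV u v = (\<lambda>\<beta>. if bilinear_on sU sV (*) UNIV UNIV \<beta> then \<beta> u v else 0)"

definition tensor_space ::
  "('k::field \<Rightarrow> 'u::ab_group_add \<Rightarrow> 'u) \<Rightarrow> ('k \<Rightarrow> 'v::ab_group_add \<Rightarrow> 'v) \<Rightarrow>
   'u set \<Rightarrow> 'v set \<Rightarrow> ('u, 'v, 'k) tensor set"
  where "tensor_space sU sV S T = module.span fscale {tensor sU sV u v |u v. u \<in> S \<and> v \<in> T}"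

text \<open>
  \<open>tlift sU sV S T f\<close> is the linear map on \<open>S \<otimes> T\<close> sending \<open>u \<otimes> v\<close> to \<open>f u v\<close>, for \<open>f\<close> bilinear
  on \<open>S \<times> T\<close>: the value at \<open>x\<close> is obtained termwise from any expression of \<open>x\<close> as a sum of
  pure tensors.
\<close>

definition tlift ::
  "('k::field \<Rightarrow> 'u::ab_group_add \<Rightarrow> 'u) \<Rightarrow> ('k \<Rightarrow> 'v::ab_group_add \<Rightarrow> 'v) \<Rightarrow> 'u set \<Rightarrow> 'v set \<Rightarrow>
   ('u \<Rightarrow> 'v \<Rightarrow> 'w::ab_group_add) \<Rightarrow> ('u, 'v, 'k) tensor \<Rightarrow> 'w"
  where "tlift sU sV S T f x = (THE y. \<exists>xs. set xs \<subseteq> S \<times> T \<and>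
    x = (\<Sum>(u, v)\<leftarrow>xs. tensor sU sV u v) \<and> y = (\<Sum>(u, v)\<leftarrow>xs. f u v))"

lemma vector_space_fscale: "vector_space (fscale :: 'k::field \<Rightarrow> ('x \<Rightarrow> 'k) \<Rightarrow> 'x \<Rightarrow> 'k)"
  by unfold_locales (auto simp: fscale_def algebra_simps fun_eq_iff)

lemma vector_space_mult: "vector_space ((*) :: 'k::field \<Rightarrow> 'k \<Rightarrow> 'k)"
  by unfold_locales (auto simp: algebra_simps)

lemma exists_projection:
  fixes s :: "'k::field \<Rightarrow> 'a::ab_group_add \<Rightarrow> 'a"
  assumes "vector_space s" "module.subspace s S"
  obtains \<pi> where "Vector_Spaces.linear s s \<pi>" "\<And>x. \<pi> x \<in> S" "\<And>x. x \<in> S \<Longrightarrow> \<pi> x = x"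
proof -
  interpret vector_space s by fact
  interpret vector_space_pair s s by unfold_locales
  have "\<exists>g. g ` UNIV \<subseteq> S \<and> Vector_Spaces.linear s s g \<and> (\<forall>v\<in>S. g (id v) = v)"
    using linear_exists_left_inverse_on[OF linear_id assms(2)] by (simp add: id_def)
  then show thesis using that by auto
qed

lemma exists_separating_functional:
  fixes s :: "'k::field \<Rightarrow> 'a::ab_group_add \<Rightarrow> 'a"
  assumes "vector_space s" "w \<noteq> 0"
  obtains \<phi> :: "'a \<Rightarrow> 'k" where "Vector_Spaces.linear s (*) \<phi>" "\<phi> w \<noteq> 0"
proof -
  interpret vector_space s by fact
  interpret K: vector_space "(*) :: 'k \<Rightarrow> 'k \<Rightarrow> 'k" by (rule vector_space_mult)
  interpret vector_space_pair s "(*) :: 'k \<Rightarrow> 'k \<Rightarrow> 'k" by unfold_locales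
  have "independent {w}" using assms(2) by simp
  from linear_independent_extend[OF this, of "\<lambda>_. 1"] show thesis using that by auto
qed

lemma tlift_welldef:
  assumes U: "vector_space sU" "module.subspace sU S"
    and V: "vector_space sV" "module.subspace sV T"
    and W: "vector_space sW" and f: "bilinear_on sU sV sW S T f"
    and xs: "set xs \<subseteq> S \<times> T" and ys: "set ys \<subseteq> S \<times> T"
    and eq: "(\<Sum>(u, v)\<leftarrow>xs. tensor sU sV u v) = (\<Sum>(u, v)\<leftarrow>ys. tensor sU sV u v)"
  shows "(\<Sum>(u, v)\<leftarrow>xs. f u v) = (\<Sum>(u, v)\<leftarrow>ys. f u v)"
proof (rule ccontr)
  assume "\<not> ?thesis"
  then have "(\<Sum>(u, v)\<leftarrow>xs. f u v) - (\<Sum>(u, v)\<leftarrow>ys. f u v) \<noteq> 0" by simp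
  from exists_separating_functional[OF W this] obtain \<phi> where
    \<phi>: "Vector_Spaces.linear sW (*) \<phi>" and
    ne: "\<phi> ((\<Sum>(u, v)\<leftarrow>xs. f u v) - (\<Sum>(u, v)\<leftarrow>ys. f u v)) \<noteq> 0" by blast
  interpret \<phi>: Vector_Spaces.linear sW "(*)" \<phi> by fact
  obtain p where p: "Vector_Spaces.linear sU sU p" "\<And>x. p x \<in> S" "\<And>x. x \<in> S \<Longrightarrow> p x = x"
    using exists_projection[OF U] by blast
  obtain q where q: "Vector_Spaces.linear sV sV q" "\<And>x. q x \<in> T" "\<And>x. x \<in> T \<Longrightarrow> q x = x"
    using exists_projection[OF V] by blast
  interpret p: Vector_Spaces.linear sU sU p by fact
  interpret q: Vector_Spaces.linear sV sV q by fact
  define \<beta> where "\<beta> u v = \<phi> (f (p u) (q v))" for u v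
  have \<beta>: "bilinear_on sU sV (*) UNIV UNIV \<beta>"
    using f p(2) q(2)
    by (simp add: bilinear_on_def linear_on_def \<beta>_def p.add q.add p.scale q.scale \<phi>.add \<phi>.scale)
  have ev: "(\<Sum>(u, v)\<leftarrow>zs. tensor sU sV u v) \<beta> = \<phi> (\<Sum>(u, v)\<leftarrow>zs. f u v)"
    if "set zs \<subseteq> S \<times> T" for zs
    using that
  proof (induction zs)
    case Nil
    show ?case by (simp add: \<phi>.zero)
  next
    case (Cons z zs)
    then show ?case
      by (auto simp: \<phi>.add tensor_def \<beta> \<beta>_def[of "fst z"] p(3) q(3) split: prod.splits)
        (use \<beta>_def p(3) q(3) in auto)
  qed
  show False using ne ev[OF xs] ev[OF ys] eq by (simp add: \<phi>.diff)
qed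

lemma tlift_sum_list:
  assumes "vector_space sU" "module.subspace sU S" "vector_space sV" "module.subspace sV T"
    and "vector_space sW" "bilinear_on sU sV sW S T f" "set xs \<subseteq> S \<times> T"
  shows "tlift sU sV S T f (\<Sum>(u, v)\<leftarrow>xs. tensor sU sV u v) = (\<Sum>(u, v)\<leftarrow>xs. f u v)"
  unfolding tlift_def
proof (rule the_equality)
  show "\<exists>ys. set ys \<subseteq> S \<times> T \<and>
    (\<Sum>(u, v)\<leftarrow>xs. tensor sU sV u v) = (\<Sum>(u, v)\<leftarrow>ys. tensor sU sV u v) \<and>
    (\<Sum>(u, v)\<leftarrow>xs. f u v) = (\<Sum>(u, v)\<leftarrow>ys. f u v)"
    using assms(7) by blast
qed (use tlift_welldef[OF assms(1-6) _ assms(7)] in metis)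

lemma tensor_scale_left:
  assumes "vector_space sU"
  shows "tensor sU sV (sU c u) v = fscale c (tensor sU sV u v)"
  by (auto simp: tensor_def fscale_def bilinear_on_def linear_on_def fun_eq_iff)

lemma tensor_space_sum_list:
  assumes "vector_space sU" "module.subspace sU S"
  shows "x \<in> tensor_space sU sV S T \<longleftrightarrow>
    (\<exists>xs. set xs \<subseteq> S \<times> T \<and> x = (\<Sum>(u, v)\<leftarrow>xs. tensor sU sV u v))"
proof
  interpret F: vector_space "fscale :: 'a \<Rightarrow> (('b \<Rightarrow> 'c \<Rightarrow> 'a) \<Rightarrow> 'a) \<Rightarrow> _"
    by (rule vector_space_fscale)
  interpret U: vector_space sU by fact
  show "\<exists>xs. set xs \<subseteq> S \<times> T \<and> x = (\<Sum>(u, v)\<leftarrow>xs. tensor sU sV u v)"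
    if "x \<in> tensor_space sU sV S T"
    using that unfolding tensor_space_def
  proof (induction rule: F.span_induct_alt)
    case base
    show ?case by (rule exI[of _ "[]"]) simp
  next
    case (step c x y)
    then obtain u v ys where "u \<in> S" "v \<in> T" "x = tensor sU sV u v"
      "set ys \<subseteq> S \<times> T" "y = (\<Sum>(u, v)\<leftarrow>ys. tensor sU sV u v)" by blast
    then show ?case
      using assms by (intro exI[of _ "(sU c u, v) # ys"]) (auto simp: tensor_scale_left U.subspace_scale)
  qed
  have "(\<Sum>(u, v)\<leftarrow>xs. tensor sU sV u v) \<in> tensor_space sU sV S T" if "set xs \<subseteq> S \<times> T" for xs
    using that unfolding tensor_space_def
    
  proof (induction xs)
    case (Cons z xs)
    then obtain u v where z: "z = (u, v)" "u \<in> S" "v \<in> T" by auto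
    from z Cons have "tensor sU sV u v + (\<Sum>(u, v)\<leftarrow>xs. tensor sU sV u v)
        \<in> F.span {tensor sU sV u v |u v. u \<in> S \<and> v \<in> T}"
      by (intro F.span_add[OF F.span_base]) auto
    then show ?case by (simp only: z list.map sum_list.Cons prod.case)
  qed (simp add: F.span_zero)
  then show "x \<in> tensor_space sU sV S T"
    if "\<exists>xs. set xs \<subseteq> S \<times> T \<and> x = (\<Sum>(u, v)\<leftarrow>xs. tensor sU sV u v)"
    using that by blast
qed

text \<open>Here \<open>V \<otimes> V \<otimes> V\<close> means \<open>(V \<otimes> V) \<otimes> V\<close>; \<open>tright\<close> includes the reassociation.\<close>

definition tensor3 ::
  "('k::field \<Rightarrow> 'v::ab_group_add \<Rightarrow> 'v) \<Rightarrow> 'v \<Rightarrow> 'v \<Rightarrow> 'v \<Rightarrow> (('v, 'v, 'k) tensor, 'v, 'k) tensor"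
  where "tensor3 s u v w = tensor fscale s (tensor s s u v) w"

text \<open>On \<open>S \<otimes> T\<close>: \<open>f \<otimes> g\<close>, the flip, \<open>f \<otimes> id\<close> for \<open>f : S \<rightarrow> V \<otimes> V\<close> and \<open>id \<otimes> f\<close> for
  \<open>f : T \<rightarrow> S' \<otimes> T'\<close>; on \<open>(S \<otimes> T) \<otimes> W\<close>: the flip of the first two factors.\<close>

definition tmap ::
  "('k::field \<Rightarrow> 'v::ab_group_add \<Rightarrow> 'v) \<Rightarrow> 'v set \<Rightarrow> 'v set \<Rightarrow> ('v \<Rightarrow> 'v) \<Rightarrow> ('v \<Rightarrow> 'v) \<Rightarrow>
   ('v, 'v, 'k) tensor \<Rightarrow> ('v, 'v, 'k) tensor"
  where "tmap s S T f g = tlift s s S T (\<lambda>u v. tensor s s (f u) (g v))"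

definition tflip ::
  "('k::field \<Rightarrow> 'v::ab_group_add \<Rightarrow> 'v) \<Rightarrow> 'v set \<Rightarrow> 'v set \<Rightarrow>
   ('v, 'v, 'k) tensor \<Rightarrow> ('v, 'v, 'k) tensor"
  where "tflip s S T = tlift s s S T (\<lambda>u v. tensor s s v u)"

definition tleft ::
  "('k::field \<Rightarrow> 'v::ab_group_add \<Rightarrow> 'v) \<Rightarrow> 'v set \<Rightarrow> 'v set \<Rightarrow> ('v \<Rightarrow> ('v, 'v, 'k) tensor) \<Rightarrow>
   ('v, 'v, 'k) tensor \<Rightarrow> (('v, 'v, 'k) tensor, 'v, 'k) tensor"
  where "tleft s S T f = tlift s s S T (\<lambda>u v. tensor fscale s (f u) v)"

definition tright ::
  "('k::field \<Rightarrow> 'v::ab_group_add \<Rightarrow> 'v) \<Rightarrow> 'v set \<Rightarrow> 'v set \<Rightarrow> 'v set \<Rightarrow> 'v set \<Rightarrow>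
   ('v \<Rightarrow> ('v, 'v, 'k) tensor) \<Rightarrow> ('v, 'v, 'k) tensor \<Rightarrow> (('v, 'v, 'k) tensor, 'v, 'k) tensor"
  where "tright s S T S' T' f =
    tlift s s S T (\<lambda>u v. tlift s s S' T' (\<lambda>a b. tensor3 s u a b) (f v))"

definition tflip12 ::
  "('k::field \<Rightarrow> 'v::ab_group_add \<Rightarrow> 'v) \<Rightarrow> 'v set \<Rightarrow> 'v set \<Rightarrow> 'v set \<Rightarrow>
   (('v, 'v, 'k) tensor, 'v, 'k) tensor \<Rightarrow> (('v, 'v, 'k) tensor, 'v, 'k) tensor"
  where "tflip12 s S T W =
    tlift fscale s (tensor_space s s S T) W (\<lambda>x w. tensor fscale s (tflip s S T x) w)"

section \<open>Poisson bialgebras\<close>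

locale poisson_algebra = vector_space s
  for s :: "'k::field \<Rightarrow> 'p::ab_group_add \<Rightarrow> 'p" +
  fixes mult :: "'p \<Rightarrow> 'p \<Rightarrow> 'p" and br :: "'p \<Rightarrow> 'p \<Rightarrow> 'p"
  assumes mult_bilinear: "bilinear_on s s s UNIV UNIV mult"
    and mult_commute: "mult p q = mult q p"
    and mult_assoc: "mult (mult p q) r = mult p (mult q r)"
    and br_bilinear: "bilinear_on s s s UNIV UNIV br"
    and br_alternating: "br p p = 0"
    and br_jacobi: "br p (br q r) + br q (br r p) + br r (br p q) = 0"
    and br_mult: "br p (mult q r) = mult (br p q) r + mult q (br p r)"

locale poisson_coalgebra = vector_space s
  for s :: "'k::field \<Rightarrow> 'p::ab_group_add \<Rightarrow> 'p" +
  fixes \<Delta> \<delta> :: "'p \<Rightarrow> ('p, 'p, 'k) tensor"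
  assumes Delta_linear: "linear_on s fscale UNIV \<Delta>"
    and Delta_in: "\<Delta> p \<in> tensor_space s s UNIV UNIV"
    and delta_linear: "linear_on s fscale UNIV \<delta>"
    and delta_in: "\<delta> p \<in> tensor_space s s UNIV UNIV"
    and Delta_cocommutative: "tflip s UNIV UNIV (\<Delta> p) = \<Delta> p"
    and Delta_coassociative:
      "tleft s UNIV UNIV \<Delta> (\<Delta> p) = tright s UNIV UNIV UNIV UNIV \<Delta> (\<Delta> p)"
    and delta_skew: "tflip s UNIV UNIV (\<delta> p) = - \<delta> p"
    and delta_cojacobi:
      "tright s UNIV UNIV UNIV UNIV \<delta> (\<delta> p)
        - tflip12 s UNIV UNIV UNIV (tright s UNIV UNIV UNIV UNIV \<delta> (\<delta> p))
       = tleft s UNIV UNIV \<delta> (\<delta> p)"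
    and delta_Delta:
      "tright s UNIV UNIV UNIV UNIV \<Delta> (\<delta> p)
       = tleft s UNIV UNIV \<delta> (\<Delta> p)
        + tflip12 s UNIV UNIV UNIV (tright s UNIV UNIV UNIV UNIV \<delta> (\<Delta> p))"

locale poisson_bialgebra = poisson_algebra s mult br + poisson_coalgebra s \<Delta> \<delta>
  for s :: "'k::field \<Rightarrow> 'p::ab_group_add \<Rightarrow> 'p" and mult br \<Delta> \<delta> +
  assumes Delta_mult:
      "\<Delta> (mult p q) = tmap s UNIV UNIV (mult q) id (\<Delta> p) + tmap s UNIV UNIV id (mult p) (\<Delta> q)"
    and delta_br:
      "\<delta> (br p q) =
         (tmap s UNIV UNIV (br p) id (\<delta> q) + tmap s UNIV UNIV id (br p) (\<delta> q))
       - (tmap s UNIV UNIV (br q) id (\<delta> p) + tmap s UNIV UNIV id (br q) (\<delta> p))"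
    and Delta_br:
      "\<Delta> (br p q) =
         (tmap s UNIV UNIV (br p) id (\<Delta> q) + tmap s UNIV UNIV id (br p) (\<Delta> q))
       + (tmap s UNIV UNIV (mult q) id (\<delta> p) - tmap s UNIV UNIV id (mult q) (\<delta> p))"
    and delta_mult:
      "\<delta> (mult p q) =
         tmap s UNIV UNIV (mult p) id (\<delta> q) + tmap s UNIV UNIV (mult q) id (\<delta> p)
       + tmap s UNIV UNIV id (br p) (\<Delta> q) + tmap s UNIV UNIV id (br q) (\<Delta> p)"

section \<open>Perm, Leibniz and DPP algebras\<close>

locale algebra_on = vector_space s
  for s :: "'k::field \<Rightarrow> 'a::ab_group_add \<Rightarrow> 'a" +
  fixes S :: "'a set" and m :: "'a \<Rightarrow> 'a \<Rightarrow> 'a"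
  assumes carrier_subspace: "subspace S"
    and m_closed: "\<lbrakk>a \<in> S; b \<in> S\<rbrakk> \<Longrightarrow> m a b \<in> S"
    and m_bilinear: "bilinear_on s s s S S m"

locale perm_algebra = algebra_on s S circ
  for s :: "'k::field \<Rightarrow> 'a::ab_group_add \<Rightarrow> 'a" and S and circ :: "'a \<Rightarrow> 'a \<Rightarrow> 'a" (infixl "\<odot>" 70) +
  assumes perm_assoc: "\<lbrakk>a \<in> S; b \<in> S; c \<in> S\<rbrakk> \<Longrightarrow> a \<odot> (b \<odot> c) = (a \<odot> b) \<odot> c"
    and perm_left_commute: "\<lbrakk>a \<in> S; b \<in> S; c \<in> S\<rbrakk> \<Longrightarrow> (a \<odot> b) \<odot> c = (b \<odot> a) \<odot> c"

locale leibniz_algebra = algebra_on s S star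
  for s :: "'k::field \<Rightarrow> 'a::ab_group_add \<Rightarrow> 'a" and S and star :: "'a \<Rightarrow> 'a \<Rightarrow> 'a" (infixl "\<star>" 70) +
  assumes leibniz: "\<lbrakk>a \<in> S; b \<in> S; c \<in> S\<rbrakk> \<Longrightarrow> a \<star> (b \<star> c) = (a \<star> b) \<star> c + b \<star> (a \<star> c)"

locale DPP_algebra = perm_algebra s S circ + leibniz_algebra s S star
  for s :: "'k::field \<Rightarrow> 'a::ab_group_add \<Rightarrow> 'a" and S
    and circ :: "'a \<Rightarrow> 'a \<Rightarrow> 'a" (infixl "\<odot>" 70) and star :: "'a \<Rightarrow> 'a \<Rightarrow> 'a" (infixl "\<star>" 70) +
  assumes circ_star: "\<lbrakk>a \<in> S; b \<in> S; c \<in> S\<rbrakk> \<Longrightarrow> (a \<odot> b) \<star> c = a \<odot> (b \<star> c) + b \<odot> (a \<star> c)"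
    and star_circ: "\<lbrakk>a \<in> S; b \<in> S; c \<in> S\<rbrakk> \<Longrightarrow> (a \<star> b) \<odot> c = a \<star> (b \<odot> c) - b \<odot> (a \<star> c)"
    and star_circ_skew: "\<lbrakk>a \<in> S; b \<in> S; c \<in> S\<rbrakk> \<Longrightarrow> (a \<star> b) \<odot> c = - ((b \<star> a) \<odot> c)"

section \<open>Graded spaces and completed tensor products\<close>

text \<open>
  A \<open>\<int>\<close>-graded space is an independent family \<open>A\<close> of finite-dimensional subspaces of the ambient
  space. The space itself is \<open>gcarrier s A\<close>, their internal direct sum, which need not be the
  whole type.
\<close>

definition gcarrier :: "('k::field \<Rightarrow> 'a::ab_group_add \<Rightarrow> 'a) \<Rightarrow> (int \<Rightarrow> 'a set) \<Rightarrow> 'a set"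
  where "gcarrier s A = module.span s (\<Union>i. A i)"

text \<open>The homogeneous component of degree \<open>i\<close> of an element.\<close>

definition hcomp :: "(int \<Rightarrow> 'a::ab_group_add set) \<Rightarrow> int \<Rightarrow> 'a \<Rightarrow> 'a"
  where "hcomp A i a =
    (THE c. (\<forall>j. c j \<in> A j) \<and> finite {j. c j \<noteq> 0} \<and> a = Sum_any c) i"

text \<open>
  An element \<open>\<Sum>\<^bsub>i,j,\<alpha>\<^esub> u\<^bsub>i,\<alpha>\<^esub> \<otimes> v\<^bsub>j,\<alpha>\<^esub>\<close> of the completed tensor square of \<open>A\<close> is the family of its
  components \<open>x i j \<in> A i \<otimes> A j\<close>; the completed tensor cube consists of families indexed by three
  degrees.
\<close>

type_synonym ('a, 'k) ctensor2 = "int \<Rightarrow> int \<Rightarrow> ('a, 'a, 'k) tensor"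
type_synonym ('a, 'k) ctensor3 = "int \<Rightarrow> int \<Rightarrow> int \<Rightarrow> (('a, 'a, 'k) tensor, 'a, 'k) tensor"

definition ctensor_space ::
  "('k::field \<Rightarrow> 'a::ab_group_add \<Rightarrow> 'a) \<Rightarrow> (int \<Rightarrow> 'a set) \<Rightarrow> ('a, 'k) ctensor2 set"
  where "ctensor_space s A = {x. \<forall>i j. x i j \<in> tensor_space s s (A i) (A j)}"

definition cscale :: "'k::field \<Rightarrow> ('a, 'k) ctensor2 \<Rightarrow> ('a, 'k) ctensor2"
  where "cscale c x = (\<lambda>i j. fscale c (x i j))"

text \<open>
  Completed maps are defined termwise and the resulting terms are sorted by degree. \<open>Sum_any\<close>
  adds up the nonzero contributions; it is \<open>0\<close> by convention if there are infinitely many.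
  For \<open>cmap\<close> this does not occur when \<open>f\<close> and \<open>g\<close> are identities or one-sided multiplications of
  a graded algebra; for \<open>cleft\<close> and \<open>cright\<close> finiteness is the separate requirement
  \<open>cleft_finite\<close>, \<open>cright_finite\<close>.
\<close>

definition cmap ::
  "('k::field \<Rightarrow> 'a::ab_group_add \<Rightarrow> 'a) \<Rightarrow> (int \<Rightarrow> 'a set) \<Rightarrow> ('a \<Rightarrow> 'a) \<Rightarrow> ('a \<Rightarrow> 'a) \<Rightarrow>
   ('a, 'k) ctensor2 \<Rightarrow> ('a, 'k) ctensor2"
  where "cmap s A f g x = (\<lambda>k l. Sum_any (\<lambda>(i, j).
    tmap s (A i) (A j) (\<lambda>u. hcomp A k (f u)) (\<lambda>v. hcomp A l (g v)) (x i j)))"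

definition cflip ::
  "('k::field \<Rightarrow> 'a::ab_group_add \<Rightarrow> 'a) \<Rightarrow> (int \<Rightarrow> 'a set) \<Rightarrow> ('a, 'k) ctensor2 \<Rightarrow> ('a, 'k) ctensor2"
  where "cflip s A x = (\<lambda>i j. tflip s (A j) (A i) (x j i))"

definition cleft_term ::
  "('k::field \<Rightarrow> 'a::ab_group_add \<Rightarrow> 'a) \<Rightarrow> (int \<Rightarrow> 'a set) \<Rightarrow> ('a \<Rightarrow> ('a, 'k) ctensor2) \<Rightarrow>
   ('a, 'k) ctensor2 \<Rightarrow> int \<Rightarrow> ('a, 'k) ctensor3"
  where "cleft_term s A f x l = (\<lambda>i j k. tleft s (A l) (A k) (\<lambda>u. f u i j) (x l k))"

definition cright_term ::
  "('k::field \<Rightarrow> 'a::ab_group_add \<Rightarrow> 'a) \<Rightarrow> (int \<Rightarrow> 'a set) \<Rightarrow> ('a \<Rightarrow> ('a, 'k) ctensor2) \<Rightarrow>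
   ('a, 'k) ctensor2 \<Rightarrow> int \<Rightarrow> ('a, 'k) ctensor3"
  where "cright_term s A f x l =
    (\<lambda>i j k. tright s (A i) (A l) (A j) (A k) (\<lambda>v. f v j k) (x i l))"

definition cleft ::
  "('k::field \<Rightarrow> 'a::ab_group_add \<Rightarrow> 'a) \<Rightarrow> (int \<Rightarrow> 'a set) \<Rightarrow> ('a \<Rightarrow> ('a, 'k) ctensor2) \<Rightarrow>
   ('a, 'k) ctensor2 \<Rightarrow> ('a, 'k) ctensor3"
  where "cleft s A f x = (\<lambda>i j k. Sum_any (\<lambda>l. cleft_term s A f x l i j k))"

definition cright ::
  "('k::field \<Rightarrow> 'a::ab_group_add \<Rightarrow> 'a) \<Rightarrow> (int \<Rightarrow> 'a set) \<Rightarrow> ('a \<Rightarrow> ('a, 'k) ctensor2) \<Rightarrow>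
   ('a, 'k) ctensor2 \<Rightarrow> ('a, 'k) ctensor3"
  where "cright s A f x = (\<lambda>i j k. Sum_any (\<lambda>l. cright_term s A f x l i j k))"

definition cleft_finite ::
  "('k::field \<Rightarrow> 'a::ab_group_add \<Rightarrow> 'a) \<Rightarrow> (int \<Rightarrow> 'a set) \<Rightarrow> ('a \<Rightarrow> ('a, 'k) ctensor2) \<Rightarrow>
   ('a, 'k) ctensor2 \<Rightarrow> bool"
  where "cleft_finite s A f x \<longleftrightarrow> (\<forall>i j k. finite {l. cleft_term s A f x l i j k \<noteq> 0})"

definition cright_finite ::
  "('k::field \<Rightarrow> 'a::ab_group_add \<Rightarrow> 'a) \<Rightarrow> (int \<Rightarrow> 'a set) \<Rightarrow> ('a \<Rightarrow> ('a, 'k) ctensor2) \<Rightarrow>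
   ('a, 'k) ctensor2 \<Rightarrow> bool"
  where "cright_finite s A f x \<longleftrightarrow> (\<forall>i j k. finite {l. cright_term s A f x l i j k \<noteq> 0})"

definition cflip12 ::
  "('k::field \<Rightarrow> 'a::ab_group_add \<Rightarrow> 'a) \<Rightarrow> (int \<Rightarrow> 'a set) \<Rightarrow> ('a, 'k) ctensor3 \<Rightarrow> ('a, 'k) ctensor3"
  where "cflip12 s A x = (\<lambda>i j k. tflip12 s (A j) (A i) (A k) (x j i k))"

locale graded_space = vector_space s
  for s :: "'k::field \<Rightarrow> 'a::ab_group_add \<Rightarrow> 'a" +
  fixes A :: "int \<Rightarrow> 'a set"
  assumes component_subspace: "subspace (A i)"
    and component_fin_dim: "fin_dim s (A i)"
    and component_independent:
      "\<lbrakk>\<And>i. c i \<in> A i; finite {i. c i \<noteq> 0}; Sum_any c = 0\<rbrakk> \<Longrightarrow> c i = 0"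
begin

abbreviation G :: "'a set" where "G \<equiv> gcarrier s A"

abbreviation map_tensor (infixr "\<otimes>\<^sub>c" 80) where "f \<otimes>\<^sub>c g \<equiv> cmap s A f g"

abbreviation flip ("\<tau>") where "\<tau> \<equiv> cflip s A"

abbreviation flip12 ("\<tau>\<^sub>1\<^sub>2") where "\<tau>\<^sub>1\<^sub>2 \<equiv> cflip12 s A"

end

locale graded_perm_algebra =
  graded_space s A + perm_algebra s "gcarrier s A" circ
  for s :: "'k::field \<Rightarrow> 'a::ab_group_add \<Rightarrow> 'a" and A
    and circ :: "'a \<Rightarrow> 'a \<Rightarrow> 'a" (infixl "\<odot>" 70) +
  assumes circ_graded: "\<lbrakk>a \<in> A i; b \<in> A j\<rbrakk> \<Longrightarrow> a \<odot> b \<in> A (i + j)"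

locale graded_DPP_algebra =
  graded_space s A + DPP_algebra s "gcarrier s A" circ star
  for s :: "'k::field \<Rightarrow> 'a::ab_group_add \<Rightarrow> 'a" and A
    and circ :: "'a \<Rightarrow> 'a \<Rightarrow> 'a" (infixl "\<odot>" 70) and star :: "'a \<Rightarrow> 'a \<Rightarrow> 'a" (infixl "\<star>" 70) +
  assumes circ_graded: "\<lbrakk>a \<in> A i; b \<in> A j\<rbrakk> \<Longrightarrow> a \<odot> b \<in> A (i + j)"
    and star_graded: "\<lbrakk>a \<in> A i; b \<in> A j\<rbrakk> \<Longrightarrow> a \<star> b \<in> A (i + j)"
begin

abbreviation L where "L a \<equiv> \<lambda>b. a \<odot> b"
abbreviation R where "R a \<equiv> \<lambda>b. b \<odot> a"
abbreviation L' where "L' a \<equiv> \<lambda>b. a \<star> b"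
abbreviation R' where "R' a \<equiv> \<lambda>b. b \<star> a"

end

locale quadratic_graded_perm_algebra = graded_perm_algebra s B circ
  for s :: "'k::field \<Rightarrow> 'b::ab_group_add \<Rightarrow> 'b" and B
    and circ :: "'b \<Rightarrow> 'b \<Rightarrow> 'b" (infixl "\<odot>" 70) +
  fixes \<omega> :: "'b \<Rightarrow> 'b \<Rightarrow> 'k"
  assumes form_bilinear: "bilinear_on s s (*) (gcarrier s B) (gcarrier s B) \<omega>"
    and form_skew: "\<lbrakk>a \<in> gcarrier s B; b \<in> gcarrier s B\<rbrakk> \<Longrightarrow> \<omega> a b = - \<omega> b a"
    and form_nondegenerate:
      "\<lbrakk>a \<in> gcarrier s B; \<And>b. b \<in> gcarrier s B \<Longrightarrow> \<omega> a b = 0\<rbrakk> \<Longrightarrow> a = 0"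
    and form_invariant:
      "\<lbrakk>a \<in> gcarrier s B; b \<in> gcarrier s B; c \<in> gcarrier s B\<rbrakk> \<Longrightarrow> \<omega> (a \<odot> b) c = \<omega> a (b \<odot> c - c \<odot> b)"
    and form_graded:
      "\<exists>m. \<forall>i j. i + j + m \<noteq> 0 \<longrightarrow> (\<forall>a\<in>B i. \<forall>b\<in>B j. \<omega> a b = 0)"

section \<open>Completed DPP bialgebras\<close>

locale completed_DPP_coalgebra = graded_space s A
  for s :: "'k::field \<Rightarrow> 'a::ab_group_add \<Rightarrow> 'a" and A +
  fixes \<nu> \<theta> :: "'a \<Rightarrow> ('a, 'k) ctensor2"
  assumes nu_linear: "linear_on s cscale G \<nu>"
    and nu_in: "a \<in> G \<Longrightarrow> \<nu> a \<in> ctensor_space s A"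
    and theta_linear: "linear_on s cscale G \<theta>"
    and theta_in: "a \<in> G \<Longrightarrow> \<theta> a \<in> ctensor_space s A"
    and composites_finite:
      "\<lbrakk>f \<in> {\<nu>, \<theta>}; g \<in> {\<nu>, \<theta>}; a \<in> G\<rbrakk> \<Longrightarrow> cleft_finite s A f (g a) \<and> cright_finite s A f (g a)"
    and nu_coassociative: "a \<in> G \<Longrightarrow> cleft s A \<nu> (\<nu> a) = cright s A \<nu> (\<nu> a)"
    and nu_coperm: "a \<in> G \<Longrightarrow> cright s A \<nu> (\<nu> a) = \<tau>\<^sub>1\<^sub>2 (cleft s A \<nu> (\<nu> a))"
    and theta_coleibniz:
      "a \<in> G \<Longrightarrow> cright s A \<theta> (\<theta> a) = cleft s A \<theta> (\<theta> a) + \<tau>\<^sub>1\<^sub>2 (cright s A \<theta> (\<theta> a))"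
    and nu_theta_right:
      "a \<in> G \<Longrightarrow> cright s A \<nu> (\<theta> a) = cleft s A \<theta> (\<nu> a) + \<tau>\<^sub>1\<^sub>2 (cright s A \<theta> (\<nu> a))"
    and nu_theta_left:
      "a \<in> G \<Longrightarrow> cleft s A \<nu> (\<theta> a) = cright s A \<theta> (\<nu> a) + \<tau>\<^sub>1\<^sub>2 (cright s A \<theta> (\<nu> a))"
    and theta_nu_skew: "a \<in> G \<Longrightarrow> cleft s A \<theta> (\<nu> a) = - \<tau>\<^sub>1\<^sub>2 (cleft s A \<theta> (\<nu> a))"
begin

abbreviation nu_minus ("\<nu>\<^sup>-") where "\<nu>\<^sup>- a \<equiv> \<nu> a - \<tau> (\<nu> a)"
abbreviation theta_plus ("\<theta>\<^sup>+") where "\<theta>\<^sup>+ a \<equiv> \<theta> a + \<tau> (\<theta> a)"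

end

locale completed_DPP_bialgebra =
  graded_DPP_algebra s A circ star + completed_DPP_coalgebra s A \<nu> \<theta>
  for s :: "'k::field \<Rightarrow> 'a::ab_group_add \<Rightarrow> 'a" and A
    and circ :: "'a \<Rightarrow> 'a \<Rightarrow> 'a" (infixl "\<odot>" 70) and star :: "'a \<Rightarrow> 'a \<Rightarrow> 'a" (infixl "\<star>" 70)
    and \<nu> \<theta> :: "'a \<Rightarrow> ('a, 'k) ctensor2" +
  assumes perm_bialgebra1:
      "\<lbrakk>a \<in> G; b \<in> G\<rbrakk> \<Longrightarrow> (R a \<otimes>\<^sub>c id) (\<nu> b) = \<tau> ((R b \<otimes>\<^sub>c id) (\<nu> a))"
    and perm_bialgebra2:
      "\<lbrakk>a \<in> G; b \<in> G\<rbrakk> \<Longrightarrow> \<nu> (a \<odot> b) = ((L a - R a) \<otimes>\<^sub>c id) (\<nu> b) + (id \<otimes>\<^sub>c R b) (\<nu> a)"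
    and perm_bialgebra3:
      "\<lbrakk>a \<in> G; b \<in> G\<rbrakk> \<Longrightarrow> \<nu> (a \<odot> b) = (id \<otimes>\<^sub>c L a) (\<nu> b) + ((L b - R b) \<otimes>\<^sub>c id) (\<nu>\<^sup>- a)"
    and leibniz_bialgebra1:
      "\<lbrakk>a \<in> G; b \<in> G\<rbrakk> \<Longrightarrow> \<tau> ((R' b \<otimes>\<^sub>c id) (\<theta> a)) = (R' a \<otimes>\<^sub>c id) (\<theta> b)"
    and leibniz_bialgebra2:
      "\<lbrakk>a \<in> G; b \<in> G\<rbrakk> \<Longrightarrow> \<theta> (a \<star> b) =
         ((id \<otimes>\<^sub>c R' b) (\<theta>\<^sup>+ a) - ((L' b + R' b) \<otimes>\<^sub>c id) (\<theta>\<^sup>+ a))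
       + ((id \<otimes>\<^sub>c L' a) (\<theta> b) + (L' a \<otimes>\<^sub>c id) (\<theta> b))"
    and DPP_bialgebra1:
      "\<lbrakk>a \<in> G; b \<in> G\<rbrakk> \<Longrightarrow> \<nu> (a \<star> b) =
         ((id \<otimes>\<^sub>c L' a) (\<nu> b) + (L' a \<otimes>\<^sub>c id) (\<nu> b))
       + (((L b - R b) \<otimes>\<^sub>c id) (\<theta>\<^sup>+ a) - (id \<otimes>\<^sub>c R b) (\<theta>\<^sup>+ a))"
    and DPP_bialgebra2:
      "\<lbrakk>a \<in> G; b \<in> G\<rbrakk> \<Longrightarrow> \<theta> (a \<odot> b) =
         (id \<otimes>\<^sub>c L a) (\<theta> b) + (id \<otimes>\<^sub>c R b) (\<theta> a)
       - ((L' a + R' a) \<otimes>\<^sub>c id) (\<nu> b) - ((L' b + R' b) \<otimes>\<^sub>c id) (\<nu>\<^sup>- a)"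
    and DPP_bialgebra3:
      "\<lbrakk>a \<in> G; b \<in> G\<rbrakk> \<Longrightarrow> (id \<otimes>\<^sub>c R' a) (\<tau> (\<nu> b)) = - (R b \<otimes>\<^sub>c id) (\<theta> a)"
    and DPP_bialgebra4:
      "\<lbrakk>a \<in> G; b \<in> G\<rbrakk> \<Longrightarrow> \<nu> (a \<star> b) =
         ((id \<otimes>\<^sub>c L a) (\<theta> b) - (L a \<otimes>\<^sub>c id) (\<theta> b))
       + ((id \<otimes>\<^sub>c R' b) (\<nu>\<^sup>- a) - ((L' b + R' b) \<otimes>\<^sub>c id) (\<nu>\<^sup>- a))"
    and DPP_bialgebra5:
      "\<lbrakk>a \<in> G; b \<in> G\<rbrakk> \<Longrightarrow> \<theta>\<^sup>+ (a \<odot> b) =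
         (id \<otimes>\<^sub>c L a) (\<theta>\<^sup>+ b) + (id \<otimes>\<^sub>c L b) (\<theta>\<^sup>+ a)
       - (L' a \<otimes>\<^sub>c id) (\<nu>\<^sup>- b) - (L' b \<otimes>\<^sub>c id) (\<nu>\<^sup>- a)"
    and DPP_bialgebra6:
      "\<lbrakk>a \<in> G; b \<in> G\<rbrakk> \<Longrightarrow> \<theta> (a \<odot> b) =
         (L a \<otimes>\<^sub>c id) (\<theta> b) - (id \<otimes>\<^sub>c R' b) (\<nu>\<^sup>- a)
       + (id \<otimes>\<^sub>c L' a) (\<nu> b) + ((L b - R b) \<otimes>\<^sub>c id) (\<theta>\<^sup>+ a)"
    and DPP_bialgebra7:
      "\<lbrakk>a \<in> G; b \<in> G\<rbrakk> \<Longrightarrow> \<nu> (a \<star> b + b \<star> a) =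
         (id \<otimes>\<^sub>c (L' a + R' a)) (\<nu> b) + ((L' a + R' a) \<otimes>\<^sub>c id) (\<tau> (\<nu> b))
       + (id \<otimes>\<^sub>c (L b - R b)) (\<theta> a) + ((L b - R b) \<otimes>\<^sub>c id) (\<tau> (\<theta> a))"

section \<open>The structure on the tensor product of a Poisson bialgebra and a perm algebra\<close>

text \<open>\<open>form_hat s B \<omega> x b b'\<close> is the value of the extended form at \<open>x\<close> and \<open>b \<otimes> b'\<close>.\<close>

definition form_hat ::
  "('k::field \<Rightarrow> 'b::ab_group_add \<Rightarrow> 'b) \<Rightarrow> (int \<Rightarrow> 'b set) \<Rightarrow> ('b \<Rightarrow> 'b \<Rightarrow> 'k) \<Rightarrow>
   ('b, 'k) ctensor2 \<Rightarrow> 'b \<Rightarrow> 'b \<Rightarrow> 'k"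
  where "form_hat s B \<omega> x b b' =
    Sum_any (\<lambda>(i, j). tlift s s (B i) (B j) (\<lambda>u v. \<omega> u b * \<omega> v b') (x i j))"

definition tensor_grading ::
  "('k::field \<Rightarrow> 'p::ab_group_add \<Rightarrow> 'p) \<Rightarrow> ('k \<Rightarrow> 'b::ab_group_add \<Rightarrow> 'b) \<Rightarrow> (int \<Rightarrow> 'b set) \<Rightarrow>
   int \<Rightarrow> ('p, 'b, 'k) tensor set"
  where "tensor_grading sP sB B i = tensor_space sP sB UNIV (B i)"

text \<open>The product with \<open>(p \<otimes> b) (q \<otimes> c) = mP p q \<otimes> mB b c\<close>.\<close>

definition tensor_mult ::
  "('k::field \<Rightarrow> 'p::ab_group_add \<Rightarrow> 'p) \<Rightarrow> ('k \<Rightarrow> 'b::ab_group_add \<Rightarrow> 'b) \<Rightarrow> (int \<Rightarrow> 'b set) \<Rightarrow>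
   ('p \<Rightarrow> 'p \<Rightarrow> 'p) \<Rightarrow> ('b \<Rightarrow> 'b \<Rightarrow> 'b) \<Rightarrow>
   ('p, 'b, 'k) tensor \<Rightarrow> ('p, 'b, 'k) tensor \<Rightarrow> ('p, 'b, 'k) tensor"
  where "tensor_mult sP sB B mP mB x y =
    tlift sP sB UNIV (gcarrier sB B)
      (\<lambda>p b. tlift sP sB UNIV (gcarrier sB B) (\<lambda>q c. tensor sP sB (mP p q) (mB b c)) y) x"

definition bullet ::
  "('k::field \<Rightarrow> 'p::ab_group_add \<Rightarrow> 'p) \<Rightarrow> ('k \<Rightarrow> 'b::ab_group_add \<Rightarrow> 'b) \<Rightarrow> (int \<Rightarrow> 'b set) \<Rightarrow>
   ('p, 'p, 'k) tensor \<Rightarrow> ('b, 'k) ctensor2 \<Rightarrow> (('p, 'b, 'k) tensor, 'k) ctensor2"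
  where "bullet sP sB B t x = (\<lambda>i j. tlift sP sP UNIV UNIV
    (\<lambda>p q. tlift sB sB (B i) (B j)
      (\<lambda>u v. tensor fscale fscale (tensor sP sB p u) (tensor sP sB q v)) (x i j)) t)"

text \<open>The linear map with \<open>p \<otimes> b \<mapsto> D p \<bullet> N b\<close>.\<close>

definition tensor_comult ::
  "('k::field \<Rightarrow> 'p::ab_group_add \<Rightarrow> 'p) \<Rightarrow> ('k \<Rightarrow> 'b::ab_group_add \<Rightarrow> 'b) \<Rightarrow> (int \<Rightarrow> 'b set) \<Rightarrow>
   ('p \<Rightarrow> ('p, 'p, 'k) tensor) \<Rightarrow> ('b \<Rightarrow> ('b, 'k) ctensor2) \<Rightarrow>
   ('p, 'b, 'k) tensor \<Rightarrow> (('p, 'b, 'k) tensor, 'k) ctensor2"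
  where "tensor_comult sP sB B D N =
    tlift sP sB UNIV (gcarrier sB B) (\<lambda>p b. bullet sP sB B (D p) (N b))"

end

theory Submission
  imports Defs
begin

text \<open>
  Since \<open>\<omega>\<close> is nondegenerate and graded, the degree \<open>i\<close> component of \<open>P \<otimes> B\<close> is separated by the
  functionals \<open>\<langle>\<phi>, c\<rangle> : p \<otimes> b \<mapsto> \<phi>(p) \<omega>(b, c)\<close> with \<open>\<phi> \<in> P\<^sup>*\<close> and \<open>c\<close> homogeneous of degree \<open>- m - i\<close>, and
  products of such functionals separate the components of the completed tensor powers. In these
  terms \<open>\<nu>\<close> becomes the bilinear operation \<open>\<langle>\<nu>(x), \<langle>\<phi>, c\<rangle> \<otimes> \<langle>\<psi>, d\<rangle>\<rangle> = - \<langle>\<Delta>\<^sup>*(\<phi> \<otimes> \<psi>), c d\<rangle>(x)\<close>, and likewise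
  for \<open>\<theta>\<close> and \<open>\<delta>\<close>, so no infinite sum survives and each identity becomes a scalar one. The coalgebra identities
  reduce to the dual Poisson identities for \<open>\<Delta>\<^sup>*\<close>, \<open>\<delta>\<^sup>*\<close> and to the perm identities of \<open>B\<close>. The
  compatibility conditions are biadditive, hence need only be checked on homogeneous pure tensors;
  there multiplications are moved across \<open>\<omega>\<close>, every \<open>B\<close>-factor is a combination of three
  words, and the coefficients are consequences of the compatibility conditions of the Poisson bialgebra.
\<close>

section \<open>Linear maps and tensor products\<close>

text \<open>The obstacle is that \<open>cmap\<close> sums over all pairs of degrees through
  \<open>Sum_any\<close>, which is additive only when finitely many terms are nonzero, while
  multiplication by a general element of \<open>P \<otimes> B\<close> is not homogeneous. Hence two
  classes of operators: \<open>bounded_map\<close>, which moves degrees by finitely many amounts and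
  serves to prove biadditivity, and \<open>shift_map\<close>, for which \<open>cmap\<close> is a
  single \<open>tmap\<close> and can be evaluated. The scalar computation is short because of the
  adjoints. For the commutative product, L, R and L - R by \<open>b\<close> turn the letter
  \<open>c\<close> of a functional into bc, bc - cb and cb; for the bracket, L, R and L + R give bc,
  cb - bc and cb. In a perm word the order of the letters before the last is immaterial, so a
  commutator followed by a letter is zero. This settles the three conditions that contain right
  multiplications only: both of their sides vanish. In each of the others all terms carry the same
  combination of words, and what remains is one condition on \<open>\<Delta>\<close> or
  \<open>\<delta>\<close>, sometimes combined with the skewness of the bracket.\<close>

abbreviation functional :: "('k::field \<Rightarrow> 'a::ab_group_add \<Rightarrow> 'a) \<Rightarrow> ('a \<Rightarrow> 'k) \<Rightarrow> bool"
  where "functional s \<phi> \<equiv> linear_on s (*) UNIV \<phi>"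

abbreviation bilinear_form ::
  "('k::field \<Rightarrow> 'u::ab_group_add \<Rightarrow> 'u) \<Rightarrow> ('k \<Rightarrow> 'v::ab_group_add \<Rightarrow> 'v) \<Rightarrow> ('u \<Rightarrow> 'v \<Rightarrow> 'k) \<Rightarrow> bool"
  where "bilinear_form sU sV \<equiv> bilinear_on sU sV (*) UNIV UNIV"

text \<open>A tensor is a function on bilinear forms, so the value at \<open>t\<close> of the
  functional induced by \<open>\<phi>\<close> and \<open>\<psi>\<close> is the plain application
  \<open>t (\<phi> \<otimes>\<^sub>f \<psi>)\<close>. All scalar identities take this shape.\<close>

definition prod_form :: "('u \<Rightarrow> 'k::times) \<Rightarrow> ('v \<Rightarrow> 'k) \<Rightarrow> 'u \<Rightarrow> 'v \<Rightarrow> 'k" (infixr "\<otimes>\<^sub>f" 75)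
  where "\<phi> \<otimes>\<^sub>f \<psi> = (\<lambda>u v. \<phi> u * \<psi> v)"

lemma bilinear_prod_form:
  "functional sU \<phi> \<Longrightarrow> functional sV \<psi> \<Longrightarrow> bilinear_form sU sV (\<phi> \<otimes>\<^sub>f \<psi>)"
  by (auto simp: bilinear_on_def linear_on_def prod_form_def algebra_simps)

lemma linear_onI [intro?]:
  assumes "\<And>x y. x \<in> S \<Longrightarrow> y \<in> S \<Longrightarrow> f (x + y) = f x + f y"
    and "\<And>c x. x \<in> S \<Longrightarrow> f (s c x) = t c (f x)"
  shows "linear_on s t S f"
  using assms by (auto simp: linear_on_def)

lemma linear_on_add: "linear_on s t S f \<Longrightarrow> x \<in> S \<Longrightarrow> y \<in> S \<Longrightarrow> f (x + y) = f x + f y"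
  and linear_on_scale: "linear_on s t S f \<Longrightarrow> x \<in> S \<Longrightarrow> f (s c x) = t c (f x)"
  by (auto simp: linear_on_def)

lemma linear_on_zero:
  assumes "linear_on s t S f" "0 \<in> S"
  shows "f 0 = 0"
  using linear_on_add[OF assms(1) assms(2,2)] by simp

lemma bilinear_on_add_left:
    "bilinear_on s t r S T f \<Longrightarrow> x \<in> S \<Longrightarrow> x' \<in> S \<Longrightarrow> y \<in> T \<Longrightarrow> f (x + x') y = f x y + f x' y"
  and bilinear_on_add_right:
    "bilinear_on s t r S T f \<Longrightarrow> x \<in> S \<Longrightarrow> y \<in> T \<Longrightarrow> y' \<in> T \<Longrightarrow> f x (y + y') = f x y + f x y'"
  and bilinear_on_scale_left:
    "bilinear_on s t r S T f \<Longrightarrow> x \<in> S \<Longrightarrow> y \<in> T \<Longrightarrow> f (s c x) y = r c (f x y)"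
  and bilinear_on_scale_right:
    "bilinear_on s t r S T f \<Longrightarrow> x \<in> S \<Longrightarrow> y \<in> T \<Longrightarrow> f x (t c y) = r c (f x y)"
  by (auto simp: bilinear_on_def linear_on_def)

lemma bilinear_on_zero_left: "bilinear_on s t r S T f \<Longrightarrow> 0 \<in> S \<Longrightarrow> y \<in> T \<Longrightarrow> f 0 y = 0"
  by (auto simp: bilinear_on_def dest: linear_on_zero)

lemma bilinear_on_zero_right: "bilinear_on s t r S T f \<Longrightarrow> x \<in> S \<Longrightarrow> 0 \<in> T \<Longrightarrow> f x 0 = 0"
  by (auto simp: bilinear_on_def dest: linear_on_zero)

lemma linear_on_sum:
  assumes "linear_on s t S f" "0 \<in> S" "\<And>x y. x \<in> S \<Longrightarrow> y \<in> S \<Longrightarrow> x + y \<in> S" "\<And>i. i \<in> I \<Longrightarrow> g i \<in> S"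
  shows "f (\<Sum>i\<in>I. g i) = (\<Sum>i\<in>I. f (g i))"
proof -
  have "(\<Sum>i\<in>I. g i) \<in> S \<and> f (\<Sum>i\<in>I. g i) = (\<Sum>i\<in>I. f (g i))"
    using assms(4)
    by (induction I rule: infinite_finite_induct)
      (auto simp: assms(2,3) linear_on_zero[OF assms(1,2)] linear_on_add[OF assms(1)])
  then show ?thesis ..
qed

lemma functional_zero: "functional s \<phi> \<Longrightarrow> \<phi> 0 = 0"
  and functional_neg: "functional s \<phi> \<Longrightarrow> \<phi> (- x) = - \<phi> x"
  and functional_diff: "functional s \<phi> \<Longrightarrow> \<phi> (x - y) = \<phi> x - \<phi> y"
proof -
  assume \<phi>: "functional s \<phi>"
  show 0: "\<phi> 0 = 0" using linear_on_zero[OF \<phi>] by simp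
  have "\<phi> (- x) + \<phi> x = 0" for x
    using linear_on_add[OF \<phi>, of "- x" x] 0 by simp
  then show neg: "\<phi> (- x) = - \<phi> x" for x by (simp add: eq_neg_iff_add_eq_0)
  show "\<phi> (x - y) = \<phi> x - \<phi> y"
    using linear_on_add[OF \<phi>, of x "- y"] neg by simp
qed

lemma functional_cmult: "functional s \<phi> \<Longrightarrow> functional s (\<lambda>p. k * \<phi> p)"
  by (auto simp: linear_on_def algebra_simps)

lemma functional_ev_comp: "linear_on s fscale UNIV D \<Longrightarrow> functional s (\<lambda>p. D p \<beta>)"
  by (auto simp: linear_on_def fscale_def)

lemma functional_comp: "linear_on s s UNIV f \<Longrightarrow> functional s \<phi> \<Longrightarrow> functional s (\<lambda>p. \<phi> (f p))"
  by (auto simp: linear_on_def)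

lemma sum_apply: "(\<Sum>i\<in>I. f i) x = (\<Sum>i\<in>I. f i x)"
  by (induction I rule: infinite_finite_induct) auto

lemma Sum_any_single:
  assumes "\<And>j. j \<noteq> i \<Longrightarrow> f j = 0"
  shows "Sum_any f = f i"
  using assms by (subst Sum_any.expand_superset[of "{i}"]) auto

section \<open>Pure tensors and the spaces they span\<close>

lemma bilinear_tensor: "bilinear_on sU sV fscale UNIV UNIV (tensor sU sV)"
  by (auto simp: bilinear_on_def linear_on_def tensor_def fscale_def fun_eq_iff)

lemmas tensor_add_left = bilinear_on_add_left[OF bilinear_tensor UNIV_I UNIV_I UNIV_I]
  and tensor_add_right = bilinear_on_add_right[OF bilinear_tensor UNIV_I UNIV_I UNIV_I]
  and tensor_scale_right = bilinear_on_scale_right[OF bilinear_tensor UNIV_I UNIV_I]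
  and tensor_zero_left = bilinear_on_zero_left[OF bilinear_tensor UNIV_I UNIV_I]
  and tensor_zero_right = bilinear_on_zero_right[OF bilinear_tensor UNIV_I UNIV_I]

lemma tensor_scale_pure: "tensor sU sV (sU c u) v = fscale c (tensor sU sV u v)"
  by (rule bilinear_on_scale_left[OF bilinear_tensor UNIV_I UNIV_I])

lemma tensor_apply: "bilinear_form sU sV \<beta> \<Longrightarrow> tensor sU sV u v \<beta> = \<beta> u v"
  by (simp add: tensor_def)

lemma subspace_tensor_space: "module.subspace fscale (tensor_space sU sV S T)"
proof -
  interpret F: vector_space "fscale :: 'a \<Rightarrow> (('b \<Rightarrow> 'c \<Rightarrow> 'a) \<Rightarrow> 'a) \<Rightarrow> _"
    by (rule vector_space_fscale)
  show ?thesis by (simp add: tensor_space_def F.subspace_span)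
qed

lemma module_fscale: "module (fscale :: 'k::field \<Rightarrow> ('x \<Rightarrow> 'k) \<Rightarrow> 'x \<Rightarrow> 'k)"
  using vector_space_fscale by (simp add: module_iff_vector_space)

lemma tensor_in: "u \<in> S \<Longrightarrow> v \<in> T \<Longrightarrow> tensor sU sV u v \<in> tensor_space sU sV S T"
  unfolding tensor_space_def by (rule module.span_base[OF module_fscale]) auto

lemmas tensor_space_add = module.subspace_add[OF module_fscale subspace_tensor_space]
  and tensor_space_diff = module.subspace_diff[OF module_fscale subspace_tensor_space]
  and tensor_space_neg = module.subspace_neg[OF module_fscale subspace_tensor_space]
  and tensor_space_scale = module.subspace_scale[OF module_fscale subspace_tensor_space]
  and tensor_space_zero = module.subspace_0[OF module_fscale subspace_tensor_space]

lemma tensor_space_mono: "S \<subseteq> S' \<Longrightarrow> T \<subseteq> T' \<Longrightarrow> tensor_space sU sV S T \<subseteq> tensor_space sU sV S' T'"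
  unfolding tensor_space_def by (rule module.span_mono[OF module_fscale]) auto

text \<open>No scalar case is needed: \<open>S\<close> is closed under scalars, so a multiple of a
  pure tensor is pure.\<close>

lemma tensor_space_induct [consumes 3, case_names zero pure add]:
  assumes "vector_space sU" "module.subspace sU S" "x \<in> tensor_space sU sV S T"
    and "P 0" "\<And>u v. u \<in> S \<Longrightarrow> v \<in> T \<Longrightarrow> P (tensor sU sV u v)"
    and "\<And>x y. x \<in> tensor_space sU sV S T \<Longrightarrow> y \<in> tensor_space sU sV S T \<Longrightarrow> P x \<Longrightarrow> P y \<Longrightarrow> P (x + y)"
  shows "P x"
proof -
  obtain xs where xs: "set xs \<subseteq> S \<times> T" "x = (\<Sum>(u, v)\<leftarrow>xs. tensor sU sV u v)"
    using assms(3) tensor_space_sum_list[OF assms(1,2)] by blast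
  have "(\<Sum>(u, v)\<leftarrow>xs. tensor sU sV u v) \<in> tensor_space sU sV S T \<and> P (\<Sum>(u, v)\<leftarrow>xs. tensor sU sV u v)"
    using xs(1)
  proof (induction xs)
    case Nil
    show ?case unfolding list.map sum_list.Nil using assms(4) tensor_space_zero by blast
  next
    case (Cons z zs)
    obtain u v where z: "z = (u, v)" "u \<in> S" "v \<in> T" using Cons.prems by auto
    have *: "tensor sU sV u v \<in> tensor_space sU sV S T" "P (tensor sU sV u v)"
      using z tensor_in assms(5) by blast+
    have **: "set zs \<subseteq> S \<times> T" using Cons.prems by simp
    show ?case
      unfolding list.map sum_list.Cons z(1) prod.case
      using assms(6) * Cons.IH[OF **] tensor_space_add by blast
  qed
  then show ?thesis using xs(2) by simp
qed

lemma tensor_space_sum_nth: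
  assumes "vector_space sU" "module.subspace sU S" "x \<in> tensor_space sU sV S T"
  obtains n u v where "\<And>i. i < (n::nat) \<Longrightarrow> u i \<in> S" "\<And>i. i < n \<Longrightarrow> v i \<in> T"
    "x = (\<Sum>i<n. tensor sU sV (u i) (v i))"
proof -
  obtain xs where xs: "set xs \<subseteq> S \<times> T" "x = (\<Sum>(u, v)\<leftarrow>xs. tensor sU sV u v)"
    using assms(3) tensor_space_sum_list[OF assms(1,2)] by blast
  have "x = (\<Sum>i<length xs. tensor sU sV (fst (xs ! i)) (snd (xs ! i)))"
    unfolding xs(2) sum_list_sum_nth by (auto simp: atLeast0LessThan case_prod_beta intro!: sum.cong)
  moreover have "xs ! i \<in> S \<times> T" if "i < length xs" for i
    using xs(1) that nth_mem by blast
  ultimately show thesis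
    using that[of "length xs" "\<lambda>i. fst (xs ! i)" "\<lambda>i. snd (xs ! i)"] by (simp add: mem_Times_iff)
qed

text \<open>\<open>tensor\<close> is 0 by convention on forms that are not bilinear. Equality of
  tensors, which are functions on all forms, is therefore decided by the bilinear ones.\<close>

lemma tensor_space_not_bilinear:
  assumes "vector_space sU" "module.subspace sU S" "x \<in> tensor_space sU sV S T"
    and "\<not> bilinear_form sU sV \<beta>"
  shows "x \<beta> = 0"
  using assms(1-3)
  by (induction rule: tensor_space_induct) (use assms(4) in \<open>auto simp: tensor_def\<close>)

text \<open>Linearity in the form, as opposed to linearity in \<open>t\<close>, is special to sums
  of pure tensors; an arbitrary function on forms does not have it.\<close>

lemma tensor_eval_scale_left:
  assumes "vector_space sU" "module.subspace sU S" "t \<in> tensor_space sU sV S T"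
    and "functional sU \<phi>" "functional sV \<psi>"
  shows "t ((\<lambda>u. k * \<phi> u) \<otimes>\<^sub>f \<psi>) = k * t (\<phi> \<otimes>\<^sub>f \<psi>)"
proof (rule tensor_space_induct[OF assms(1-3), where P = "\<lambda>t. t ((\<lambda>u. k * \<phi> u) \<otimes>\<^sub>f \<psi>) = k * t (\<phi> \<otimes>\<^sub>f \<psi>)"])
  have "functional sU (\<lambda>u. k * \<phi> u)" using assms(4) by (auto simp: linear_on_def algebra_simps)
  then show "tensor sU sV u v ((\<lambda>u. k * \<phi> u) \<otimes>\<^sub>f \<psi>) = k * tensor sU sV u v (\<phi> \<otimes>\<^sub>f \<psi>)" for u v
    using assms by (simp add: tensor_apply bilinear_prod_form) (simp add: prod_form_def)
qed (auto simp: algebra_simps)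

lemma tensor_eval_scale_right:
  assumes "vector_space sU" "module.subspace sU S" "t \<in> tensor_space sU sV S T"
    and "functional sU \<phi>" "functional sV \<psi>"
  shows "t (\<phi> \<otimes>\<^sub>f (\<lambda>v. k * \<psi> v)) = k * t (\<phi> \<otimes>\<^sub>f \<psi>)"
  using tensor_eval_scale_left[OF assms]
  by (simp add: prod_form_def mult.left_commute mult.assoc)

lemma tensor_eval_add_left:
  assumes "vector_space sU" "module.subspace sU S" "t \<in> tensor_space sU sV S T"
    and "functional sU \<phi>" "functional sU \<phi>'" "functional sV \<psi>"
  shows "t ((\<lambda>u. \<phi> u + \<phi>' u) \<otimes>\<^sub>f \<psi>) = t (\<phi> \<otimes>\<^sub>f \<psi>) + t (\<phi>' \<otimes>\<^sub>f \<psi>)"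
proof (rule tensor_space_induct[OF assms(1-3), where
      P = "\<lambda>t. t ((\<lambda>u. \<phi> u + \<phi>' u) \<otimes>\<^sub>f \<psi>) = t (\<phi> \<otimes>\<^sub>f \<psi>) + t (\<phi>' \<otimes>\<^sub>f \<psi>)"])
  have "functional sU (\<lambda>u. \<phi> u + \<phi>' u)" using assms(4,5) by (auto simp: linear_on_def algebra_simps)
  then show "tensor sU sV u v ((\<lambda>u. \<phi> u + \<phi>' u) \<otimes>\<^sub>f \<psi>) =
      tensor sU sV u v (\<phi> \<otimes>\<^sub>f \<psi>) + tensor sU sV u v (\<phi>' \<otimes>\<^sub>f \<psi>)" for u v
    using assms by (simp add: tensor_apply bilinear_prod_form) (simp add: prod_form_def algebra_simps)
qed auto

text \<open>Contract twice. The families separate only the subspaces \<open>S\<close> and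
  \<open>T\<close>, so each contraction is first seen to lie in its subspace; after the second one,
  one slot is free for arbitrary functionals, and a basis of the span of the left factors reduces
  every bilinear form to that case.\<close>

lemma tensor_space_separation:
  assumes U: "vector_space sU" "module.subspace sU S"
    and V: "vector_space sV" "module.subspace sV T"
    and x: "x \<in> tensor_space sU sV S T"
    and \<Phi>: "\<And>\<phi>. \<phi> \<in> \<Phi> \<Longrightarrow> functional sU \<phi>" "\<And>u. u \<in> S \<Longrightarrow> (\<And>\<phi>. \<phi> \<in> \<Phi> \<Longrightarrow> \<phi> u = 0) \<Longrightarrow> u = 0"
    and \<Psi>: "\<And>\<psi>. \<psi> \<in> \<Psi> \<Longrightarrow> functional sV \<psi>" "\<And>v. v \<in> T \<Longrightarrow> (\<And>\<psi>. \<psi> \<in> \<Psi> \<Longrightarrow> \<psi> v = 0) \<Longrightarrow> v = 0"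
    and zero: "\<And>\<phi> \<psi>. \<phi> \<in> \<Phi> \<Longrightarrow> \<psi> \<in> \<Psi> \<Longrightarrow> x (\<phi> \<otimes>\<^sub>f \<psi>) = 0"
  shows "x = 0"
proof -
  interpret U: vector_space sU by (fact U)
  interpret V: vector_space sV by (fact V)
  interpret UK: vector_space_pair sU "(*) :: 'a \<Rightarrow> 'a \<Rightarrow> 'a"
    by (simp add: vector_space_pair_def U vector_space_mult)
  interpret UU: vector_space_pair sU sU by (simp add: vector_space_pair_def U)
  obtain n u v where uv: "\<And>i. i < (n::nat) \<Longrightarrow> u i \<in> S" "\<And>i. i < n \<Longrightarrow> v i \<in> T"
    and x_eq: "x = (\<Sum>i<n. tensor sU sV (u i) (v i))"
    using tensor_space_sum_nth[OF U x] by metis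
  have ev: "x \<beta> = (\<Sum>i<n. \<beta> (u i) (v i))" if "bilinear_form sU sV \<beta>" for \<beta>
    using that by (simp add: x_eq sum_apply tensor_apply)
  have ev': "x (\<phi> \<otimes>\<^sub>f \<psi>) = (\<Sum>i<n. \<phi> (u i) * \<psi> (v i))" if "functional sU \<phi>" "functional sV \<psi>" for \<phi> \<psi>
    using ev[OF bilinear_prod_form[OF that]] by (simp add: prod_form_def)
  \<comment> \<open>Contraction of the right factor with a member of \<open>\<Psi>\<close>: it lies
    in \<open>S\<close>, and \<open>\<Phi>\<close> kills it because of \<open>zero\<close>.\<close>
  have A: "(\<Sum>i<n. sU (\<psi> (v i)) (u i)) = 0" if "\<psi> \<in> \<Psi>" for \<psi>
  proof (rule \<Phi>(2))
    show "(\<Sum>i<n. sU (\<psi> (v i)) (u i)) \<in> S"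
      using uv(1) by (intro U.subspace_sum[OF U(2)] U.subspace_scale[OF U(2)]) simp
    show "\<phi> (\<Sum>i<n. sU (\<psi> (v i)) (u i)) = 0" if "\<phi> \<in> \<Phi>" for \<phi>
      using zero[OF that \<open>\<psi> \<in> \<Psi>\<close>] ev'[OF \<Phi>(1)[OF that] \<Psi>(1)[OF \<open>\<psi> \<in> \<Psi>\<close>]]
      by (simp add: linear_on_sum[OF \<Phi>(1)[OF that]] linear_on_scale[OF \<Phi>(1)[OF that]] mult.commute)
  qed
  \<comment> \<open>The contraction of the left factor is tested against \<open>\<Psi>\<close>;
    exchanging the two scalars turns the value into \<open>\<phi>\<close> of the contraction in
    \<open>A\<close>. So \<open>\<phi>\<close> may be any functional, not just a member of
    \<open>\<Phi>\<close>.\<close>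
  have B: "(\<Sum>i<n. sV (\<phi> (u i)) (v i)) = 0" if \<phi>: "functional sU \<phi>" for \<phi>
  proof (rule \<Psi>(2))
    show "(\<Sum>i<n. sV (\<phi> (u i)) (v i)) \<in> T"
      using uv(2) by (intro V.subspace_sum[OF V(2)] V.subspace_scale[OF V(2)]) simp
    show "\<psi> (\<Sum>i<n. sV (\<phi> (u i)) (v i)) = 0" if "\<psi> \<in> \<Psi>" for \<psi>
    proof -
      have "\<psi> (\<Sum>i<n. sV (\<phi> (u i)) (v i)) = \<phi> (\<Sum>i<n. sU (\<psi> (v i)) (u i))"
        by (simp add: linear_on_sum[OF \<Psi>(1)[OF that]] linear_on_scale[OF \<Psi>(1)[OF that]]
            linear_on_sum[OF \<phi>] linear_on_scale[OF \<phi>] mult.commute)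
      then show ?thesis using A[OF that] linear_on_zero[OF \<phi>] by simp
    qed
  qed
  have "x \<beta> = 0" if \<beta>: "bilinear_form sU sV \<beta>" for \<beta>
  proof -
    obtain E where E: "E \<subseteq> u ` {..<n}" "U.independent E" "u ` {..<n} \<subseteq> U.span E"
      using U.maximal_independent_subset by blast
    then have fin: "finite E" using finite_subset by blast
    \<comment> \<open>Coordinate functionals of the basis \<open>E\<close>, extended to the whole
      type so that \<open>B\<close> applies to them.\<close>
    have "\<exists>\<phi>. functional sU \<phi> \<and> (\<forall>e'\<in>E. \<phi> e' = (if e' = e then 1 else 0))" for e
    proof -
      obtain \<phi> where "Vector_Spaces.linear sU (*) \<phi>" "\<forall>e'\<in>E. \<phi> e' = (if e' = e then 1 else 0)"
        using UK.linear_independent_extend[OF E(2), of "\<lambda>e'. if e' = e then 1 else 0"] by blast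
      then show ?thesis
        by (intro exI[of _ \<phi>]) (auto simp: linear_on_def Vector_Spaces.linear_iff)
    qed
    then obtain c where c: "\<And>e. functional sU (c e)" "\<And>e e'. e' \<in> E \<Longrightarrow> c e e' = (if e' = e then 1 else 0)"
      by metis
    have coord: "y = (\<Sum>e\<in>E. sU (c e y) e)" if "y \<in> U.span E" for y
      using that
    proof (induction rule: U.span_induct_alt)
      case base
      then show ?case by (simp add: linear_on_zero[OF c(1)])
    next
      case (step a z y)
      have "(\<Sum>e\<in>E. sU (c e (sU a z + y)) e) = sU a (\<Sum>e\<in>E. sU (c e z) e) + (\<Sum>e\<in>E. sU (c e y) e)"
        by (simp add: linear_on_add[OF c(1)] linear_on_scale[OF c(1)] U.scale_left_distrib
            sum.distrib U.scale_sum_right)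
      moreover have "(\<Sum>e\<in>E. sU (c e z) e) = z"
        using step(1) fin by (simp add: c(2) if_distrib[of "\<lambda>k. sU k _"] cong: if_cong)
      ultimately show ?case using step(2) by simp
    qed
    have lin: "functional sU (\<lambda>u. \<beta> u w)" "functional sV (\<beta> u)" for u w
      using \<beta> by (auto simp: bilinear_on_def)
    have "\<beta> (u i) (v i) = (\<Sum>e\<in>E. c e (u i) * \<beta> e (v i))" if "i < n" for i
    proof -
      have "u i = (\<Sum>e\<in>E. sU (c e (u i)) e)" using coord E(3) that by blast
      then have "\<beta> (u i) (v i) = \<beta> (\<Sum>e\<in>E. sU (c e (u i)) e) (v i)" by simp
      also have "\<dots> = (\<Sum>e\<in>E. c e (u i) * \<beta> e (v i))"
        by (simp add: linear_on_sum[OF lin(1)] linear_on_scale[OF lin(1)])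
      finally show ?thesis .
    qed
    then have "x \<beta> = (\<Sum>i<n. \<Sum>e\<in>E. c e (u i) * \<beta> e (v i))" by (simp add: ev[OF \<beta>])
    also have "\<dots> = (\<Sum>e\<in>E. \<beta> e (\<Sum>i<n. sV (c e (u i)) (v i)))"
      by (subst sum.swap) (simp add: linear_on_sum[OF lin(2)] linear_on_scale[OF lin(2)])
    also have "\<dots> = 0" by (simp add: B[OF c(1)] linear_on_zero[OF lin(2)])
    finally show ?thesis .
  qed
  then have "x \<beta> = 0" for \<beta>
    using tensor_space_not_bilinear[OF U x] by blast
  then show ?thesis by (simp add: fun_eq_iff)
qed

section \<open>The universal property of the tensor product\<close>

locale tensor_lift =
  fixes sU :: "'k::field \<Rightarrow> 'u::ab_group_add \<Rightarrow> 'u" and sV :: "'k \<Rightarrow> 'v::ab_group_add \<Rightarrow> 'v"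
    and sW :: "'k \<Rightarrow> 'w::ab_group_add \<Rightarrow> 'w" and S T f
  assumes U: "vector_space sU" "module.subspace sU S"
    and V: "vector_space sV" "module.subspace sV T"
    and W: "vector_space sW" and f: "bilinear_on sU sV sW S T f"
begin

lemma lift_zero: "tlift sU sV S T f 0 = 0"
  using tlift_sum_list[OF U V W f, of "[]"] by (simp add: zero_fun_def)

lemma lift_pure: "u \<in> S \<Longrightarrow> v \<in> T \<Longrightarrow> tlift sU sV S T f (tensor sU sV u v) = f u v"
  using tlift_sum_list[OF U V W f, of "[(u, v)]"] by simp

lemma lift_add:
  assumes "x \<in> tensor_space sU sV S T" "y \<in> tensor_space sU sV S T"
  shows "tlift sU sV S T f (x + y) = tlift sU sV S T f x + tlift sU sV S T f y"
proof -
  obtain xs ys where "set xs \<subseteq> S \<times> T" "x = (\<Sum>(u, v)\<leftarrow>xs. tensor sU sV u v)"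
    "set ys \<subseteq> S \<times> T" "y = (\<Sum>(u, v)\<leftarrow>ys. tensor sU sV u v)"
    using assms tensor_space_sum_list[OF U] by blast
  then show ?thesis
    using tlift_sum_list[OF U V W f, of xs] tlift_sum_list[OF U V W f, of ys]
      tlift_sum_list[OF U V W f, of "xs @ ys"] by simp
qed

lemma lift_scale:
  assumes "x \<in> tensor_space sU sV S T"
  shows "tlift sU sV S T f (fscale c x) = sW c (tlift sU sV S T f x)"
proof (rule tensor_space_induct[OF U assms,
    where P = "\<lambda>x. tlift sU sV S T f (fscale c x) = sW c (tlift sU sV S T f x)"])
  have "fscale c (0 :: ('u, 'v, 'k) tensor) = 0" by (simp add: fscale_def fun_eq_iff)
  then show "tlift sU sV S T f (fscale c 0) = sW c (tlift sU sV S T f 0)"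
    by (simp add: lift_zero module.scale_zero_right W module_iff_vector_space)
  show "tlift sU sV S T f (fscale c (tensor sU sV u v)) = sW c (tlift sU sV S T f (tensor sU sV u v))"
    if "u \<in> S" "v \<in> T" for u v
    using that module.subspace_scale[OF _ U(2)] U
    by (simp add: tensor_scale_pure[symmetric] lift_pure bilinear_on_scale_left[OF f] module_iff_vector_space)
next
  fix x y
  assume "x \<in> tensor_space sU sV S T" "y \<in> tensor_space sU sV S T"
    "tlift sU sV S T f (fscale c x) = sW c (tlift sU sV S T f x)"
    "tlift sU sV S T f (fscale c y) = sW c (tlift sU sV S T f y)"
  moreover have "fscale c (x + y) = fscale c x + fscale c y"
    by (simp add: fscale_def fun_eq_iff algebra_simps)
  ultimately show "tlift sU sV S T f (fscale c (x + y)) = sW c (tlift sU sV S T f (x + y))"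
    by (simp add: lift_add tensor_space_scale module.scale_right_distrib W module_iff_vector_space)
qed

lemma linear_lift: "linear_on fscale sW (tensor_space sU sV S T) (tlift sU sV S T f)"
  by (rule linear_onI) (auto simp: lift_add lift_scale)

lemma lift_in:
  assumes "x \<in> tensor_space sU sV S T" "module.subspace sW X" "\<And>u v. u \<in> S \<Longrightarrow> v \<in> T \<Longrightarrow> f u v \<in> X"
  shows "tlift sU sV S T f x \<in> X"
proof -
  have W': "module sW" using W by (simp add: module_iff_vector_space)
  show ?thesis
    by (rule tensor_space_induct[OF U assms(1), where P = "\<lambda>x. tlift sU sV S T f x \<in> X"])
      (auto simp: lift_zero lift_pure lift_add assms(3) module.subspace_0[OF W' assms(2)]
        module.subspace_add[OF W' assms(2)])
qed

text \<open>Only additivity of \<open>h\<close> is required, since scalars are absorbed into pure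
  tensors. With \<open>h\<close> an evaluation this yields all the formulas for induced maps; with
  \<open>h\<close> the identity it computes scalar-valued lifts.\<close>

lemma lift_eval:
  assumes "x \<in> tensor_space sU sV S T" "\<And>a b. h (a + b) = h a + (h b :: 'k)" "bilinear_form sU sV \<beta>"
    and "\<And>u v. u \<in> S \<Longrightarrow> v \<in> T \<Longrightarrow> h (f u v) = \<beta> u v"
  shows "h (tlift sU sV S T f x) = x \<beta>"
proof -
  have "h 0 + h 0 = h 0" using assms(2)[of 0 0] by simp
  then have "h 0 = 0" by (metis add_left_cancel add.right_neutral)
  then show ?thesis
    by (intro tensor_space_induct[OF U assms(1), where P = "\<lambda>x. h (tlift sU sV S T f x) = x \<beta>"])
      (use assms(2-4) in \<open>auto simp: lift_zero lift_pure lift_add tensor_apply\<close>)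
qed

end

lemma tlift_cong:
  assumes "\<And>u v. u \<in> S \<Longrightarrow> v \<in> T \<Longrightarrow> f u v = g u v"
  shows "tlift sU sV S T f = tlift sU sV S T g"
proof -
  have *: "(\<Sum>(u, v)\<leftarrow>xs. f u v) = (\<Sum>(u, v)\<leftarrow>xs. g u v)" if "set xs \<subseteq> S \<times> T" for xs
    using that assms by (auto intro!: arg_cong[of _ _ sum_list] map_cong)
  then have "(\<exists>xs. set xs \<subseteq> S \<times> T \<and> x = (\<Sum>(u, v)\<leftarrow>xs. tensor sU sV u v) \<and> y = (\<Sum>(u, v)\<leftarrow>xs. f u v))
    \<longleftrightarrow> (\<exists>xs. set xs \<subseteq> S \<times> T \<and> x = (\<Sum>(u, v)\<leftarrow>xs. tensor sU sV u v) \<and> y = (\<Sum>(u, v)\<leftarrow>xs. g u v))"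
    for x y by metis
  then show ?thesis by (simp add: tlift_def fun_eq_iff)
qed

text \<open>Linearity in the lifted map rather than in the tensor. Nested lifts need it: their inner
  map depends on the arguments of the outer one, which must be shown bilinear.\<close>

lemma (in tensor_lift) lift_fun_add:
  assumes g: "bilinear_on sU sV sW S T g" and k: "bilinear_on sU sV sW S T k"
    and eq: "\<And>u v. u \<in> S \<Longrightarrow> v \<in> T \<Longrightarrow> k u v = f u v + g u v"
    and x: "x \<in> tensor_space sU sV S T"
  shows "tlift sU sV S T k x = tlift sU sV S T f x + tlift sU sV S T g x"
proof -
  interpret g: tensor_lift sU sV sW S T g by (simp add: tensor_lift_def U V W g)
  interpret k: tensor_lift sU sV sW S T k by (simp add: tensor_lift_def U V W k)
  show ?thesis
    by (rule tensor_space_induct[OF U x,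
          where P = "\<lambda>x. tlift sU sV S T k x = tlift sU sV S T f x + tlift sU sV S T g x"])
      (auto simp: lift_zero g.lift_zero k.lift_zero lift_pure g.lift_pure k.lift_pure eq
        lift_add g.lift_add k.lift_add algebra_simps)
qed

lemma (in tensor_lift) lift_fun_scale:
  assumes k: "bilinear_on sU sV sW S T k"
    and eq: "\<And>u v. u \<in> S \<Longrightarrow> v \<in> T \<Longrightarrow> k u v = sW c (f u v)"
    and x: "x \<in> tensor_space sU sV S T"
  shows "tlift sU sV S T k x = sW c (tlift sU sV S T f x)"
proof -
  interpret k: tensor_lift sU sV sW S T k by (simp add: tensor_lift_def U V W k)
  interpret W: vector_space sW by (fact W)
  show ?thesis
    by (rule tensor_space_induct[OF U x,
          where P = "\<lambda>x. tlift sU sV S T k x = sW c (tlift sU sV S T f x)"])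
      (auto simp: lift_zero k.lift_zero lift_pure k.lift_pure eq lift_add k.lift_add W.scale_right_distrib)
qed

text \<open>Bilinearity is not a hypothesis because a map that vanishes on
  \<open>S \<times> T\<close> has it. There \<open>f\<close> equals \<open>f + f\<close>, so the
  lift is its own double.\<close>

lemma tlift_zero:
  fixes sU :: "'k::field \<Rightarrow> 'u::ab_group_add \<Rightarrow> 'u" and sW :: "'k \<Rightarrow> 'w::ab_group_add \<Rightarrow> 'w"
    and f :: "'u \<Rightarrow> 'v::ab_group_add \<Rightarrow> 'w"
  assumes "vector_space sU" "module.subspace sU S" "vector_space sV" "module.subspace sV T" "vector_space sW"
    and "x \<in> tensor_space sU sV S T" "\<And>u v. u \<in> S \<Longrightarrow> v \<in> T \<Longrightarrow> f u v = 0"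
  shows "tlift sU sV S T f x = 0"
proof -
  interpret W: vector_space sW by fact
  have f: "bilinear_on sU sV sW S T f"
    using assms(7) module.subspace_add[OF _ assms(2)] module.subspace_scale[OF _ assms(2)]
      module.subspace_add[OF _ assms(4)] module.subspace_scale[OF _ assms(4)] assms(1,3)
    by (auto simp: bilinear_on_def linear_on_def module_iff_vector_space)
  interpret tensor_lift sU sV sW S T f by (simp add: tensor_lift_def assms f)
  have "tlift sU sV S T f x = tlift sU sV S T f x + tlift sU sV S T f x"
    by (rule lift_fun_add[OF f f _ assms(6)]) (simp add: assms(7))
  then show ?thesis by simp
qed

abbreviation (input) ev :: "'x \<Rightarrow> ('x \<Rightarrow> 'k) \<Rightarrow> 'k" where "ev \<beta> \<equiv> \<lambda>t. t \<beta>"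

lemma functional_ev: "functional fscale (ev \<beta>)"
  by (auto simp: linear_on_def fscale_def)

lemma bilinear_tensor_comp:
  assumes "linear_on s sU S f" "linear_on s' sV T g"
  shows "bilinear_on s s' fscale S T (\<lambda>u v. tensor sU sV (f u) (g v))"
  using assms by (auto simp: bilinear_on_def linear_on_def tensor_add_left tensor_add_right
    tensor_scale_pure tensor_scale_right)

section \<open>Induced maps on a tensor square\<close>

locale tensor_square = vector_space s
  for s :: "'k::field \<Rightarrow> 'v::ab_group_add \<Rightarrow> 'v" +
  fixes S T :: "'v set"
  assumes S: "subspace S" and T: "subspace T"
begin

lemma vs: "vector_space s" by unfold_locales

lemma tensor_lift: "vector_space sW \<Longrightarrow> bilinear_on s s sW S T f \<Longrightarrow> tensor_lift s s sW S T f"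
  by (simp add: tensor_lift_def vs S T)

lemma lift_map:
  assumes "linear_on s s S f" "linear_on s s T g"
  shows "tensor_lift s s fscale S T (\<lambda>u v. tensor s s (f u) (g v))"
  by (rule tensor_lift[OF vector_space_fscale bilinear_tensor_comp[OF assms]])

text \<open>\<open>f\<close> is linear on \<open>S\<close> only, so the composite of
  \<open>F\<close> with \<open>f\<close> need not be a functional on the ambient type.
  \<open>F'\<close> is a global functional that agrees with it on \<open>S\<close>; similarly
  \<open>H'\<close>.\<close>

lemma tmap_eval:
  assumes "linear_on s s S f" "linear_on s s T g" "x \<in> tensor_space s s S T"
    and "functional s F" "functional s H" "functional s F'" "functional s H'"
    and "\<And>u. u \<in> S \<Longrightarrow> F (f u) = F' u" "\<And>v. v \<in> T \<Longrightarrow> H (g v) = H' v"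
  shows "tmap s S T f g x (F \<otimes>\<^sub>f H) = x (F' \<otimes>\<^sub>f H')"
  unfolding tmap_def
  by (rule tensor_lift.lift_eval[OF lift_map[OF assms(1,2)] assms(3), where h = "ev (F \<otimes>\<^sub>f H)"])
    (simp_all add: bilinear_prod_form assms tensor_apply, simp add: prod_form_def assms)

lemma tmap_in:
  assumes "linear_on s s S f" "linear_on s s T g" "x \<in> tensor_space s s S T"
    and "f ` S \<subseteq> S'" "g ` T \<subseteq> T'"
  shows "tmap s S T f g x \<in> tensor_space s s S' T'"
  unfolding tmap_def
  by (rule tensor_lift.lift_in[OF lift_map[OF assms(1,2)] assms(3) subspace_tensor_space])
    (use assms(4,5) in \<open>auto intro!: tensor_in\<close>)

lemma tmap_add:
  assumes "linear_on s s S f" "linear_on s s T g" "x \<in> tensor_space s s S T" "y \<in> tensor_space s s S T"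
  shows "tmap s S T f g (x + y) = tmap s S T f g x + tmap s S T f g y"
  unfolding tmap_def by (rule tensor_lift.lift_add[OF lift_map]; fact)

lemma tmap_fun_add_left:
  assumes "linear_on s s S f" "linear_on s s S f'" "linear_on s s S f''" "linear_on s s T g"
    and "x \<in> tensor_space s s S T" "\<And>u. u \<in> S \<Longrightarrow> f'' u = f u + f' u"
  shows "tmap s S T f'' g x = tmap s S T f g x + tmap s S T f' g x"
  unfolding tmap_def
  by (rule tensor_lift.lift_fun_add[OF lift_map[OF assms(1,4)] bilinear_tensor_comp
        bilinear_tensor_comp _ assms(5)])
    (simp_all add: assms tensor_add_left)

lemma tmap_fun_add_right:
  assumes "linear_on s s S f" "linear_on s s T g" "linear_on s s T g'" "linear_on s s T g''"
    and "x \<in> tensor_space s s S T" "\<And>u. u \<in> T \<Longrightarrow> g'' u = g u + g' u"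
  shows "tmap s S T f g'' x = tmap s S T f g x + tmap s S T f g' x"
  unfolding tmap_def
  by (rule tensor_lift.lift_fun_add[OF lift_map[OF assms(1,2)] bilinear_tensor_comp
        bilinear_tensor_comp _ assms(5)])
    (simp_all add: assms tensor_add_right)

lemma tmap_zero:
  assumes "x \<in> tensor_space s s S T"
    and "(\<forall>u\<in>S. f u = 0) \<or> (\<forall>v\<in>T. g v = 0)"
  shows "tmap s S T f g x = 0"
  unfolding tmap_def
  by (rule tlift_zero[OF vs S vs T vector_space_fscale assms(1)])
    (use assms(2) in \<open>auto simp: tensor_zero_left tensor_zero_right\<close>)

lemma tmap_cong:
  assumes "\<And>u. u \<in> S \<Longrightarrow> f u = f' u" "\<And>v. v \<in> T \<Longrightarrow> g v = g' v"
  shows "tmap s S T f g = tmap s S T f' g'"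
  unfolding tmap_def by (rule tlift_cong) (simp add: assms)

lemma lift_flip: "tensor_lift s s fscale S T (\<lambda>u v. tensor s s v u)"
  by (rule tensor_lift[OF vector_space_fscale])
    (auto simp: bilinear_on_def linear_on_def tensor_add_left tensor_add_right
      tensor_scale_pure tensor_scale_right)

lemma tflip_eval:
  assumes "x \<in> tensor_space s s S T" "functional s F" "functional s H"
  shows "tflip s S T x (F \<otimes>\<^sub>f H) = x (H \<otimes>\<^sub>f F)"
  unfolding tflip_def
  by (rule tensor_lift.lift_eval[OF lift_flip assms(1), where h = "ev (F \<otimes>\<^sub>f H)"])
    (simp_all add: bilinear_prod_form assms tensor_apply, simp add: prod_form_def)

lemma tflip_in: "x \<in> tensor_space s s S T \<Longrightarrow> tflip s S T x \<in> tensor_space s s T S"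
  unfolding tflip_def
  by (rule tensor_lift.lift_in[OF lift_flip _ subspace_tensor_space]) (auto intro: tensor_in)

lemmas tflip_add = tensor_lift.lift_add[OF lift_flip, folded tflip_def]
  and tflip_zero = tensor_lift.lift_zero[OF lift_flip, folded tflip_def]
  and tflip_linear = tensor_lift.linear_lift[OF lift_flip, folded tflip_def]

lemma lift_left:
  "linear_on s fscale S f \<Longrightarrow> tensor_lift s s fscale S T (\<lambda>u v. tensor fscale s (f u) v)"
  by (rule tensor_lift[OF vector_space_fscale bilinear_tensor_comp]) (auto simp: linear_on_def)

lemma tleft_eval:
  assumes "linear_on s fscale S f" "x \<in> tensor_space s s S T"
    and "functional s F" "functional s N" "\<And>u. u \<in> S \<Longrightarrow> f u \<beta> = N u"
  shows "tleft s S T f x (ev \<beta> \<otimes>\<^sub>f F) = x (N \<otimes>\<^sub>f F)"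
  unfolding tleft_def
  by (rule tensor_lift.lift_eval[OF lift_left[OF assms(1)] assms(2), where h = "ev (ev \<beta> \<otimes>\<^sub>f F)"])
    (simp_all add: bilinear_prod_form functional_ev assms tensor_apply, simp add: prod_form_def assms)

lemma tleft_in:
  assumes "linear_on s fscale S f" "x \<in> tensor_space s s S T" "f ` S \<subseteq> X"
  shows "tleft s S T f x \<in> tensor_space fscale s X T"
  unfolding tleft_def
  by (rule tensor_lift.lift_in[OF lift_left[OF assms(1)] assms(2) subspace_tensor_space])
    (use assms(3) in \<open>auto intro!: tensor_in\<close>)

lemma tleft_zero:
  assumes "x \<in> tensor_space s s S T" "\<And>u. u \<in> S \<Longrightarrow> f u = 0"
  shows "tleft s S T f x = 0"
  unfolding tleft_def
  by (rule tlift_zero[OF vs S vs T vector_space_fscale assms(1)]) (simp add: assms(2) tensor_zero_left)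

end

section \<open>Maps into tensor cubes and reassociation\<close>

locale tensor_cube = L: tensor_square s S T + R: tensor_square s S' T'
  for s :: "'k::field \<Rightarrow> 'v::ab_group_add \<Rightarrow> 'v" and S T S' T'
begin

sublocale SS': tensor_square s S S'
  by unfold_locales (rule L.S, rule R.S)

lemma lift_tensor3:
  "tensor_lift s s fscale S' T' (tensor3 s u)"
  unfolding tensor3_def
  by (rule R.tensor_lift[OF vector_space_fscale])
    (auto simp: bilinear_on_def linear_on_def tensor_add_left tensor_add_right
       tensor_scale_pure tensor_scale_right)

lemma lift_right:
  assumes f: "linear_on s fscale T f" "f ` T \<subseteq> tensor_space s s S' T'"
  shows "tensor_lift s s fscale S T (\<lambda>u v. tlift s s S' T' (\<lambda>a b. tensor3 s u a b) (f v))"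
proof (rule L.tensor_lift[OF vector_space_fscale])
  have fin: "f v \<in> tensor_space s s S' T'" if "v \<in> T" for v using f(2) that by auto
  show "bilinear_on s s fscale S T (\<lambda>u v. tlift s s S' T' (\<lambda>a b. tensor3 s u a b) (f v))"
    unfolding bilinear_on_def linear_on_def
  proof (intro conjI ballI allI)
    show "tlift s s S' T' (\<lambda>a b. tensor3 s u a b) (f (v + v')) =
        tlift s s S' T' (\<lambda>a b. tensor3 s u a b) (f v) + tlift s s S' T' (\<lambda>a b. tensor3 s u a b) (f v')"
      if "v \<in> T" "v' \<in> T" for u v v'
      using that by (simp add: linear_on_add[OF f(1)] tensor_lift.lift_add[OF lift_tensor3] fin)
    show "tlift s s S' T' (\<lambda>a b. tensor3 s u a b) (f (s c v)) =
        fscale c (tlift s s S' T' (\<lambda>a b. tensor3 s u a b) (f v))" if "v \<in> T" for c u v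
      using that by (simp add: linear_on_scale[OF f(1)] tensor_lift.lift_scale[OF lift_tensor3] fin)
    show "tlift s s S' T' (\<lambda>a b. tensor3 s (u + u') a b) (f v) =
        tlift s s S' T' (\<lambda>a b. tensor3 s u a b) (f v) + tlift s s S' T' (\<lambda>a b. tensor3 s u' a b) (f v)"
      if "v \<in> T" for u u' v
      by (rule tensor_lift.lift_fun_add[OF lift_tensor3 tensor_lift.f[OF lift_tensor3]
            tensor_lift.f[OF lift_tensor3] _ fin[OF that]])
        (simp add: tensor3_def tensor_add_left)
    show "tlift s s S' T' (\<lambda>a b. tensor3 s (s c u) a b) (f v) =
        fscale c (tlift s s S' T' (\<lambda>a b. tensor3 s u a b) (f v))" if "v \<in> T" for c u v
      by (rule tensor_lift.lift_fun_scale[OF lift_tensor3 tensor_lift.f[OF lift_tensor3] _ fin[OF that]])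
        (simp add: tensor3_def tensor_scale_pure)
  qed
qed

text \<open>Reassociation at the level of functionals: the last two of \<open>F1\<close>,
  \<open>F2\<close>, \<open>F3\<close> are absorbed into the pullback \<open>N\<close> along
  \<open>f\<close>, so a functional on the cube becomes one on the square.\<close>

lemma tright_eval:
  assumes f: "linear_on s fscale T f" "f ` T \<subseteq> tensor_space s s S' T'"
    and x: "x \<in> tensor_space s s S T"
    and F: "functional s F1" "functional s F2" "functional s F3"
    and N: "functional s N" "\<And>v. v \<in> T \<Longrightarrow> f v (F2 \<otimes>\<^sub>f F3) = N v"
  shows "tright s S T S' T' f x (ev (F1 \<otimes>\<^sub>f F2) \<otimes>\<^sub>f F3) = x (F1 \<otimes>\<^sub>f N)"
  unfolding tright_def
proof (rule tensor_lift.lift_eval[OF lift_right[OF f] x, where h = "ev (ev (F1 \<otimes>\<^sub>f F2) \<otimes>\<^sub>f F3)"])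
  have b3: "bilinear_form fscale s (ev (F1 \<otimes>\<^sub>f F2) \<otimes>\<^sub>f F3)"
    by (rule bilinear_prod_form[OF functional_ev F(3)])
  show "tlift s s S' T' (\<lambda>a b. tensor3 s u a b) (f v) (ev (F1 \<otimes>\<^sub>f F2) \<otimes>\<^sub>f F3) = (F1 \<otimes>\<^sub>f N) u v"
    if "v \<in> T" for u v
  proof -
    \<comment> \<open>For fixed \<open>u\<close>, the functional on the cube restricts to the
      product of \<open>F2\<close> and \<open>F3\<close> with the scalar \<open>F1 u\<close>
      attached to the first factor.\<close>
    have "tlift s s S' T' (\<lambda>a b. tensor3 s u a b) (f v) (ev (F1 \<otimes>\<^sub>f F2) \<otimes>\<^sub>f F3) =
        f v ((\<lambda>a. F1 u * F2 a) \<otimes>\<^sub>f F3)"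
    proof (rule tensor_lift.lift_eval[OF lift_tensor3, where h = "ev (ev (F1 \<otimes>\<^sub>f F2) \<otimes>\<^sub>f F3)"])
      show "f v \<in> tensor_space s s S' T'" using f(2) that by auto
      show "bilinear_form s s ((\<lambda>a. F1 u * F2 a) \<otimes>\<^sub>f F3)"
        by (rule bilinear_prod_form[OF functional_cmult[OF F(2)] F(3)])
    qed (simp_all add: tensor3_def tensor_apply[OF b3], simp add: prod_form_def
        tensor_apply[OF bilinear_prod_form[OF F(1,2), unfolded prod_form_def]])
    also have "\<dots> = F1 u * f v (F2 \<otimes>\<^sub>f F3)"
      by (rule tensor_eval_scale_left[OF L.vs R.S _ F(2,3)]) (use f(2) that in auto)
    finally show ?thesis by (simp only: N(2)[OF that] prod_form_def[of F1 N])
  qed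
qed (simp_all add: bilinear_prod_form F N)

lemma tright_in:
  assumes f: "linear_on s fscale T f" "f ` T \<subseteq> tensor_space s s S' T'"
    and x: "x \<in> tensor_space s s S T"
  shows "tright s S T S' T' f x \<in> tensor_space fscale s (tensor_space s s S S') T'"
  unfolding tright_def
proof (rule tensor_lift.lift_in[OF lift_right[OF f] x subspace_tensor_space])
  show "tlift s s S' T' (\<lambda>a b. tensor3 s u a b) (f v) \<in> tensor_space fscale s (tensor_space s s S S') T'"
    if "u \<in> S" "v \<in> T" for u v
    by (rule tensor_lift.lift_in[OF lift_tensor3 _ subspace_tensor_space])
      (use that f(2) in \<open>auto simp: tensor3_def intro!: tensor_in\<close>)
qed

lemma tright_zero:
  assumes "x \<in> tensor_space s s S T" "\<And>v. v \<in> T \<Longrightarrow> f v = 0"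
  shows "tright s S T S' T' f x = 0"
  unfolding tright_def
  by (rule tlift_zero[OF L.vs L.S L.vs L.T vector_space_fscale assms(1)])
    (simp add: assms(2) tensor_lift.lift_zero[OF lift_tensor3])

end

context tensor_square
begin

lemma lift_flip12:
  "subspace W \<Longrightarrow>
    tensor_lift fscale s fscale (tensor_space s s S T) W (\<lambda>x w. tensor fscale s (tflip s S T x) w)"
  by (simp add: tensor_lift_def vs vector_space_fscale subspace_tensor_space)
    (rule bilinear_tensor_comp[OF tflip_linear], simp add: linear_on_def)

lemma tflip12_eval:
  assumes W: "subspace W" and x: "x \<in> tensor_space fscale s (tensor_space s s S T) W"
    and F: "functional s F1" "functional s F2" "functional s F3"
  shows "tflip12 s S T W x (ev (F1 \<otimes>\<^sub>f F2) \<otimes>\<^sub>f F3) = x (ev (F2 \<otimes>\<^sub>f F1) \<otimes>\<^sub>f F3)"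
  unfolding tflip12_def
  by (rule tensor_lift.lift_eval[OF lift_flip12[OF W] x, where h = "ev (ev (F1 \<otimes>\<^sub>f F2) \<otimes>\<^sub>f F3)"])
    (simp_all add: bilinear_prod_form functional_ev F tensor_apply, simp add: prod_form_def
      tflip_eval[unfolded prod_form_def] F)

lemma tflip12_in:
  assumes W: "subspace W" and x: "x \<in> tensor_space fscale s (tensor_space s s S T) W"
  shows "tflip12 s S T W x \<in> tensor_space fscale s (tensor_space s s T S) W"
  unfolding tflip12_def
  by (rule tensor_lift.lift_in[OF lift_flip12[OF W] x subspace_tensor_space])
    (auto intro!: tensor_in tflip_in)

end

section \<open>Graded spaces and completed tensor products\<close>

context graded_space
begin

lemma vs: "vector_space s" by unfold_locales

lemma subspace_G: "subspace G"
  by (simp add: gcarrier_def subspace_span)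

lemma component_in_G: "a \<in> A i \<Longrightarrow> a \<in> G"
  unfolding gcarrier_def by (rule span_base) blast

lemmas G_add = subspace_add[OF subspace_G] and G_diff = subspace_diff[OF subspace_G]
  and G_neg = subspace_neg[OF subspace_G] and G_scale = subspace_scale[OF subspace_G]
  and G_zero = subspace_0[OF subspace_G]
  and component_zero = subspace_0[OF component_subspace]

text \<open>The predicate under the description operator in \<open>hcomp\<close>, named so that its
  closure under sums and multiples makes \<open>hcomp\<close> linear.\<close>

definition decomposition :: "(int \<Rightarrow> 'a) \<Rightarrow> 'a \<Rightarrow> bool"
  where "decomposition c a \<longleftrightarrow> (\<forall>j. c j \<in> A j) \<and> finite {j. c j \<noteq> 0} \<and> a = Sum_any c"

lemma decomposition_single: "a \<in> A i \<Longrightarrow> decomposition (\<lambda>j. if j = i then a else 0) a"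
  unfolding decomposition_def
  by (subst Sum_any_single[of i]) (auto simp: component_zero)

lemma decomposition_add:
  assumes "decomposition c a" "decomposition c' a'"
  shows "decomposition (\<lambda>j. c j + c' j) (a + a')"
proof -
  have "finite {j. c j + c' j \<noteq> 0}"
    by (rule finite_subset[of _ "{j. c j \<noteq> 0} \<union> {j. c' j \<noteq> 0}"]) (use assms in \<open>auto simp: decomposition_def\<close>)
  then show ?thesis
    using assms by (auto simp: decomposition_def Sum_any.distrib subspace_add[OF component_subspace])
qed

lemma decomposition_scale:
  assumes "decomposition c a"
  shows "decomposition (\<lambda>j. s k (c j)) (s k a)"
proof -
  have fin: "finite {j. c j \<noteq> 0}" using assms by (auto simp: decomposition_def)
  have sub: "{j. s k (c j) \<noteq> 0} \<subseteq> {j. c j \<noteq> 0}" by auto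
  have "s k (Sum_any c) = Sum_any (\<lambda>j. s k (c j))"
    by (simp add: Sum_any.expand_superset[OF fin sub] Sum_any.expand_set scale_sum_right)
  then show ?thesis
    using assms finite_subset[OF sub fin]
    by (auto simp: decomposition_def subspace_scale[OF component_subspace])
qed

lemma decomposition_unique:
  assumes "decomposition c a" "decomposition c' a"
  shows "c = c'"
proof
  fix i
  have "decomposition (\<lambda>j. c j + s (-1) (c' j)) (a + s (-1) a)"
    by (intro decomposition_add decomposition_scale assms)
  then have "c i + s (-1) (c' i) = 0"
    using component_independent[of "\<lambda>j. c j + s (-1) (c' j)" i] by (auto simp: decomposition_def)
  then show "c i = c' i" by simp
qed

lemma decomposition_exists:
  assumes "a \<in> G"
  shows "\<exists>c. decomposition c a"
  using assms unfolding gcarrier_def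
proof (induction rule: span_induct_alt)
  case base
  show ?case using decomposition_single[OF component_zero] by blast
next
  case (step k x y)
  then show ?case
    using decomposition_single decomposition_scale decomposition_add by (metis UN_E)
qed

lemma hcomp_eqI: "decomposition c a \<Longrightarrow> hcomp A i a = c i"
  unfolding hcomp_def decomposition_def[symmetric]
  by (subst the_equality[of _ c]) (auto intro: decomposition_unique)

lemma hcomp_homogeneous: "a \<in> A i \<Longrightarrow> hcomp A k a = (if k = i then a else 0)"
  by (rule hcomp_eqI[OF decomposition_single])

lemma linear_hcomp: "linear_on s s G (hcomp A k)"
proof (rule linear_onI)
  show "hcomp A k (x + y) = hcomp A k x + hcomp A k y" if "x \<in> G" "y \<in> G" for x y
    using that[THEN decomposition_exists] hcomp_eqI[OF decomposition_add] hcomp_eqI by metis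
  show "hcomp A k (s c x) = s c (hcomp A k x)" if "x \<in> G" for c x
    using that[THEN decomposition_exists] hcomp_eqI[OF decomposition_scale] hcomp_eqI by metis
qed

text \<open>The set \<open>N\<close> collects the possible degree changes. Its finiteness makes the
  sum in \<open>cmap\<close> finite, also for multiplication by a non-homogeneous element, which is
  not a \<open>shift_map\<close>.\<close>

definition bounded_map :: "('a \<Rightarrow> 'a) \<Rightarrow> bool"
  where "bounded_map f \<longleftrightarrow> linear_on s s G f \<and> f ` G \<subseteq> G \<and>
    (\<exists>N. finite N \<and> (\<forall>i. \<forall>u\<in>A i. \<forall>k. k - i \<notin> N \<longrightarrow> hcomp A k (f u) = 0))"

definition shift_map :: "int \<Rightarrow> ('a \<Rightarrow> 'a) \<Rightarrow> bool"
  where "shift_map n f \<longleftrightarrow> linear_on s s G f \<and> (\<forall>i. \<forall>u\<in>A i. f u \<in> A (i + n))"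

lemma shift_map_bounded:
  assumes "shift_map n f"
  shows "bounded_map f"
  unfolding bounded_map_def
proof (intro conjI exI[of _ "{n}"] allI ballI impI)
  have f: "linear_on s s G f" "\<And>i u. u \<in> A i \<Longrightarrow> f u \<in> A (i + n)"
    using assms by (auto simp: shift_map_def)
  show "linear_on s s G f" by fact
  have "f u \<in> G" if "u \<in> G" for u
  proof -
    \<comment> \<open>Membership of \<open>u\<close> is carried through the induction because
      \<open>f\<close> is additive on \<open>G\<close> only.\<close>
    have "u \<in> G \<and> f u \<in> G"
      using that unfolding gcarrier_def
    proof (induction rule: span_induct_alt)
      case base
      then show ?case using G_zero linear_on_zero[OF f(1) G_zero] by (simp add: gcarrier_def)
    next
      case (step c x y)
      then obtain i where "x \<in> A i" by auto
      then show ?case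
        using step f(2)[of x i] component_in_G G_scale G_add
        by (simp add: linear_on_add[OF f(1)] linear_on_scale[OF f(1)] flip: gcarrier_def)
    qed
    then show ?thesis ..
  qed
  then show "f ` G \<subseteq> G" by auto
  show "hcomp A k (f u) = 0" if "u \<in> A i" "k - i \<notin> {n}" for i u k
    using hcomp_homogeneous[OF f(2)[OF that(1)], of k] that(2) by auto
qed simp

lemma bounded_map_add:
  assumes "bounded_map f" "bounded_map g"
  shows "bounded_map (\<lambda>u. f u + g u)"
proof -
  obtain N M where NM: "finite N" "\<And>i u k. u \<in> A i \<Longrightarrow> k - i \<notin> N \<Longrightarrow> hcomp A k (f u) = 0"
      "finite M" "\<And>i u k. u \<in> A i \<Longrightarrow> k - i \<notin> M \<Longrightarrow> hcomp A k (g u) = 0"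
    using assms unfolding bounded_map_def by metis
  show ?thesis
    unfolding bounded_map_def
  proof (intro conjI exI[of _ "N \<union> M"] allI ballI impI)
    show "hcomp A k (f u + g u) = 0" if "u \<in> A i" "k - i \<notin> N \<union> M" for i u k
      using NM that assms component_in_G[OF that(1)]
      by (auto simp: bounded_map_def image_subset_iff linear_on_add[OF linear_hcomp])
  qed (use assms NM G_add in \<open>auto simp: bounded_map_def linear_on_def algebra_simps image_subset_iff\<close>)
qed

lemma bounded_map_cong:
  assumes "bounded_map f" "\<And>u. u \<in> G \<Longrightarrow> g u = f u"
  shows "bounded_map g"
proof -
  obtain N where N: "finite N" "\<And>i u k. u \<in> A i \<Longrightarrow> k - i \<notin> N \<Longrightarrow> hcomp A k (f u) = 0"
    using assms(1) unfolding bounded_map_def by metis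
  then have "\<And>i u k. u \<in> A i \<Longrightarrow> k - i \<notin> N \<Longrightarrow> hcomp A k (g u) = 0"
    using assms(2) component_in_G by simp
  then show ?thesis using assms N(1) G_add G_scale unfolding bounded_map_def linear_on_def
    by (auto simp: image_subset_iff)
qed

lemma bounded_map_scale:
  assumes "bounded_map f"
  shows "bounded_map (\<lambda>u. s c (f u))"
proof -
  obtain N where N: "finite N" "\<And>i u k. u \<in> A i \<Longrightarrow> k - i \<notin> N \<Longrightarrow> hcomp A k (f u) = 0"
    using assms(1) unfolding bounded_map_def by metis
  show ?thesis
    unfolding bounded_map_def
  proof (intro conjI exI[of _ N] allI ballI impI)
    show "hcomp A k (s c (f u)) = 0" if "u \<in> A i" "k - i \<notin> N" for i u k
      using N that assms component_in_G[OF that(1)]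
      by (auto simp: bounded_map_def image_subset_iff linear_on_scale[OF linear_hcomp])
  qed (use assms N G_scale in \<open>auto simp: bounded_map_def linear_on_def algebra_simps image_subset_iff\<close>)
qed

lemma shift_map_id: "shift_map 0 id"
  by (simp add: shift_map_def linear_on_def)

lemmas bounded_map_id = shift_map_bounded[OF shift_map_id]

section \<open>Operators on the completed tensor square\<close>

lemma square: "tensor_square s (A i) (A j)"
  by unfold_locales (rule component_subspace)+

lemma linear_on_component: "linear_on s t G f \<Longrightarrow> linear_on s t (A i) f"
  using component_in_G by (auto simp: linear_on_def)

lemma bounded_hcomp_linear: "bounded_map f \<Longrightarrow> linear_on s s (A i) (\<lambda>u. hcomp A k (f u))"
  by (rule linear_onI)
    (auto simp: bounded_map_def image_subset_iff component_in_G
      linear_on_add[OF _ component_in_G component_in_G] linear_on_scale[OF _ component_in_G]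
      linear_on_add[OF linear_hcomp] linear_on_scale[OF linear_hcomp])

lemma component_in: "x \<in> ctensor_space s A \<Longrightarrow> x i j \<in> tensor_space s s (A i) (A j)"
  by (simp add: ctensor_space_def)

definition cmap_term :: "('a \<Rightarrow> 'a) \<Rightarrow> ('a \<Rightarrow> 'a) \<Rightarrow> ('a, 'k) ctensor2 \<Rightarrow> int \<Rightarrow> int \<Rightarrow>
    int \<times> int \<Rightarrow> ('a, 'a, 'k) tensor"
  where "cmap_term f g x k l = (\<lambda>(i, j).
    tmap s (A i) (A j) (\<lambda>u. hcomp A k (f u)) (\<lambda>v. hcomp A l (g v)) (x i j))"

lemma cmap_eq: "cmap s A f g x = (\<lambda>k l. Sum_any (cmap_term f g x k l))"
  by (simp add: cmap_def cmap_term_def)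

context
  fixes f g x
  assumes f: "bounded_map f" and g: "bounded_map g" and x: "x \<in> ctensor_space s A"
begin

text \<open>Component \<open>(i, j)\<close> can reach degree \<open>(k, l)\<close> only if
  \<open>k - i\<close> and \<open>l - j\<close> are among the finitely many degree changes of
  \<open>f\<close> and \<open>g\<close>.\<close>

lemma cmap_finite:
  "finite {p. cmap_term f g x k l p \<noteq> 0}"
proof -
  obtain N where N: "finite N" "\<And>i u k. u \<in> A i \<Longrightarrow> k - i \<notin> N \<Longrightarrow> hcomp A k (f u) = 0"
    using f unfolding bounded_map_def by metis
  obtain M where M: "finite M" "\<And>i u k. u \<in> A i \<Longrightarrow> k - i \<notin> M \<Longrightarrow> hcomp A k (g u) = 0"
    using g unfolding bounded_map_def by metis
  have "tmap s (A i) (A j) (\<lambda>u. hcomp A k (f u)) (\<lambda>v. hcomp A l (g v)) (x i j) = 0"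
    if "(k - i, l - j) \<notin> N \<times> M" for i j
    by (rule tensor_square.tmap_zero[OF square component_in[OF x]]) (use N M that in auto)
  then have "{p. cmap_term f g x k l p \<noteq> 0}
      \<subseteq> (\<lambda>(n, m). (k - n, l - m)) ` (N \<times> M)"
    by (force simp: image_iff cmap_term_def)
  then show ?thesis using N M finite_subset by blast
qed

end

lemma cmap_add_left:
  assumes "bounded_map f" "bounded_map f'" "bounded_map g" "x \<in> ctensor_space s A"
    and eq: "\<And>u. u \<in> G \<Longrightarrow> f'' u = f u + f' u"
  shows "cmap s A f'' g x = cmap s A f g x + cmap s A f' g x"
proof -
  have f'': "bounded_map f''" using bounded_map_cong[OF bounded_map_add[OF assms(1,2)]] eq by blast
  have "tmap s (A i) (A j) (\<lambda>u. hcomp A k (f'' u)) (\<lambda>v. hcomp A l (g v)) (x i j) =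
      tmap s (A i) (A j) (\<lambda>u. hcomp A k (f u)) (\<lambda>v. hcomp A l (g v)) (x i j) +
      tmap s (A i) (A j) (\<lambda>u. hcomp A k (f' u)) (\<lambda>v. hcomp A l (g v)) (x i j)" for i j k l
    by (rule tensor_square.tmap_fun_add_left[OF square])
      (simp_all add: bounded_hcomp_linear assms(1-4) f'' component_in,
        use assms component_in_G in \<open>auto simp: eq bounded_map_def image_subset_iff
         linear_on_add[OF linear_hcomp]\<close>)
  then have "cmap_term f'' g x k l = (\<lambda>p. cmap_term f g x k l p + cmap_term f' g x k l p)" for k l
    by (intro ext) (simp only: cmap_term_def case_prod_beta)
  then show ?thesis
    using cmap_finite[OF assms(1,3,4)] cmap_finite[OF assms(2,3,4)]
    by (intro ext) (simp only: cmap_eq plus_fun_apply Sum_any.distrib)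
qed

lemma cmap_add_right:
  assumes "bounded_map f" "bounded_map g" "bounded_map g'" "x \<in> ctensor_space s A"
    and eq: "\<And>u. u \<in> G \<Longrightarrow> g'' u = g u + g' u"
  shows "cmap s A f g'' x = cmap s A f g x + cmap s A f g' x"
proof -
  have g'': "bounded_map g''" using bounded_map_cong[OF bounded_map_add[OF assms(2,3)]] eq by blast
  have "tmap s (A i) (A j) (\<lambda>u. hcomp A k (f u)) (\<lambda>v. hcomp A l (g'' v)) (x i j) =
      tmap s (A i) (A j) (\<lambda>u. hcomp A k (f u)) (\<lambda>v. hcomp A l (g v)) (x i j) +
      tmap s (A i) (A j) (\<lambda>u. hcomp A k (f u)) (\<lambda>v. hcomp A l (g' v)) (x i j)" for i j k l
    by (rule tensor_square.tmap_fun_add_right[OF square])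
      (simp_all add: bounded_hcomp_linear assms(1-4) g'' component_in,
        use assms component_in_G in \<open>auto simp: eq bounded_map_def image_subset_iff
         linear_on_add[OF linear_hcomp]\<close>)
  then have "cmap_term f g'' x k l = (\<lambda>p. cmap_term f g x k l p + cmap_term f g' x k l p)" for k l
    by (intro ext) (simp only: cmap_term_def case_prod_beta)
  then show ?thesis
    using cmap_finite[OF assms(1,2,4)] cmap_finite[OF assms(1,3,4)]
    by (intro ext) (simp only: cmap_eq plus_fun_apply Sum_any.distrib)
qed

lemma cmap_add:
  assumes "bounded_map f" "bounded_map g" "x \<in> ctensor_space s A" "y \<in> ctensor_space s A"
  shows "cmap s A f g (x + y) = cmap s A f g x + cmap s A f g y"
proof -
  have "tmap s (A i) (A j) (\<lambda>u. hcomp A k (f u)) (\<lambda>v. hcomp A l (g v)) ((x + y) i j) =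
      tmap s (A i) (A j) (\<lambda>u. hcomp A k (f u)) (\<lambda>v. hcomp A l (g v)) (x i j) +
      tmap s (A i) (A j) (\<lambda>u. hcomp A k (f u)) (\<lambda>v. hcomp A l (g v)) (y i j)" for i j k l
    using tensor_square.tmap_add[OF square bounded_hcomp_linear bounded_hcomp_linear component_in component_in] assms
    by (simp only: plus_fun_apply)
  then have "cmap_term f g (x + y) k l = (\<lambda>p. cmap_term f g x k l p + cmap_term f g y k l p)" for k l
    by (intro ext) (simp only: cmap_term_def case_prod_beta)
  then show ?thesis
    using cmap_finite[OF assms(1-3)] cmap_finite[OF assms(1,2,4)]
    by (intro ext) (simp only: cmap_eq plus_fun_apply Sum_any.distrib)
qed

text \<open>Homogeneous maps send exactly one component into degree \<open>(k, l)\<close>, and there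
  the projections \<open>hcomp\<close> act as the identity.\<close>

lemma cmap_shift:
  assumes "shift_map n f" "shift_map m g" "x \<in> ctensor_space s A"
  shows "cmap s A f g x k l = tmap s (A (k - n)) (A (l - m)) f g (x (k - n) (l - m))"
proof -
  have f: "f u \<in> A (i + n)" if "u \<in> A i" for i u using assms(1) that by (simp add: shift_map_def)
  have g: "g u \<in> A (i + m)" if "u \<in> A i" for i u using assms(2) that by (simp add: shift_map_def)
  have "cmap s A f g x k l = (\<lambda>(i, j). tmap s (A i) (A j)
      (\<lambda>u. hcomp A k (f u)) (\<lambda>v. hcomp A l (g v)) (x i j)) (k - n, l - m)"
    unfolding cmap_def
  proof (rule Sum_any_single)
    fix p :: "int \<times> int"
    assume "p \<noteq> (k - n, l - m)"
    then obtain i j where ij: "p = (i, j)" "i + n \<noteq> k \<or> j + m \<noteq> l" by (cases p) auto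
    have "(\<forall>u\<in>A i. hcomp A k (f u) = 0) \<or> (\<forall>v\<in>A j. hcomp A l (g v) = 0)"
      using ij(2) hcomp_homogeneous[OF f] hcomp_homogeneous[OF g] by metis
    then show "(\<lambda>(i, j). tmap s (A i) (A j) (\<lambda>u. hcomp A k (f u)) (\<lambda>v. hcomp A l (g v)) (x i j)) p = 0"
      unfolding ij(1) prod.case by (intro tensor_square.tmap_zero[OF square component_in[OF assms(3)]])
  qed
  also have "\<dots> = tmap s (A (k - n)) (A (l - m)) f g (x (k - n) (l - m))"
    unfolding prod.case
    by (rule fun_cong[OF tensor_square.tmap_cong[OF square]])
      (use f g hcomp_homogeneous in force)+
  finally show ?thesis .
qed

lemma cmap_in_shift:
  assumes "shift_map n f" "shift_map m g" "x \<in> ctensor_space s A"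
  shows "cmap s A f g x \<in> ctensor_space s A"
  unfolding ctensor_space_def mem_Collect_eq cmap_shift[OF assms]
proof (intro allI)
  fix k l
  have "f ` A (k - n) \<subseteq> A k" "g ` A (l - m) \<subseteq> A l"
    using assms(1,2) unfolding shift_map_def by fastforce+
  then show "tmap s (A (k - n)) (A (l - m)) f g (x (k - n) (l - m)) \<in> tensor_space s s (A k) (A l)"
    using assms by (intro tensor_square.tmap_in[OF square])
      (auto simp: component_in shift_map_def linear_on_component)
qed

lemma cmap_eval:
  assumes "shift_map n f" "shift_map m g" "x \<in> ctensor_space s A"
    and "functional s F" "functional s H" "functional s F'" "functional s H'"
    and "\<And>u. u \<in> G \<Longrightarrow> F (f u) = F' u" "\<And>v. v \<in> G \<Longrightarrow> H (g v) = H' v"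
  shows "cmap s A f g x k l (F \<otimes>\<^sub>f H) = x (k - n) (l - m) (F' \<otimes>\<^sub>f H')"
  unfolding cmap_shift[OF assms(1-3)]
  by (rule tensor_square.tmap_eval[OF square _ _ component_in[OF assms(3)] assms(4-7)])
    (use assms(1,2,8,9) component_in_G in \<open>auto simp: shift_map_def linear_on_component\<close>)

lemma cflip_in: "x \<in> ctensor_space s A \<Longrightarrow> \<tau> x \<in> ctensor_space s A"
  by (auto simp: ctensor_space_def cflip_def intro!: tensor_square.tflip_in[OF square])

lemma cflip_eval:
  "x \<in> ctensor_space s A \<Longrightarrow> functional s F \<Longrightarrow> functional s H \<Longrightarrow> \<tau> x i j (F \<otimes>\<^sub>f H) = x j i (H \<otimes>\<^sub>f F)"
  unfolding cflip_def by (rule tensor_square.tflip_eval[OF square]) (auto simp: ctensor_space_def)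

lemma cflip_add:
  "x \<in> ctensor_space s A \<Longrightarrow> y \<in> ctensor_space s A \<Longrightarrow> \<tau> (x + y) = \<tau> x + \<tau> y"
  by (intro ext) (simp only: cflip_def plus_fun_apply tensor_square.tflip_add[OF square component_in component_in])

lemma cflip_zero: "\<tau> 0 = 0"
  by (intro ext) (simp only: cflip_def zero_fun_apply tensor_square.tflip_zero[OF square])

lemma ctensor_space_zero: "0 \<in> ctensor_space s A"
  by (simp only: ctensor_space_def mem_Collect_eq zero_fun_apply tensor_space_zero simp_thms)

lemma ctensor_space_add: "x \<in> ctensor_space s A \<Longrightarrow> y \<in> ctensor_space s A \<Longrightarrow> x + y \<in> ctensor_space s A"
  and ctensor_space_diff: "x \<in> ctensor_space s A \<Longrightarrow> y \<in> ctensor_space s A \<Longrightarrow> x - y \<in> ctensor_space s A"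
  by (simp_all only: ctensor_space_def mem_Collect_eq plus_fun_apply minus_apply
      tensor_space_add tensor_space_diff simp_thms)

lemma cflip12_in:
  "x j i k \<in> tensor_space fscale s (tensor_space s s (A j) (A i)) (A k) \<Longrightarrow>
    cflip12 s A x i j k \<in> tensor_space fscale s (tensor_space s s (A i) (A j)) (A k)"
  unfolding cflip12_def by (rule tensor_square.tflip12_in[OF square component_subspace])

lemma cflip12_eval:
  "x j i k \<in> tensor_space fscale s (tensor_space s s (A j) (A i)) (A k) \<Longrightarrow>
    functional s F1 \<Longrightarrow> functional s F2 \<Longrightarrow> functional s F3 \<Longrightarrow>
    cflip12 s A x i j k (ev (F1 \<otimes>\<^sub>f F2) \<otimes>\<^sub>f F3) = x j i k (ev (F2 \<otimes>\<^sub>f F1) \<otimes>\<^sub>f F3)"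
  unfolding cflip12_def by (rule tensor_square.tflip12_eval[OF square component_subspace])

lemma shift_map_add: "shift_map n f \<Longrightarrow> shift_map n g \<Longrightarrow> shift_map n (f + g)"
  by (auto simp: shift_map_def linear_on_def algebra_simps subspace_add[OF component_subspace])

lemma shift_map_diff: "shift_map n f \<Longrightarrow> shift_map n g \<Longrightarrow> shift_map n (f - g)"
  by (auto simp: shift_map_def linear_on_def algebra_simps subspace_diff[OF component_subspace])

lemma bounded_map_diff:
  assumes "bounded_map f" "bounded_map g"
  shows "bounded_map (f - g)"
  using bounded_map_cong[OF bounded_map_add[OF assms(1) bounded_map_scale[OF assms(2), of "-1"]], of "f - g"]
  by simp

lemma bounded_map_plus: "bounded_map f \<Longrightarrow> bounded_map g \<Longrightarrow> bounded_map (f + g)"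
  using bounded_map_cong[OF bounded_map_add, of f g "f + g"] by simp

text \<open>Additivity in the algebra element, for families of operators and below for families of
  completed tensors. Together they give biadditivity of each side of a compatibility condition from
  closure rules, without any computation with infinite families.\<close>

definition map_family :: "('a \<Rightarrow> 'a \<Rightarrow> 'a) \<Rightarrow> bool"
  where "map_family h \<longleftrightarrow> (\<forall>a\<in>G. bounded_map (h a)) \<and>
    (\<forall>a\<in>G. \<forall>a'\<in>G. \<forall>u\<in>G. h (a + a') u = h a u + h a' u)"

definition tensor_family :: "('a \<Rightarrow> ('a, 'k) ctensor2) \<Rightarrow> bool"
  where "tensor_family X \<longleftrightarrow> (\<forall>a\<in>G. X a \<in> ctensor_space s A) \<and>
    (\<forall>a\<in>G. \<forall>a'\<in>G. X (a + a') = X a + X a')"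

definition biadditive :: "('a \<Rightarrow> 'a \<Rightarrow> 'c::ab_group_add) \<Rightarrow> bool"
  where "biadditive T \<longleftrightarrow> (\<forall>a\<in>G. \<forall>a'\<in>G. \<forall>b\<in>G. T (a + a') b = T a b + T a' b \<and> T b (a + a') = T b a + T b a')"

lemma map_family_add: "map_family h \<Longrightarrow> map_family h' \<Longrightarrow> map_family (\<lambda>a. h a + h' a)"
  by (simp add: map_family_def bounded_map_plus algebra_simps)

lemma map_family_diff: "map_family h \<Longrightarrow> map_family h' \<Longrightarrow> map_family (\<lambda>a. h a - h' a)"
  by (simp add: map_family_def bounded_map_diff algebra_simps)

lemma tensor_family_add:
  assumes "tensor_family X" "tensor_family Y"
  shows "tensor_family (\<lambda>a. X a + Y a)"
  unfolding tensor_family_def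
proof (intro conjI ballI)
  show "X a + Y a \<in> ctensor_space s A" if "a \<in> G" for a
    using assms that ctensor_space_add unfolding tensor_family_def by blast
  show "X (a + a') + Y (a + a') = X a + Y a + (X a' + Y a')" if "a \<in> G" "a' \<in> G" for a a'
  proof -
    have "X (a + a') = X a + X a'" "Y (a + a') = Y a + Y a'"
      using assms that unfolding tensor_family_def by blast+
    then show ?thesis by (simp only: add.assoc add.left_commute add.commute)
  qed
qed

lemma tensor_family_diff:
  assumes "tensor_family X" "tensor_family Y"
  shows "tensor_family (\<lambda>a. X a - Y a)"
  unfolding tensor_family_def
proof (intro conjI ballI)
  show "X a - Y a \<in> ctensor_space s A" if "a \<in> G" for a
    using assms that ctensor_space_diff unfolding tensor_family_def by blast
  show "X (a + a') - Y (a + a') = X a - Y a + (X a' - Y a')" if "a \<in> G" "a' \<in> G" for a a'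
  proof -
    have "X (a + a') = X a + X a'" "Y (a + a') = Y a + Y a'"
      using assms that unfolding tensor_family_def by blast+
    then show ?thesis by (simp only: add_diff_add)
  qed
qed

lemma tensor_family_flip:
  assumes "tensor_family X"
  shows "tensor_family (\<lambda>a. cflip s A (X a))"
  unfolding tensor_family_def
proof (intro conjI ballI)
  show "cflip s A (X a) \<in> ctensor_space s A" if "a \<in> G" for a
    using assms that cflip_in unfolding tensor_family_def by blast
  show "cflip s A (X (a + a')) = cflip s A (X a) + cflip s A (X a')" if "a \<in> G" "a' \<in> G" for a a'
    using assms that cflip_add[of "X a" "X a'"] unfolding tensor_family_def by metis
qed

lemma biadditive_add:
  assumes "biadditive T" "biadditive U"
  shows "biadditive (\<lambda>a b. T a b + U a b)"
  using assms by (simp add: biadditive_def algebra_simps)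

lemma biadditive_diff:
  assumes "biadditive T" "biadditive U"
  shows "biadditive (\<lambda>a b. T a b - U a b)"
  using assms by (simp add: biadditive_def algebra_simps)

lemma biadditive_swap: "biadditive T \<Longrightarrow> biadditive (\<lambda>a b. T b a)"
  unfolding biadditive_def by blast

lemma biadditive_cmap_left:
  assumes "map_family h" "tensor_family X"
  shows "biadditive (\<lambda>a b. cmap s A (h a) id (X b))"
  unfolding biadditive_def
proof (intro ballI conjI)
  fix a a' b assume *: "a \<in> G" "a' \<in> G" "b \<in> G"
  have h: "bounded_map (h a)" "bounded_map (h a')" "bounded_map (h b)"
    "\<And>u. u \<in> G \<Longrightarrow> h (a + a') u = h a u + h a' u"
    using assms(1) * unfolding map_family_def by blast+
  have X: "X a \<in> ctensor_space s A" "X a' \<in> ctensor_space s A" "X b \<in> ctensor_space s A"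
    "X (a + a') = X a + X a'"
    using assms(2) * unfolding tensor_family_def by blast+
  show "cmap s A (h (a + a')) id (X b) = cmap s A (h a) id (X b) + cmap s A (h a') id (X b)"
    by (rule cmap_add_left[OF h(1,2) bounded_map_id X(3) h(4)])
  show "cmap s A (h b) id (X (a + a')) = cmap s A (h b) id (X a) + cmap s A (h b) id (X a')"
    unfolding X(4) by (rule cmap_add[OF h(3) bounded_map_id X(1,2)])
qed

lemma biadditive_cmap_right:
  assumes "map_family h" "tensor_family X"
  shows "biadditive (\<lambda>a b. cmap s A id (h a) (X b))"
  unfolding biadditive_def
proof (intro ballI conjI)
  fix a a' b assume *: "a \<in> G" "a' \<in> G" "b \<in> G"
  have h: "bounded_map (h a)" "bounded_map (h a')" "bounded_map (h b)"
    "\<And>u. u \<in> G \<Longrightarrow> h (a + a') u = h a u + h a' u"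
    using assms(1) * unfolding map_family_def by blast+
  have X: "X a \<in> ctensor_space s A" "X a' \<in> ctensor_space s A" "X b \<in> ctensor_space s A"
    "X (a + a') = X a + X a'"
    using assms(2) * unfolding tensor_family_def by blast+
  show "cmap s A id (h (a + a')) (X b) = cmap s A id (h a) (X b) + cmap s A id (h a') (X b)"
    by (rule cmap_add_right[OF bounded_map_id h(1,2) X(3) h(4)])
  show "cmap s A id (h b) (X (a + a')) = cmap s A id (h b) (X a) + cmap s A id (h b) (X a')"
    unfolding X(4) by (rule cmap_add[OF bounded_map_id h(3) X(1,2)])
qed

lemma biadditive_tensor_family:
  assumes "tensor_family X" "\<And>a b. a \<in> G \<Longrightarrow> b \<in> G \<Longrightarrow> m a b \<in> G" "biadditive m"
  shows "biadditive (\<lambda>a b. X (m a b))"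
  unfolding biadditive_def
proof (intro ballI conjI)
  fix a a' b assume *: "a \<in> G" "a' \<in> G" "b \<in> G"
  have X: "X (u + v) = X u + X v" if "u \<in> G" "v \<in> G" for u v
    using assms(1) that unfolding tensor_family_def by blast
  have m: "m (a + a') b = m a b + m a' b" "m b (a + a') = m b a + m b a'"
    using assms(3) * unfolding biadditive_def by blast+
  show "X (m (a + a') b) = X (m a b) + X (m a' b)" unfolding m by (rule X) (intro assms(2) *)+
  show "X (m b (a + a')) = X (m b a) + X (m b a')" unfolding m by (rule X) (intro assms(2) *)+
qed

lemmas biadditive_intros = biadditive_diff biadditive_add
  biadditive_cmap_left biadditive_cmap_left[THEN biadditive_swap]
  biadditive_cmap_right biadditive_cmap_right[THEN biadditive_swap]
  map_family_add map_family_diff tensor_family_add tensor_family_diff tensor_family_flip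

end

section \<open>Pairings on the tensor product with a quadratic perm algebra\<close>

text \<open>Of \<open>P\<close> only the finite-dimensional vector space is kept. A generic bilinear
  \<open>M\<close> and a generic comultiplication \<open>D\<close> are treated once and later
  specialised to \<open>mult\<close>, \<open>br\<close> and to \<open>\<Delta>\<close>,
  \<open>\<delta>\<close>.\<close>

locale perm_tensor = P: vector_space sP + B: quadratic_graded_perm_algebra sB B circ \<omega>
  for sP :: "'k::field \<Rightarrow> 'p::ab_group_add \<Rightarrow> 'p"
    and sB :: "'k \<Rightarrow> 'b::ab_group_add \<Rightarrow> 'b" and B
    and circ :: "'b \<Rightarrow> 'b \<Rightarrow> 'b" (infixl "\<odot>" 70) and \<omega> +
  fixes \<nu>\<omega> :: "'b \<Rightarrow> ('b, 'k) ctensor2"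
  assumes P_fin_dim: "fin_dim sP (UNIV :: 'p set)"
    and coform_linear: "linear_on sB cscale (gcarrier sB B) \<nu>\<omega>"
    and coform_in: "b \<in> gcarrier sB B \<Longrightarrow> \<nu>\<omega> b \<in> ctensor_space sB B"
    and coform: "b \<in> gcarrier sB B \<Longrightarrow> c \<in> gcarrier sB B \<Longrightarrow> d \<in> gcarrier sB B \<Longrightarrow>
      form_hat sB B \<omega> (\<nu>\<omega> b) c d = - \<omega> b (c \<odot> d)"
begin

abbreviation H :: "'b set" where "H \<equiv> gcarrier sB B"
abbreviation AA :: "int \<Rightarrow> ('p, 'b, 'k) tensor set" where "AA \<equiv> tensor_grading sP sB B"
abbreviation GA :: "('p, 'b, 'k) tensor set" where "GA \<equiv> gcarrier fscale AA"
abbreviation pure :: "'p \<Rightarrow> 'b \<Rightarrow> ('p, 'b, 'k) tensor" where "pure \<equiv> tensor sP sB"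

lemma P_vs: "vector_space sP" by unfold_locales
lemma P_UNIV: "P.subspace UNIV" by simp

lemma circ_in: "b \<in> H \<Longrightarrow> c \<in> H \<Longrightarrow> b \<odot> c \<in> H"
  by (rule B.m_closed)

definition deg :: int
  where "deg = (SOME m. \<forall>i j. i + j + m \<noteq> 0 \<longrightarrow> (\<forall>a\<in>B i. \<forall>b\<in>B j. \<omega> a b = 0))"

lemma form_zero: "a \<in> B i \<Longrightarrow> b \<in> B j \<Longrightarrow> i + j + deg \<noteq> 0 \<Longrightarrow> \<omega> a b = 0"
  using someI_ex[OF B.form_graded] unfolding deg_def by blast

lemma form_linear_left: "c \<in> H \<Longrightarrow> linear_on sB (*) H (\<lambda>b. \<omega> b c)"
  and form_linear_right: "b \<in> H \<Longrightarrow> linear_on sB (*) H (\<omega> b)"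
  using B.form_bilinear by (auto simp: bilinear_on_def)

text \<open>\<open>B i\<close> pairs to zero with every component except
  \<open>B (- deg - i)\<close>, so nondegeneracy over all of \<open>H\<close> can already be tested
  on that component.\<close>

lemma form_separation:
  assumes b: "b \<in> B i" and 0: "\<And>c. c \<in> B (- deg - i) \<Longrightarrow> \<omega> b c = 0"
  shows "b = 0"
proof (rule B.form_nondegenerate)
  show bH: "b \<in> H" using b by (rule B.component_in_G)
  have "c \<in> H \<and> \<omega> b c = 0" if "c \<in> H" for c
    using that unfolding gcarrier_def
  proof (induction rule: B.span_induct_alt)
    case base
    then show ?case
      using linear_on_zero[OF form_linear_right[OF bH] B.G_zero] B.G_zero by (simp add: gcarrier_def)
  next
    case (step k x y)
    then obtain j where j: "x \<in> B j" by auto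
    have "\<omega> b x = 0"
      using 0 form_zero[OF b j] j by (cases "j = - deg - i") auto
    then show ?case
      using step B.component_in_G[OF j] B.G_scale[OF B.component_in_G[OF j]] B.G_add
      by (simp add: linear_on_add[OF form_linear_right[OF bH]]
          linear_on_scale[OF form_linear_right[OF bH]] flip: gcarrier_def)
  qed
  then show "\<omega> b c = 0" if "c \<in> H" for c using that by blast
qed

text \<open>The form is only bilinear on \<open>H\<close>; a projection onto \<open>H\<close> extends it to the ambient space.\<close>

definition proj :: "'b \<Rightarrow> 'b"
  where "proj = (SOME \<pi>. Vector_Spaces.linear sB sB \<pi> \<and> (\<forall>x. \<pi> x \<in> H) \<and> (\<forall>x\<in>H. \<pi> x = x))"

lemma proj: "Vector_Spaces.linear sB sB proj" "proj x \<in> H" "x \<in> H \<Longrightarrow> proj x = x"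
proof -
  have "\<exists>\<pi>. Vector_Spaces.linear sB sB \<pi> \<and> (\<forall>x. \<pi> x \<in> H) \<and> (\<forall>x\<in>H. \<pi> x = x)"
    using exists_projection[OF B.vs B.subspace_G] by metis
  from someI_ex[OF this] show "Vector_Spaces.linear sB sB proj" "proj x \<in> H" "x \<in> H \<Longrightarrow> proj x = x"
    unfolding proj_def[symmetric] by blast+
qed

definition form_at :: "'b \<Rightarrow> 'b \<Rightarrow> 'k" where "form_at c b = \<omega> (proj b) c"

lemma form_at: "b \<in> H \<Longrightarrow> form_at c b = \<omega> b c"
  by (simp add: form_at_def proj)

lemma functional_form_at: "c \<in> H \<Longrightarrow> functional sB (form_at c)"
  using proj(1,2) form_linear_left[of c]
  by (auto simp: linear_on_def form_at_def Vector_Spaces.linear_iff)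

definition pairing :: "('p \<Rightarrow> 'k) \<Rightarrow> 'b \<Rightarrow> ('p, 'b, 'k) tensor \<Rightarrow> 'k"
  where "pairing \<phi> c = ev (\<phi> \<otimes>\<^sub>f form_at c)"

lemma functional_pairing: "functional fscale (pairing \<phi> c)"
  unfolding pairing_def by (rule functional_ev)

lemma pairing_pure:
  "functional sP \<phi> \<Longrightarrow> c \<in> H \<Longrightarrow> b \<in> H \<Longrightarrow> pairing \<phi> c (pure p b) = \<phi> p * \<omega> b c"
  by (simp add: pairing_def tensor_apply bilinear_prod_form functional_form_at)
    (simp add: prod_form_def form_at)

lemmas pairing_zero = functional_zero[OF functional_pairing]
  and pairing_add = linear_on_add[OF functional_pairing UNIV_I UNIV_I]

lemma AA_separation:
  assumes "x \<in> AA i" and "\<And>\<phi> c. functional sP \<phi> \<Longrightarrow> c \<in> B (- deg - i) \<Longrightarrow> pairing \<phi> c x = 0"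
  shows "x = 0"
proof (rule tensor_space_separation[where \<Phi> = "{\<phi>. functional sP \<phi>}" and \<Psi> = "form_at ` B (- deg - i)"])
  show "x \<in> tensor_space sP sB UNIV (B i)" using assms(1) by (simp add: tensor_grading_def)
  show "p = 0" if "\<And>\<phi>. \<phi> \<in> {\<phi>. functional sP \<phi>} \<Longrightarrow> \<phi> p = 0" for p
  proof (rule ccontr)
    assume "p \<noteq> 0"
    from exists_separating_functional[OF P_vs this] that show False
      by (auto simp: linear_on_def Vector_Spaces.linear_iff)
  qed
  show "b = 0" if "b \<in> B i" "\<And>\<psi>. \<psi> \<in> form_at ` B (- deg - i) \<Longrightarrow> \<psi> b = 0" for b
  proof (rule form_separation[OF that(1)])
    show "\<omega> b c = 0" if "c \<in> B (- deg - i)" for c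
      using \<open>\<And>\<psi>. \<psi> \<in> form_at ` B (- deg - i) \<Longrightarrow> \<psi> b = 0\<close>[of "form_at c"] that
        form_at[OF B.component_in_G[OF \<open>b \<in> B i\<close>]] by simp
  qed
qed (use assms(2) in \<open>auto simp: P_vs B.vs B.component_subspace pairing_def
    intro: functional_form_at B.component_in_G\<close>)

lemma pairing_homogeneous:
  assumes "x \<in> AA j" "functional sP \<phi>" "c \<in> B (- deg - i)" "j \<noteq> i"
  shows "pairing \<phi> c x = 0"
  using assms(1) unfolding tensor_grading_def
proof (rule tensor_space_induct[OF P_vs P_UNIV, where P = "\<lambda>x. pairing \<phi> c x = 0"])
  show "pairing \<phi> c (pure p b) = 0" if "b \<in> B j" for p b
    using form_zero[OF that assms(3)] assms(4)
    by (simp add: pairing_pure[OF assms(2)] B.component_in_G[OF that] B.component_in_G[OF assms(3)])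
qed (auto simp: pairing_zero pairing_add)

sublocale A: graded_space fscale AA
proof (unfold_locales, goal_cases)
  case (5 i)
  show ?case unfolding tensor_grading_def by (rule subspace_tensor_space)
next
  case (6 i)
  interpret FS: vector_space "fscale :: 'k \<Rightarrow> ('p, 'b, 'k) tensor \<Rightarrow> _" by (rule vector_space_fscale)
  obtain X Y where X: "finite X" "UNIV = P.span X" and Y: "finite Y" "B i = B.span Y"
    using P_fin_dim B.component_fin_dim[of i] unfolding fin_dim_def by metis
  let ?Z = "(\<lambda>(x, y). pure x y) ` (X \<times> Y)"
  have Z: "pure x y \<in> FS.span ?Z" if "x \<in> X" "y \<in> Y" for x y
    by (rule FS.span_base) (use that in auto)
  have 1: "pure p y \<in> FS.span ?Z" if "y \<in> Y" for p y
  proof -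
    have "p \<in> P.span X" using X by auto
    then show ?thesis
      by (induction rule: P.span_induct_alt)
        (auto simp only: tensor_zero_left tensor_add_left tensor_scale_pure FS.span_zero
          intro: FS.span_add FS.span_scale Z that)
  qed
  have 2: "pure p b \<in> FS.span ?Z" if "b \<in> B i" for p b
    using that unfolding Y(2)
    by (induction rule: B.span_induct_alt)
      (auto simp only: tensor_zero_right tensor_add_right tensor_scale_right FS.span_zero
        intro: FS.span_add FS.span_scale 1)
  have "AA i = FS.span ?Z"
    unfolding tensor_grading_def tensor_space_def
  proof (rule antisym; rule FS.span_minimal[OF _ FS.subspace_span])
    show "{pure u v |u v. u \<in> UNIV \<and> v \<in> B i} \<subseteq> FS.span ?Z" using 2 by auto
    show "?Z \<subseteq> FS.span {pure u v |u v. u \<in> UNIV \<and> v \<in> B i}"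
      using B.span_base[of _ Y] Y(2) by (auto intro!: FS.span_base)
  qed
  moreover have "finite ?Z" using X Y by auto
  ultimately show ?case unfolding fin_dim_def by blast
\<comment> \<open>Independence: a pairing whose letter lies in \<open>B (- deg - i)\<close> kills
  \<open>c j\<close> for \<open>j \<noteq> i\<close>, so on a vanishing sum it returns the value at
  \<open>c i\<close>, and such pairings separate \<open>AA i\<close>.\<close>
next
  case (7 c i)
  show ?case
  proof (rule AA_separation[OF 7(1)])
    fix \<phi> d
    assume \<phi>: "functional sP \<phi>" and d: "d \<in> B (- deg - i)"
    have "pairing \<phi> d (Sum_any c) = (\<Sum>j | c j \<noteq> 0. pairing \<phi> d (c j))"
      unfolding Sum_any.expand_set by (rule linear_on_sum[OF functional_pairing]) auto
    also have "\<dots> = (\<Sum>j | c j \<noteq> 0. if j = i then pairing \<phi> d (c i) else 0)"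
      by (rule sum.cong) (auto intro!: pairing_homogeneous[OF 7(1) \<phi> d])
    also have "\<dots> = pairing \<phi> d (c i)"
      using 7(2) by (auto simp: pairing_zero)
    finally show "pairing \<phi> d (c i) = 0"
      using 7(3) pairing_zero by simp
  qed
qed (auto simp: fscale_def fun_eq_iff algebra_simps)

text \<open>Tensoring with \<open>P\<close> commutes with the direct sum. This links the graded
  carrier of the theorem with \<open>P \<otimes> H\<close>, over which \<open>tensor_mult\<close>
  and \<open>tensor_comult\<close> are lifted.\<close>

lemma GA_eq: "GA = tensor_space sP sB UNIV H"
proof
  show "GA \<subseteq> tensor_space sP sB UNIV H"
    unfolding gcarrier_def[of fscale AA] tensor_grading_def
    by (intro A.span_minimal subspace_tensor_space UN_least tensor_space_mono)
      (auto intro: B.component_in_G)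
  have "pure p b \<in> GA" if "b \<in> H" for p b
    using that unfolding gcarrier_def[of sB B]
  proof (induction rule: B.span_induct_alt)
    case base
    show ?case unfolding tensor_zero_right by (rule A.G_zero)
  next
    case (step k x y)
    then obtain i where "x \<in> B i" by auto
    then have "pure p x \<in> AA i" by (simp add: tensor_grading_def tensor_in)
    then show ?case unfolding tensor_add_right tensor_scale_right
      by (intro A.G_add A.G_scale step) (rule A.component_in_G)
  qed
  then show "tensor_space sP sB UNIV H \<subseteq> GA"
    unfolding tensor_space_def by (intro A.span_minimal A.subspace_G) auto
qed

lemma pure_in_GA: "b \<in> H \<Longrightarrow> pure p b \<in> GA"
  by (simp add: GA_eq tensor_in)

lemma pure_in_AA: "b \<in> B i \<Longrightarrow> pure p b \<in> AA i"
  by (simp add: tensor_grading_def tensor_in)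

lemma GA_induct [consumes 1, case_names zero pure add]:
  assumes "x \<in> GA" "P 0" "\<And>p b i. b \<in> B i \<Longrightarrow> P (pure p b)"
    and "\<And>x y. x \<in> GA \<Longrightarrow> y \<in> GA \<Longrightarrow> P x \<Longrightarrow> P y \<Longrightarrow> P (x + y)"
  shows "P x"
proof -
  have "pure p b \<in> GA \<and> P (pure p b)" if "b \<in> H" for p b
    using that unfolding gcarrier_def[of sB B]
  proof (induction arbitrary: p rule: B.span_induct_alt)
    case base
    show ?case unfolding tensor_zero_right using assms(2) A.G_zero by blast
  next
    case (step k x y)
    then obtain i where "x \<in> B i" by auto
    then have "sB k x \<in> B i" by (rule B.subspace_scale[OF B.component_subspace])
    then have "pure p (sB k x) \<in> GA \<and> P (pure p (sB k x))"
      using assms(3) pure_in_GA B.component_in_G by blast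
    then show ?case unfolding tensor_add_right using step A.G_add assms(4) by blast
  qed
  then have pure: "P (pure p b)" if "b \<in> H" for p b using that by blast
  show ?thesis
  proof (rule tensor_space_induct[OF P_vs P_UNIV, of _ sB H, where P = P])
    show "x \<in> tensor_space sP sB UNIV H" using assms(1) by (simp only: GA_eq)
    show "P (x + y)" if "x \<in> tensor_space sP sB UNIV H" "y \<in> tensor_space sP sB UNIV H" "P x" "P y" for x y
      using assms(4) that by (simp only: GA_eq)
  qed (simp_all only: assms(2) pure)
qed

lemma ctensor_separation:
  assumes "X \<in> ctensor_space fscale AA" "Y \<in> ctensor_space fscale AA"
    and "\<And>i j \<phi> \<psi> c d. functional sP \<phi> \<Longrightarrow> functional sP \<psi> \<Longrightarrow> c \<in> B (- deg - i) \<Longrightarrow> d \<in> B (- deg - j) \<Longrightarrow>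
      X i j (pairing \<phi> c \<otimes>\<^sub>f pairing \<psi> d) = Y i j (pairing \<phi> c \<otimes>\<^sub>f pairing \<psi> d)"
  shows "X = Y"
proof (intro ext[of X Y] ext[of "X _" "Y _"])
  fix i j
  let ?\<Phi> = "\<lambda>i. {pairing \<phi> c |\<phi> c. functional sP \<phi> \<and> c \<in> B (- deg - i)}"
  have "X i j - Y i j = 0"
    by (rule tensor_space_separation[OF A.vs A.component_subspace A.vs A.component_subspace
          tensor_space_diff[OF A.component_in[OF assms(1)] A.component_in[OF assms(2)]],
          where \<Phi> = "?\<Phi> i" and \<Psi> = "?\<Phi> j"])
      (auto intro: AA_separation simp: functional_pairing assms(3))
  then show "X i j = Y i j" by simp
qed

text \<open>Two uses of \<open>tensor_space_separation\<close>: products of pairings separate the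
  square of the first two factors, and evaluations at these products then serve as the separating
  family for that square against the third factor.\<close>

lemma ctensor3_separation:
  assumes "x \<in> tensor_space fscale fscale (tensor_space fscale fscale (AA i) (AA j)) (AA k)"
    and "y \<in> tensor_space fscale fscale (tensor_space fscale fscale (AA i) (AA j)) (AA k)"
    and "\<And>\<phi> \<chi> \<psi> c d e. functional sP \<phi> \<Longrightarrow> functional sP \<chi> \<Longrightarrow> functional sP \<psi> \<Longrightarrow>
      c \<in> B (- deg - i) \<Longrightarrow> d \<in> B (- deg - j) \<Longrightarrow> e \<in> B (- deg - k) \<Longrightarrow>
      x (ev (pairing \<phi> c \<otimes>\<^sub>f pairing \<chi> d) \<otimes>\<^sub>f pairing \<psi> e) =
      y (ev (pairing \<phi> c \<otimes>\<^sub>f pairing \<chi> d) \<otimes>\<^sub>f pairing \<psi> e)"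
  shows "x = y"
proof -
  let ?\<Phi> = "\<lambda>i. {pairing \<phi> c |\<phi> c. functional sP \<phi> \<and> c \<in> B (- deg - i)}"
  let ?\<Phi>2 = "{ev (F \<otimes>\<^sub>f F') |F F'. F \<in> ?\<Phi> i \<and> F' \<in> ?\<Phi> j}"
  have "x - y = 0"
  proof (rule tensor_space_separation[OF vector_space_fscale subspace_tensor_space A.vs A.component_subspace
          tensor_space_diff[OF assms(1,2)], where \<Phi> = ?\<Phi>2 and \<Psi> = "?\<Phi> k"])
    show "t = 0" if "t \<in> tensor_space fscale fscale (AA i) (AA j)" "\<And>F. F \<in> ?\<Phi>2 \<Longrightarrow> F t = 0" for t
    proof (rule tensor_space_separation[OF A.vs A.component_subspace A.vs A.component_subspace that(1),
          where \<Phi> = "?\<Phi> i" and \<Psi> = "?\<Phi> j"])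
      show "t (F \<otimes>\<^sub>f F') = 0" if "F \<in> ?\<Phi> i" "F' \<in> ?\<Phi> j" for F F'
        using \<open>\<And>F. F \<in> ?\<Phi>2 \<Longrightarrow> F t = 0\<close>[of "ev (F \<otimes>\<^sub>f F')"] that by blast
    qed (auto intro: AA_separation simp: functional_pairing)
    show "functional fscale F" if "F \<in> ?\<Phi>2" for F using that functional_ev by auto
  qed (auto intro: AA_separation simp: functional_pairing assms(3))
  then show ?thesis by simp
qed

end

lemma vector_space_cscale: "vector_space (cscale :: 'k::field \<Rightarrow> ('a, 'k) ctensor2 \<Rightarrow> _)"
  by unfold_locales (auto simp: cscale_def fscale_def fun_eq_iff algebra_simps)

section \<open>Adjoints under the form and products on the tensor product\<close>

context perm_tensor
begin

text \<open>With respect to \<open>\<omega>\<close>, left multiplications are self-adjoint and the adjoint of \<open>R\<close> is \<open>L - R\<close>.\<close>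

lemma form_left:
  assumes "x \<in> H" "b \<in> H" "c \<in> H"
  shows "\<omega> (x \<odot> b) c = \<omega> b (x \<odot> c)"
proof -
  have inv: "\<omega> (a \<odot> b) c = \<omega> a (b \<odot> c) - \<omega> a (c \<odot> b)" if "a \<in> H" "b \<in> H" "c \<in> H" for a b c
    using B.form_invariant[OF that] linear_on_add[OF form_linear_right[OF that(1)], of "b \<odot> c - c \<odot> b" "c \<odot> b"]
    by (simp add: that circ_in B.G_diff)
  \<comment> \<open>Invariance for the triples (x, b, c), (b, c, x) and (c, b, x), combined by
    skewness: the value \<open>\<omega> (x \<odot> b) c\<close> occurs on both sides and
    cancels.\<close>
  have 1: "\<omega> c (b \<odot> x) = \<omega> b (c \<odot> x) - \<omega> b (x \<odot> c)" if "b \<in> H" "c \<in> H" for b c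
    using inv[OF assms(1) that] inv[OF that(1,2) assms(1)] inv[OF that(2,1) assms(1)]
      B.form_skew[of x "b \<odot> c"] B.form_skew[of x "c \<odot> b"] B.form_skew[of c "x \<odot> b"]
    by (simp add: circ_in that assms algebra_simps)
  \<comment> \<open>Adding the relation to the one with \<open>b\<close> and \<open>c\<close>
    exchanged cancels the terms in which \<open>x\<close> stands on the right; skewness then gives
    self-adjointness.\<close>
  from 1[OF assms(2,3)] 1[OF assms(3,2)] show ?thesis
    using B.form_skew[of c "x \<odot> b"] assms by (simp add: circ_in)
qed

lemmas form_right = B.form_invariant

lemma circ_add_left: "b \<in> H \<Longrightarrow> b' \<in> H \<Longrightarrow> c \<in> H \<Longrightarrow> (b + b') \<odot> c = b \<odot> c + b' \<odot> c"
  and circ_add_right: "b \<in> H \<Longrightarrow> c \<in> H \<Longrightarrow> c' \<in> H \<Longrightarrow> b \<odot> (c + c') = b \<odot> c + b \<odot> c'"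
  and circ_scale_left: "b \<in> H \<Longrightarrow> c \<in> H \<Longrightarrow> sB k b \<odot> c = sB k (b \<odot> c)"
  and circ_scale_right: "b \<in> H \<Longrightarrow> c \<in> H \<Longrightarrow> b \<odot> sB k c = sB k (b \<odot> c)"
  using B.m_bilinear by (auto simp: bilinear_on_def linear_on_def)

context
  fixes M :: "'p \<Rightarrow> 'p \<Rightarrow> 'p"
  assumes M: "bilinear_on sP sP sP UNIV UNIV M"
begin

abbreviation TM where "TM \<equiv> tensor_mult sP sB B M (\<odot>)"

lemma M_add_left: "M (p + p') q = M p q + M p' q"
  and M_add_right: "M p (q + q') = M p q + M p q'"
  and M_scale_left: "M (sP k p) q = sP k (M p q)"
  and M_scale_right: "M p (sP k q) = sP k (M p q)"
  using M by (auto simp: bilinear_on_def linear_on_def)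

lemma lift_mult_inner:
  "b \<in> H \<Longrightarrow> tensor_lift sP sB fscale UNIV H (\<lambda>q c. pure (M p q) (b \<odot> c))"
  unfolding tensor_lift_def
  by (auto simp: P_vs B.vs vector_space_fscale B.subspace_G bilinear_on_def linear_on_def
      M_add_right M_scale_right circ_add_right circ_scale_right
      tensor_add_left tensor_add_right tensor_scale_pure tensor_scale_right)

lemma lift_mult_outer:
  assumes y: "y \<in> GA"
  shows "tensor_lift sP sB fscale UNIV H (\<lambda>p b. tlift sP sB UNIV H (\<lambda>q c. pure (M p q) (b \<odot> c)) y)"
proof -
  have y: "y \<in> tensor_space sP sB UNIV H" using y by (simp only: GA_eq)
  have "bilinear_on sP sB fscale UNIV H (\<lambda>p b. tlift sP sB UNIV H (\<lambda>q c. pure (M p q) (b \<odot> c)) y)"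
    unfolding bilinear_on_def linear_on_def
  proof (intro conjI ballI allI)
    fix p p' b b' k assume b: "b \<in> H" and b': "b' \<in> H"
    note i = lift_mult_inner and f = tensor_lift.f[OF lift_mult_inner]
    show "tlift sP sB UNIV H (\<lambda>q c. pure (M p q) ((b + b') \<odot> c)) y =
      tlift sP sB UNIV H (\<lambda>q c. pure (M p q) (b \<odot> c)) y + tlift sP sB UNIV H (\<lambda>q c. pure (M p q) (b' \<odot> c)) y"
      by (rule tensor_lift.lift_fun_add[OF i f f _ y])
        (simp_all add: b b' B.G_add circ_add_left tensor_add_right)
    show "tlift sP sB UNIV H (\<lambda>q c. pure (M p q) (sB k b \<odot> c)) y =
      fscale k (tlift sP sB UNIV H (\<lambda>q c. pure (M p q) (b \<odot> c)) y)"
      by (rule tensor_lift.lift_fun_scale[OF i f _ y])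
        (simp_all add: b B.G_scale circ_scale_left tensor_scale_right)
    show "tlift sP sB UNIV H (\<lambda>q c. pure (M (p + p') q) (b \<odot> c)) y =
      tlift sP sB UNIV H (\<lambda>q c. pure (M p q) (b \<odot> c)) y + tlift sP sB UNIV H (\<lambda>q c. pure (M p' q) (b \<odot> c)) y"
      by (rule tensor_lift.lift_fun_add[OF i f f _ y])
        (simp_all add: b M_add_left tensor_add_left)
    show "tlift sP sB UNIV H (\<lambda>q c. pure (M (sP k p) q) (b \<odot> c)) y =
      fscale k (tlift sP sB UNIV H (\<lambda>q c. pure (M p q) (b \<odot> c)) y)"
      by (rule tensor_lift.lift_fun_scale[OF i f _ y])
        (simp_all add: b M_scale_left tensor_scale_pure)
  qed
  then show ?thesis
    by (simp add: tensor_lift_def P_vs B.vs vector_space_fscale B.subspace_G)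
qed

lemma mult_pure: "b \<in> H \<Longrightarrow> c \<in> H \<Longrightarrow> TM (pure p b) (pure q c) = pure (M p q) (b \<odot> c)"
  unfolding tensor_mult_def
  by (simp add: tensor_lift.lift_pure[OF lift_mult_outer] pure_in_GA tensor_lift.lift_pure[OF lift_mult_inner])

lemma mult_bilinear: "bilinear_on fscale fscale fscale GA GA TM"
  unfolding bilinear_on_def
proof (intro conjI ballI)
  fix x assume x: "x \<in> GA"
  note x' = x[unfolded GA_eq]
  show "linear_on fscale fscale GA (TM x)"
  proof (rule linear_onI)
    fix y y' assume y: "y \<in> GA" "y' \<in> GA"
    note y' = y[unfolded GA_eq]
    show "TM x (y + y') = TM x y + TM x y'"
      unfolding tensor_mult_def
      by (rule tensor_lift.lift_fun_add[OF lift_mult_outer tensor_lift.f[OF lift_mult_outer]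
            tensor_lift.f[OF lift_mult_outer] _ x'])
        (simp_all add: y A.G_add tensor_lift.lift_add[OF lift_mult_inner] y')
  next
    fix k y assume y: "y \<in> GA"
    note y' = y[unfolded GA_eq]
    show "TM x (fscale k y) = fscale k (TM x y)"
      unfolding tensor_mult_def
      by (rule tensor_lift.lift_fun_scale[OF lift_mult_outer tensor_lift.f[OF lift_mult_outer] _ x'])
        (simp_all add: y A.G_scale tensor_lift.lift_scale[OF lift_mult_inner] y')
  qed
next
  fix y assume "y \<in> GA"
  then show "linear_on fscale fscale GA (\<lambda>x. TM x y)"
    unfolding tensor_mult_def
    using tensor_lift.linear_lift[OF lift_mult_outer] by (simp only: GA_eq)
qed

lemmas mult_add_left = bilinear_on_add_left[OF mult_bilinear]
  and mult_add_right = bilinear_on_add_right[OF mult_bilinear]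
  and mult_zero_left = bilinear_on_zero_left[OF mult_bilinear A.G_zero]
  and mult_zero_right = bilinear_on_zero_right[OF mult_bilinear _ A.G_zero]

text \<open>Stated for general subsets so that one induction gives both closure (all three equal to
  \<open>H\<close>) and the grading (components of \<open>B\<close>).\<close>

lemma mult_in_tensor_space:
  assumes "x \<in> tensor_space sP sB UNIV S" "y \<in> tensor_space sP sB UNIV T"
    and ST: "S \<subseteq> H" "T \<subseteq> H" "\<And>b c. b \<in> S \<Longrightarrow> c \<in> T \<Longrightarrow> b \<odot> c \<in> U"
  shows "TM x y \<in> tensor_space sP sB UNIV U"
proof -
  have sub: "z \<in> GA" if "z \<in> tensor_space sP sB UNIV X" "X \<subseteq> H" for z X
    using that tensor_space_mono[of UNIV UNIV X H] unfolding GA_eq by blast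
  have 1: "TM (pure p b) y \<in> tensor_space sP sB UNIV U" if b: "b \<in> S" for p b
  proof (rule tensor_space_induct[OF P_vs P_UNIV assms(2), where
        P = "\<lambda>y. TM (pure p b) y \<in> tensor_space sP sB UNIV U"])
    have bH: "b \<in> H" using b ST by auto
    show "TM (pure p b) 0 \<in> tensor_space sP sB UNIV U"
      by (simp only: mult_zero_right[OF pure_in_GA[OF bH]] tensor_space_zero)
    show "TM (pure p b) (pure q c) \<in> tensor_space sP sB UNIV U" if "c \<in> T" for q c
      using that b ST by (subst mult_pure) (auto intro!: tensor_in)
    show "TM (pure p b) (y + y') \<in> tensor_space sP sB UNIV U"
      if "y \<in> tensor_space sP sB UNIV T" "y' \<in> tensor_space sP sB UNIV T"
        "TM (pure p b) y \<in> tensor_space sP sB UNIV U" "TM (pure p b) y' \<in> tensor_space sP sB UNIV U" for y y'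
      using that by (simp only: mult_add_right[OF pure_in_GA[OF bH] sub sub] ST tensor_space_add)
  qed
  have yG: "y \<in> GA" by (rule sub[OF assms(2) ST(2)])
  show ?thesis
  proof (rule tensor_space_induct[OF P_vs P_UNIV assms(1), where
        P = "\<lambda>x. TM x y \<in> tensor_space sP sB UNIV U"])
    show "TM 0 y \<in> tensor_space sP sB UNIV U"
      by (simp only: mult_zero_left[OF yG] tensor_space_zero)
    show "TM (x + x') y \<in> tensor_space sP sB UNIV U"
      if "x \<in> tensor_space sP sB UNIV S" "x' \<in> tensor_space sP sB UNIV S"
        "TM x y \<in> tensor_space sP sB UNIV U" "TM x' y \<in> tensor_space sP sB UNIV U" for x x'
      using that by (simp only: mult_add_left[OF sub sub yG] ST tensor_space_add)
  qed (rule 1)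
qed

lemma mult_in: "x \<in> GA \<Longrightarrow> y \<in> GA \<Longrightarrow> TM x y \<in> GA"
  unfolding GA_eq by (rule mult_in_tensor_space) (auto intro: circ_in)

lemma mult_graded: "x \<in> AA i \<Longrightarrow> y \<in> AA j \<Longrightarrow> TM x y \<in> AA (i + j)"
  unfolding tensor_grading_def
  by (rule mult_in_tensor_space) (auto intro: B.component_in_G B.circ_graded)

lemma functional_M_left: "functional sP \<phi> \<Longrightarrow> functional sP (\<lambda>p. \<phi> (M q p))"
  and functional_M_right: "functional sP \<phi> \<Longrightarrow> functional sP (\<lambda>p. \<phi> (M p q))"
  using M by (auto simp: bilinear_on_def linear_on_def)

text \<open>The adjoint acts on the two factors of a pairing separately: \<open>\<phi>\<close> is
  precomposed with \<open>M q\<close>, and \<open>b\<close> moves across the form by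
  \<open>form_left\<close>.\<close>

lemma pairing_mult_left:
  assumes "functional sP \<phi>" "b \<in> H" "c \<in> H" "x \<in> GA"
  shows "pairing \<phi> c (TM (pure q b) x) = pairing (\<lambda>p. \<phi> (M q p)) (b \<odot> c) x"
  using assms(4)
proof (rule GA_induct[where P = "\<lambda>x. pairing \<phi> c (TM (pure q b) x) = pairing (\<lambda>p. \<phi> (M q p)) (b \<odot> c) x"])
  show "pairing \<phi> c (TM (pure q b) 0) = pairing (\<lambda>p. \<phi> (M q p)) (b \<odot> c) 0"
    by (simp only: mult_zero_right[OF pure_in_GA[OF assms(2)]] pairing_zero)
  show "pairing \<phi> c (TM (pure q b) (pure p b')) = pairing (\<lambda>p. \<phi> (M q p)) (b \<odot> c) (pure p b')"
    if "b' \<in> B i" for p b' i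
    using B.component_in_G[OF that] assms
    by (simp add: mult_pure pairing_pure functional_M_left circ_in form_left)
qed (simp only: mult_add_right[OF pure_in_GA[OF assms(2)]] pairing_add)

lemma pairing_mult_right:
  assumes "functional sP \<phi>" "b \<in> H" "c \<in> H" "x \<in> GA"
  shows "pairing \<phi> c (TM x (pure q b)) = pairing (\<lambda>p. \<phi> (M p q)) (b \<odot> c - c \<odot> b) x"
  using assms(4)
proof (rule GA_induct[where P = "\<lambda>x. pairing \<phi> c (TM x (pure q b)) = pairing (\<lambda>p. \<phi> (M p q)) (b \<odot> c - c \<odot> b) x"])
  show "pairing \<phi> c (TM 0 (pure q b)) = pairing (\<lambda>p. \<phi> (M p q)) (b \<odot> c - c \<odot> b) 0"
    by (simp only: mult_zero_left[OF pure_in_GA[OF assms(2)]] pairing_zero)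
  show "pairing \<phi> c (TM (pure p b') (pure q b)) = pairing (\<lambda>p. \<phi> (M p q)) (b \<odot> c - c \<odot> b) (pure p b')"
    if "b' \<in> B i" for p b' i
    using B.component_in_G[OF that] assms
    by (simp add: mult_pure pairing_pure functional_M_right circ_in form_right B.G_diff)
qed (simp only: mult_add_left[OF _ _ pure_in_GA[OF assms(2)]] pairing_add)

lemma shift_mult_left: "x \<in> AA n \<Longrightarrow> A.shift_map n (TM x)"
  and shift_mult_right: "x \<in> AA n \<Longrightarrow> A.shift_map n (\<lambda>y. TM y x)"
  using mult_bilinear A.component_in_G mult_graded[of x n] mult_graded[of _ _ x n]
  by (auto simp: A.shift_map_def bilinear_on_def add.commute[of _ n])

text \<open>Homogeneous pure tensors give shifts, and bounded maps, unlike shifts of different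
  degrees, are closed under sums.\<close>

lemma bounded_mult:
  assumes "x \<in> GA"
  shows "A.bounded_map (TM x) \<and> A.bounded_map (\<lambda>y. TM y x)"
  using assms
proof (rule GA_induct[where P = "\<lambda>x. A.bounded_map (TM x) \<and> A.bounded_map (\<lambda>y. TM y x)"])
  have "0 \<in> AA 0" by (rule A.component_zero)
  then show "A.bounded_map (TM 0) \<and> A.bounded_map (\<lambda>y. TM y 0)"
    using shift_mult_left shift_mult_right A.shift_map_bounded by blast
  show "A.bounded_map (TM (pure p b)) \<and> A.bounded_map (\<lambda>y. TM y (pure p b))" if "b \<in> B i" for p b i
    using shift_mult_left shift_mult_right A.shift_map_bounded pure_in_AA[OF that] by blast
  show "A.bounded_map (TM (x + x')) \<and> A.bounded_map (\<lambda>y. TM y (x + x'))"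
    if "x \<in> GA" "x' \<in> GA" "A.bounded_map (TM x) \<and> A.bounded_map (\<lambda>y. TM y x)"
      "A.bounded_map (TM x') \<and> A.bounded_map (\<lambda>y. TM y x')" for x x'
  proof
    show "A.bounded_map (TM (x + x'))"
      by (rule A.bounded_map_cong[OF A.bounded_map_add, of "TM x" "TM x'"])
        (simp_all only: that mult_add_left)
    show "A.bounded_map (\<lambda>y. TM y (x + x'))"
      by (rule A.bounded_map_cong[OF A.bounded_map_add, of "\<lambda>y. TM y x" "\<lambda>y. TM y x'"])
        (simp_all only: that mult_add_right)
  qed
qed

end

end

section \<open>Comultiplications\<close>

context perm_tensor
begin

lemma lift_bullet_inner:
  "tensor_lift sB sB fscale (B i) (B j) (\<lambda>u v. tensor fscale fscale (pure p u) (pure q v))"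
  by (rule tensor_square.tensor_lift[OF B.square vector_space_fscale bilinear_tensor_comp])
    (auto simp: linear_on_def tensor_add_right tensor_scale_right)

lemma lift_bullet_outer:
  assumes x: "x \<in> tensor_space sB sB (B i) (B j)"
  shows "tensor_lift sP sP fscale UNIV UNIV
    (\<lambda>p q. tlift sB sB (B i) (B j) (\<lambda>u v. tensor fscale fscale (pure p u) (pure q v)) x)"
proof -
  note i = lift_bullet_inner and f = tensor_lift.f[OF lift_bullet_inner]
  have "bilinear_on sP sP fscale UNIV UNIV
    (\<lambda>p q. tlift sB sB (B i) (B j) (\<lambda>u v. tensor fscale fscale (pure p u) (pure q v)) x)"
    unfolding bilinear_on_def linear_on_def
    by (intro conjI ballI allI; (rule tensor_lift.lift_fun_add[OF i f f _ x] | rule tensor_lift.lift_fun_scale[OF i f _ x]))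
      (simp_all only: tensor_add_left tensor_add_right tensor_scale_pure tensor_scale_right)
  then show ?thesis
    by (simp add: tensor_lift_def P_vs vector_space_fscale)
qed

lemma bullet_add_left:
  "t \<in> tensor_space sP sP UNIV UNIV \<Longrightarrow> t' \<in> tensor_space sP sP UNIV UNIV \<Longrightarrow> x \<in> ctensor_space sB B \<Longrightarrow>
    bullet sP sB B (t + t') x = bullet sP sB B t x + bullet sP sB B t' x"
  by (intro ext) (simp only: bullet_def plus_fun_apply tensor_lift.lift_add[OF lift_bullet_outer[OF B.component_in]])

lemma bullet_scale_left:
  "t \<in> tensor_space sP sP UNIV UNIV \<Longrightarrow> x \<in> ctensor_space sB B \<Longrightarrow>
    bullet sP sB B (fscale k t) x = cscale k (bullet sP sB B t x)"
  by (intro ext) (simp only: bullet_def cscale_def tensor_lift.lift_scale[OF lift_bullet_outer[OF B.component_in]])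

lemma bullet_add_right:
  assumes t: "t \<in> tensor_space sP sP UNIV UNIV" and x: "x \<in> ctensor_space sB B" "y \<in> ctensor_space sB B"
  shows "bullet sP sB B t (x + y) = bullet sP sB B t x + bullet sP sB B t y"
proof (intro ext[of "bullet sP sB B t (x + y)"] ext[of "bullet sP sB B t (x + y) _"])
  fix i j
  show "bullet sP sB B t (x + y) i j = (bullet sP sB B t x + bullet sP sB B t y) i j"
    unfolding bullet_def plus_fun_def[of "bullet sP sB B t x" for x]
    by (simp only: plus_fun_apply, rule tensor_lift.lift_fun_add[OF lift_bullet_outer tensor_lift.f[OF lift_bullet_outer]
          tensor_lift.f[OF lift_bullet_outer] _ t])
      (simp_all only: B.component_in x tensor_space_add tensor_lift.lift_add[OF lift_bullet_inner])
qed

lemma bullet_scale_right: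
  assumes t: "t \<in> tensor_space sP sP UNIV UNIV" and x: "x \<in> ctensor_space sB B"
  shows "bullet sP sB B t (cscale k x) = cscale k (bullet sP sB B t x)"
proof (intro ext[of "bullet sP sB B t (cscale k x)"] ext[of "bullet sP sB B t (cscale k x) _"])
  fix i j
  show "bullet sP sB B t (cscale k x) i j = cscale k (bullet sP sB B t x) i j"
    unfolding bullet_def cscale_def
    by (rule tensor_lift.lift_fun_scale[OF lift_bullet_outer tensor_lift.f[OF lift_bullet_outer] _ t])
      (simp_all only: B.component_in x tensor_space_scale tensor_lift.lift_scale[OF lift_bullet_inner])
qed

lemma bullet_in:
  assumes t: "t \<in> tensor_space sP sP UNIV UNIV" and x: "x \<in> ctensor_space sB B"
  shows "bullet sP sB B t x \<in> ctensor_space fscale AA"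
  unfolding ctensor_space_def bullet_def mem_Collect_eq
proof (intro allI tensor_lift.lift_in[OF lift_bullet_outer[OF B.component_in[OF x]] t subspace_tensor_space])
  show "tlift sB sB (B i) (B j) (\<lambda>u v. tensor fscale fscale (pure p u) (pure q v)) (x i j)
      \<in> tensor_space fscale fscale (AA i) (AA j)" for i j p q
    by (rule tensor_lift.lift_in[OF lift_bullet_inner B.component_in[OF x] subspace_tensor_space])
      (intro tensor_in pure_in_AA)
qed

text \<open>The value factors into a \<open>P\<close> part and a \<open>B\<close> part. This lets
  Poisson identities and perm identities be used independently.\<close>

lemma bullet_eval:
  assumes t: "t \<in> tensor_space sP sP UNIV UNIV" and x: "x \<in> ctensor_space sB B"
    and \<phi>: "functional sP \<phi>" "functional sP \<psi>" and c: "c \<in> H" "d \<in> H"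
  shows "bullet sP sB B t x i j (pairing \<phi> c \<otimes>\<^sub>f pairing \<psi> d) =
    t (\<phi> \<otimes>\<^sub>f \<psi>) * x i j (form_at c \<otimes>\<^sub>f form_at d)"
proof -
  define K where "K = x i j (form_at c \<otimes>\<^sub>f form_at d)"
  have inner: "tlift sB sB (B i) (B j) (\<lambda>u v. tensor fscale fscale (pure p u) (pure q v)) (x i j)
      (pairing \<phi> c \<otimes>\<^sub>f pairing \<psi> d) = \<phi> p * \<psi> q * K" for p q
  proof -
    have "tlift sB sB (B i) (B j) (\<lambda>u v. tensor fscale fscale (pure p u) (pure q v)) (x i j)
        (pairing \<phi> c \<otimes>\<^sub>f pairing \<psi> d) =
        x i j ((\<lambda>u. \<phi> p * form_at c u) \<otimes>\<^sub>f (\<lambda>v. \<psi> q * form_at d v))"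
      by (rule tensor_lift.lift_eval[OF lift_bullet_inner B.component_in[OF x], where h = "ev (pairing \<phi> c \<otimes>\<^sub>f pairing \<psi> d)"])
        (simp_all add: tensor_apply bilinear_prod_form functional_pairing functional_cmult functional_form_at c,
         simp add: prod_form_def pairing_pure \<phi> c B.component_in_G form_at)
    also have "\<dots> = \<phi> p * (\<psi> q * K)"
      unfolding K_def
      by (simp only: tensor_eval_scale_left[OF B.vs B.component_subspace B.component_in[OF x]]
          tensor_eval_scale_right[OF B.vs B.component_subspace B.component_in[OF x]]
          functional_cmult functional_form_at c)
    finally show ?thesis by simp
  qed
  have "bullet sP sB B t x i j (pairing \<phi> c \<otimes>\<^sub>f pairing \<psi> d) = t ((\<lambda>p. K * \<phi> p) \<otimes>\<^sub>f \<psi>)"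
    unfolding bullet_def
    by (rule tensor_lift.lift_eval[OF lift_bullet_outer[OF B.component_in[OF x]] t,
          where h = "ev (pairing \<phi> c \<otimes>\<^sub>f pairing \<psi> d)"])
      (simp_all add: bilinear_prod_form functional_cmult \<phi> inner, simp add: prod_form_def)
  also have "\<dots> = K * t (\<phi> \<otimes>\<^sub>f \<psi>)"
    by (rule tensor_eval_scale_left[OF P_vs P_UNIV t \<phi>])
  finally show ?thesis by (simp add: K_def)
qed

text \<open>\<open>form_hat\<close> sums over all pairs of degrees, but for homogeneous
  \<open>c\<close> and \<open>d\<close> only \<open>(i, j)\<close> survives. The defining equation
  thus determines each component separately.\<close>

lemma coform_eval:
  assumes b: "b \<in> H" and c: "c \<in> B (- deg - i)" and d: "d \<in> B (- deg - j)"
  shows "\<nu>\<omega> b i j (form_at c \<otimes>\<^sub>f form_at d) = - \<omega> b (c \<odot> d)"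
proof -
  have H: "c \<in> H" "d \<in> H" using c d B.component_in_G by auto
  note x = B.component_in[OF coform_in[OF b]]
  let ?f = "\<lambda>u v. \<omega> u c * \<omega> v d"
  have "form_hat sB B \<omega> (\<nu>\<omega> b) c d = (\<lambda>(i, j). tlift sB sB (B i) (B j) ?f (\<nu>\<omega> b i j)) (i, j)"
    unfolding form_hat_def
  proof (rule Sum_any_single)
    fix r assume "r \<noteq> (i, j)"
    then obtain i' j' where r: "r = (i', j')" "i' \<noteq> i \<or> j' \<noteq> j" by (cases r) auto
    have "?f u v = 0" if "u \<in> B i'" "v \<in> B j'" for u v
      using r(2) form_zero[OF that(1) c] form_zero[OF that(2) d] by auto
    then have "tlift sB sB (B i') (B j') ?f (\<nu>\<omega> b i' j') = 0"
      by (intro tlift_zero[OF B.vs B.component_subspace B.vs B.component_subspace vector_space_mult x])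
    then show "(\<lambda>(i, j). tlift sB sB (B i) (B j) ?f (\<nu>\<omega> b i j)) r = 0" by (simp add: r)
  qed
  also have "\<dots> = \<nu>\<omega> b i j (form_at c \<otimes>\<^sub>f form_at d)"
    unfolding prod.case
  proof (rule tensor_lift.lift_eval[OF _ x, where h = "\<lambda>a. a"])
    have "bilinear_on sB sB (*) (B i) (B j) ?f"
      using linear_on_add[OF form_linear_left[OF H(1)]] linear_on_add[OF form_linear_left[OF H(2)]]
        linear_on_scale[OF form_linear_left[OF H(1)]] linear_on_scale[OF form_linear_left[OF H(2)]]
      by (simp add: bilinear_on_def linear_on_def B.component_in_G algebra_simps)
    then show "tensor_lift sB sB (*) (B i) (B j) ?f"
      by (rule tensor_square.tensor_lift[OF B.square vector_space_mult])
  qed (simp_all add: bilinear_prod_form functional_form_at H, simp add: prod_form_def form_at B.component_in_G)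
  finally show ?thesis using coform[OF b H] by simp
qed

text \<open>The product of letters dual to degrees \<open>i\<close> and \<open>j\<close> is dual to
  degree \<open>i + j + deg\<close>. This is where the index \<open>i + j + deg\<close> of the
  comultiplications comes from.\<close>

lemma circ_component:
  assumes "c \<in> B (- deg - i)" "d \<in> B (- deg - j)"
  shows "c \<odot> d \<in> B (- deg - (i + j + deg))"
proof -
  have "- deg - (i + j + deg) = (- deg - i) + (- deg - j)" by simp
  then show ?thesis using B.circ_graded[OF assms] by simp
qed

text \<open>The minus sign in \<open>comult_eval\<close> is moved into the letter, so that the
  result is again a pairing and a second comultiplication can be evaluated on it.\<close>

lemma pairing_neg:
  assumes "functional sP \<phi>" "c \<in> H" "x \<in> GA"
  shows "pairing \<phi> (- c) x = - pairing \<phi> c x"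
proof (rule GA_induct[OF assms(3), where P = "\<lambda>x. pairing \<phi> (- c) x = - pairing \<phi> c x"])
  show "pairing \<phi> (- c) (pure p b) = - pairing \<phi> c (pure p b)" if "b \<in> B i" for p b i
    using B.component_in_G[OF that] assms(1,2) linear_on_scale[OF form_linear_right, of b c "- 1"]
    by (simp add: pairing_pure B.G_neg)
qed (simp_all only: pairing_zero pairing_add minus_zero minus_add_distrib)

lemma A_cube: "tensor_cube fscale (AA i) (AA j) (AA k) (AA l)"
  by (simp add: tensor_cube_def A.square)

context
  fixes D :: "'p \<Rightarrow> ('p, 'p, 'k) tensor"
  assumes D_linear: "linear_on sP fscale UNIV D"
    and D_in: "D p \<in> tensor_space sP sP UNIV UNIV"
begin

abbreviation TD where "TD \<equiv> tensor_comult sP sB B D \<nu>\<omega>"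

lemma lift_comult: "tensor_lift sP sB cscale UNIV H (\<lambda>p b. bullet sP sB B (D p) (\<nu>\<omega> b))"
proof -
  have "bilinear_on sP sB cscale UNIV H (\<lambda>p b. bullet sP sB B (D p) (\<nu>\<omega> b))"
    unfolding bilinear_on_def linear_on_def
    by (intro conjI ballI allI)
      (simp_all only: linear_on_add[OF D_linear] linear_on_scale[OF D_linear] linear_on_add[OF coform_linear]
        linear_on_scale[OF coform_linear] bullet_add_left bullet_scale_left bullet_add_right
        bullet_scale_right D_in coform_in UNIV_I)
  then show ?thesis
    by (simp add: tensor_lift_def P_vs B.vs vector_space_cscale B.subspace_G)
qed

lemma comult_linear: "linear_on fscale cscale GA TD"
  unfolding tensor_comult_def using tensor_lift.linear_lift[OF lift_comult] by (simp only: GA_eq)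

lemmas comult_add = linear_on_add[OF comult_linear]
  and comult_zero = linear_on_zero[OF comult_linear A.G_zero]

lemma comult_pure: "b \<in> H \<Longrightarrow> TD (pure p b) = bullet sP sB B (D p) (\<nu>\<omega> b)"
  unfolding tensor_comult_def by (simp add: tensor_lift.lift_pure[OF lift_comult])

lemma comult_in:
  assumes "x \<in> GA"
  shows "TD x \<in> ctensor_space fscale AA"
proof (rule GA_induct[OF assms, where P = "\<lambda>x. TD x \<in> ctensor_space fscale AA"])
  show "TD 0 \<in> ctensor_space fscale AA"
    by (simp only: comult_zero A.ctensor_space_zero)
  show "TD (pure p b) \<in> ctensor_space fscale AA" if "b \<in> B i" for p b i
    by (simp only: comult_pure B.component_in_G[OF that] bullet_in D_in coform_in)
qed (simp only: comult_add A.ctensor_space_add)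

lemma functional_dual: "functional sP (\<lambda>p. D p \<beta>)"
  by (rule functional_ev_comp[OF D_linear])

lemma comult_eval:
  assumes "x \<in> GA" and \<phi>: "functional sP \<phi>" "functional sP \<psi>"
    and c: "c \<in> B (- deg - i)" "d \<in> B (- deg - j)"
  shows "TD x i j (pairing \<phi> c \<otimes>\<^sub>f pairing \<psi> d) = - pairing (\<lambda>p. D p (\<phi> \<otimes>\<^sub>f \<psi>)) (c \<odot> d) x"
proof (rule GA_induct[OF assms(1), where
      P = "\<lambda>x. TD x i j (pairing \<phi> c \<otimes>\<^sub>f pairing \<psi> d) = - pairing (\<lambda>p. D p (\<phi> \<otimes>\<^sub>f \<psi>)) (c \<odot> d) x"])
  show "TD 0 i j (pairing \<phi> c \<otimes>\<^sub>f pairing \<psi> d) = - pairing (\<lambda>p. D p (\<phi> \<otimes>\<^sub>f \<psi>)) (c \<odot> d) 0"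
    by (simp only: comult_zero zero_fun_apply pairing_zero neg_equal_0_iff_equal minus_zero)
  show "TD (pure p b) i j (pairing \<phi> c \<otimes>\<^sub>f pairing \<psi> d) = - pairing (\<lambda>p. D p (\<phi> \<otimes>\<^sub>f \<psi>)) (c \<odot> d) (pure p b)"
    if "b \<in> B n" for p b n
    using B.component_in_G[OF that] B.component_in_G[OF c(1)] B.component_in_G[OF c(2)]
    by (simp add: comult_pure bullet_eval D_in coform_in coform_eval \<phi> c pairing_pure functional_dual circ_in)
qed (simp only: comult_add plus_fun_apply pairing_add minus_add_distrib add.commute)

text \<open>The form has degree \<open>deg\<close>, so the comultiplications are homogeneous of degree \<open>- deg\<close>.\<close>

lemma comult_homogeneous:
  assumes x: "x \<in> AA l" and l: "l \<noteq> i + j + deg"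
  shows "TD x i j = 0"
proof -
  have xG: "x \<in> GA" using x by (rule A.component_in_G)
  \<comment> \<open>Separation compares whole families, so the component in question is extended by
    zero to a family.\<close>
  let ?X = "\<lambda>i' j'. if i' = i \<and> j' = j then TD x i j else 0"
  have "?X = 0"
  proof (rule ctensor_separation)
    show "?X \<in> ctensor_space fscale AA"
      using A.component_in[OF comult_in[OF xG]] tensor_space_zero by (auto simp: ctensor_space_def)
    show "0 \<in> ctensor_space fscale AA"
      by (rule A.ctensor_space_zero)
    fix i' j' \<phi> \<psi> c d
    assume \<phi>: "functional sP \<phi>" "functional sP \<psi>"
      and c: "c \<in> B (- deg - i')" "d \<in> B (- deg - j')"
    show "?X i' j' (pairing \<phi> c \<otimes>\<^sub>f pairing \<psi> d) = 0 i' j' (pairing \<phi> c \<otimes>\<^sub>f pairing \<psi> d)"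
    proof (cases "i' = i \<and> j' = j")
      case True
      note cd = circ_component[OF c]
      have "pairing (\<lambda>p. D p (\<phi> \<otimes>\<^sub>f \<psi>)) (c \<odot> d) x = 0"
        by (rule pairing_homogeneous[OF x functional_dual cd]) (use True l in auto)
      then show ?thesis using True comult_eval[OF xG \<phi> c] by simp
    qed auto
  qed
  then have "?X i j = 0 i j" by (rule fun_cong[OF fun_cong])
  then show ?thesis by simp
qed

lemma comult_component_linear: "linear_on fscale fscale (AA l) (\<lambda>x. TD x i j)"
  by (rule linear_onI) (simp_all add: comult_add linear_on_scale[OF comult_linear] A.component_in_G cscale_def)

lemma comult_component_in: "x \<in> AA l \<Longrightarrow> TD x i j \<in> tensor_space fscale fscale (AA i) (AA j)"
  by (rule A.component_in[OF comult_in[OF A.component_in_G]])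

lemma cleft_term_zero:
  assumes "x \<in> ctensor_space fscale AA" "l \<noteq> i + j + deg"
  shows "cleft_term fscale AA TD x l i j k = 0"
  unfolding cleft_term_def
  by (rule tensor_square.tleft_zero[OF A.square A.component_in[OF assms(1)] comult_homogeneous[OF _ assms(2)]])

lemma cright_term_zero:
  assumes "x \<in> ctensor_space fscale AA" "l \<noteq> j + k + deg"
  shows "cright_term fscale AA TD x l i j k = 0"
  unfolding cright_term_def
  by (rule tensor_cube.tright_zero[OF A_cube A.component_in[OF assms(1)] comult_homogeneous[OF _ assms(2)]])

text \<open>By homogeneity of the inner comultiplication only \<open>l = i + j + deg\<close>
  contributes, so the composite is one \<open>tleft\<close>; the same vanishing gives the required
  finiteness.\<close>

lemma cleft_eq:
  assumes "x \<in> ctensor_space fscale AA"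
  shows "cleft fscale AA TD x i j k = cleft_term fscale AA TD x (i + j + deg) i j k"
  unfolding cleft_def by (rule Sum_any_single) (rule cleft_term_zero[OF assms])

lemma cright_eq:
  assumes "x \<in> ctensor_space fscale AA"
  shows "cright fscale AA TD x i j k = cright_term fscale AA TD x (j + k + deg) i j k"
  unfolding cright_def by (rule Sum_any_single) (rule cright_term_zero[OF assms])

lemma cleft_finite: "x \<in> ctensor_space fscale AA \<Longrightarrow> cleft_finite fscale AA TD x"
  unfolding cleft_finite_def
  by (intro allI finite_subset[OF _ finite.insertI[OF finite.emptyI]] subsetI)
    (use cleft_term_zero in blast)

lemma cright_finite: "x \<in> ctensor_space fscale AA \<Longrightarrow> cright_finite fscale AA TD x"
  unfolding cright_finite_def
  by (intro allI finite_subset[OF _ finite.insertI[OF finite.emptyI]] subsetI)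
    (use cright_term_zero in blast)

lemma cleft_in:
  "x \<in> ctensor_space fscale AA \<Longrightarrow>
    cleft fscale AA TD x i j k \<in> tensor_space fscale fscale (tensor_space fscale fscale (AA i) (AA j)) (AA k)"
  unfolding cleft_eq cleft_term_def
  by (rule tensor_square.tleft_in[OF A.square comult_component_linear A.component_in])
    (auto simp: comult_component_in)

lemma cright_in:
  "x \<in> ctensor_space fscale AA \<Longrightarrow>
    cright fscale AA TD x i j k \<in> tensor_space fscale fscale (tensor_space fscale fscale (AA i) (AA j)) (AA k)"
  unfolding cright_eq cright_term_def
  by (rule tensor_cube.tright_in[OF A_cube comult_component_linear _ A.component_in])
    (auto simp: comult_component_in)

end

text \<open>The two signs cancel, and by associativity both composites carry the same word in
  \<open>c\<close>, \<open>d\<close>, \<open>e\<close>. They differ only in how the dual operations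
  on functionals are bracketed.\<close>

lemma
  fixes D E
  assumes D: "linear_on sP fscale UNIV D" "\<And>p. D p \<in> tensor_space sP sP UNIV UNIV"
    and E: "linear_on sP fscale UNIV E" "\<And>p. E p \<in> tensor_space sP sP UNIV UNIV"
    and x: "x \<in> GA"
    and \<phi>: "functional sP \<phi>" "functional sP \<chi>" "functional sP \<psi>"
    and c: "c \<in> B (- deg - i)" "d \<in> B (- deg - j)" "e \<in> B (- deg - k)"
  shows cleft_eval: "cleft fscale AA (tensor_comult sP sB B D \<nu>\<omega>) (tensor_comult sP sB B E \<nu>\<omega> x) i j k
      (ev (pairing \<phi> c \<otimes>\<^sub>f pairing \<chi> d) \<otimes>\<^sub>f pairing \<psi> e) =
      pairing (\<lambda>p. E p ((\<lambda>q. D q (\<phi> \<otimes>\<^sub>f \<chi>)) \<otimes>\<^sub>f \<psi>)) (c \<odot> (d \<odot> e)) x"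
    and cright_eval: "cright fscale AA (tensor_comult sP sB B D \<nu>\<omega>) (tensor_comult sP sB B E \<nu>\<omega> x) i j k
      (ev (pairing \<phi> c \<otimes>\<^sub>f pairing \<chi> d) \<otimes>\<^sub>f pairing \<psi> e) =
      pairing (\<lambda>p. E p (\<phi> \<otimes>\<^sub>f (\<lambda>q. D q (\<chi> \<otimes>\<^sub>f \<psi>)))) (c \<odot> (d \<odot> e)) x"
proof -
  note xin = comult_in[OF E x]
  have H: "c \<in> H" "d \<in> H" "e \<in> H" using c B.component_in_G by auto
  have cd: "- (c \<odot> d) \<in> B (- deg - (i + j + deg))"
    by (intro B.subspace_neg[OF B.component_subspace] circ_component c)
  have de: "- (d \<odot> e) \<in> B (- deg - (j + k + deg))"
    by (intro B.subspace_neg[OF B.component_subspace] circ_component c)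
  let ?N = "\<lambda>q. D q (\<phi> \<otimes>\<^sub>f \<chi>)" and ?N' = "\<lambda>q. D q (\<chi> \<otimes>\<^sub>f \<psi>)"
  have N: "functional sP ?N" "functional sP ?N'" by (rule functional_dual[OF D])+
  note m1 = circ_scale_left[of _ _ "-1", simplified] and m2 = circ_scale_right[of _ _ "-1", simplified]
  have 1: "tensor_comult sP sB B D \<nu>\<omega> u i j (pairing \<phi> c \<otimes>\<^sub>f pairing \<chi> d) = pairing ?N (- (c \<odot> d)) u"
    if "u \<in> AA l" for u l
    using comult_eval[OF D A.component_in_G[OF that] \<phi>(1,2) c(1,2)]
      pairing_neg[OF N(1) circ_in[OF H(1,2)] A.component_in_G[OF that]] by simp
  have "cleft fscale AA (tensor_comult sP sB B D \<nu>\<omega>) (tensor_comult sP sB B E \<nu>\<omega> x) i j k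
      (ev (pairing \<phi> c \<otimes>\<^sub>f pairing \<chi> d) \<otimes>\<^sub>f pairing \<psi> e) =
      tensor_comult sP sB B E \<nu>\<omega> x (i + j + deg) k (pairing ?N (- (c \<odot> d)) \<otimes>\<^sub>f pairing \<psi> e)"
    unfolding cleft_eq[OF D xin] cleft_term_def
    by (rule tensor_square.tleft_eval[OF A.square, where \<beta> = "pairing \<phi> c \<otimes>\<^sub>f pairing \<chi> d"
          and f = "\<lambda>u. tensor_comult sP sB B D \<nu>\<omega> u i j" and N = "pairing ?N (- (c \<odot> d))"])
      (fact comult_component_linear[OF D] A.component_in[OF xin] functional_pairing | erule 1)+
  also have "\<dots> = pairing (\<lambda>p. E p (?N \<otimes>\<^sub>f \<psi>)) (c \<odot> (d \<odot> e)) x"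
    using comult_eval[OF E x N(1) \<phi>(3) cd c(3)]
      pairing_neg[OF functional_dual[OF E] circ_in[OF circ_in[OF H(1,2)] H(3)] x]
    by (simp add: m1 circ_in H B.perm_assoc)
  finally show "cleft fscale AA (tensor_comult sP sB B D \<nu>\<omega>) (tensor_comult sP sB B E \<nu>\<omega> x) i j k
      (ev (pairing \<phi> c \<otimes>\<^sub>f pairing \<chi> d) \<otimes>\<^sub>f pairing \<psi> e) =
      pairing (\<lambda>p. E p ((\<lambda>q. D q (\<phi> \<otimes>\<^sub>f \<chi>)) \<otimes>\<^sub>f \<psi>)) (c \<odot> (d \<odot> e)) x" .
  have 2: "tensor_comult sP sB B D \<nu>\<omega> u j k (pairing \<chi> d \<otimes>\<^sub>f pairing \<psi> e) = pairing ?N' (- (d \<odot> e)) u"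
    if "u \<in> AA l" for u l
    using comult_eval[OF D A.component_in_G[OF that] \<phi>(2,3) c(2,3)]
      pairing_neg[OF N(2) circ_in[OF H(2,3)] A.component_in_G[OF that]] by simp
  have "cright fscale AA (tensor_comult sP sB B D \<nu>\<omega>) (tensor_comult sP sB B E \<nu>\<omega> x) i j k
      (ev (pairing \<phi> c \<otimes>\<^sub>f pairing \<chi> d) \<otimes>\<^sub>f pairing \<psi> e) =
      tensor_comult sP sB B E \<nu>\<omega> x i (j + k + deg) (pairing \<phi> c \<otimes>\<^sub>f pairing ?N' (- (d \<odot> e)))"
    unfolding cright_eq[OF D xin] cright_term_def
    by (rule tensor_cube.tright_eval[OF A_cube, where
          f = "\<lambda>u. tensor_comult sP sB B D \<nu>\<omega> u j k" and N = "pairing ?N' (- (d \<odot> e))"])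
      (fact comult_component_linear[OF D] A.component_in[OF xin] functional_pairing | erule 2 |
        blast intro: comult_component_in[OF D])+
  also have "\<dots> = pairing (\<lambda>p. E p (\<phi> \<otimes>\<^sub>f ?N')) (c \<odot> (d \<odot> e)) x"
    using comult_eval[OF E x \<phi>(1) N(2) c(1) de]
      pairing_neg[OF functional_dual[OF E] circ_in[OF H(1) circ_in[OF H(2,3)]] x]
    by (simp add: m2 circ_in H)
  finally show "cright fscale AA (tensor_comult sP sB B D \<nu>\<omega>) (tensor_comult sP sB B E \<nu>\<omega> x) i j k
      (ev (pairing \<phi> c \<otimes>\<^sub>f pairing \<chi> d) \<otimes>\<^sub>f pairing \<psi> e) =
      pairing (\<lambda>p. E p (\<phi> \<otimes>\<^sub>f (\<lambda>q. D q (\<chi> \<otimes>\<^sub>f \<psi>)))) (c \<odot> (d \<odot> e)) x" .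
qed

end

section \<open>The DPP algebra and DPP coalgebra structures\<close>

context poisson_coalgebra
begin

lemma sq: "tensor_square s UNIV UNIV"
  by unfold_locales auto

lemma cube: "tensor_cube s UNIV UNIV UNIV UNIV"
  by (simp add: tensor_cube_def sq)

lemma functional_Delta: "functional s (\<lambda>p. \<Delta> p \<beta>)"
  and functional_delta: "functional s (\<lambda>p. \<delta> p \<beta>)"
  by (rule functional_ev_comp[OF Delta_linear] functional_ev_comp[OF delta_linear])+

lemma Delta_sym: "functional s \<phi> \<Longrightarrow> functional s \<psi> \<Longrightarrow> \<Delta> p (\<phi> \<otimes>\<^sub>f \<psi>) = \<Delta> p (\<psi> \<otimes>\<^sub>f \<phi>)"
  using tensor_square.tflip_eval[OF sq Delta_in[of p], of \<phi> \<psi>] by (simp add: Delta_cocommutative)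

lemma delta_antisym: "functional s \<phi> \<Longrightarrow> functional s \<psi> \<Longrightarrow> \<delta> p (\<phi> \<otimes>\<^sub>f \<psi>) = - \<delta> p (\<psi> \<otimes>\<^sub>f \<phi>)"
  using tensor_square.tflip_eval[OF sq delta_in[of p], of \<psi> \<phi>] by (simp add: delta_skew)

context
  fixes \<phi> \<chi> \<psi> assumes F: "functional s \<phi>" "functional s \<chi>" "functional s \<psi>"
begin

text \<open>Regard \<open>\<lambda>q. D q (\<phi> \<otimes>\<^sub>f \<chi>)\<close> as the product
  of two functionals. The left and right composites are then the two bracketings of a triple
  product, and the coalgebra axioms become algebra axioms.\<close>

lemma nested_eval:
  assumes D: "linear_on s fscale UNIV D" "\<And>p. D p \<in> tensor_space s s UNIV UNIV"
    and t: "t \<in> tensor_space s s UNIV UNIV"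
  shows "tleft s UNIV UNIV D t (ev (\<phi> \<otimes>\<^sub>f \<chi>) \<otimes>\<^sub>f \<psi>) = t ((\<lambda>q. D q (\<phi> \<otimes>\<^sub>f \<chi>)) \<otimes>\<^sub>f \<psi>)"
    and "tright s UNIV UNIV UNIV UNIV D t (ev (\<phi> \<otimes>\<^sub>f \<chi>) \<otimes>\<^sub>f \<psi>) = t (\<phi> \<otimes>\<^sub>f (\<lambda>q. D q (\<chi> \<otimes>\<^sub>f \<psi>)))"
  by (rule tensor_square.tleft_eval[OF sq D(1) t F(3) functional_ev_comp[OF D(1)]], rule refl)
    (rule tensor_cube.tright_eval[OF cube D(1) _ t F functional_ev_comp[OF D(1)]], auto simp: D(2))

lemma nested_flip_eval:
  assumes D: "linear_on s fscale UNIV D" "\<And>p. D p \<in> tensor_space s s UNIV UNIV"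
    and t: "t \<in> tensor_space s s UNIV UNIV"
  shows "tflip12 s UNIV UNIV UNIV (tright s UNIV UNIV UNIV UNIV D t) (ev (\<phi> \<otimes>\<^sub>f \<chi>) \<otimes>\<^sub>f \<psi>) =
    t (\<chi> \<otimes>\<^sub>f (\<lambda>q. D q (\<phi> \<otimes>\<^sub>f \<psi>)))"
proof -
  have "tright s UNIV UNIV UNIV UNIV D t \<in> tensor_space fscale s (tensor_space s s UNIV UNIV) UNIV"
    by (rule tensor_cube.tright_in[OF cube D(1) _ t]) (auto simp: D(2))
  then have "tflip12 s UNIV UNIV UNIV (tright s UNIV UNIV UNIV UNIV D t) (ev (\<phi> \<otimes>\<^sub>f \<chi>) \<otimes>\<^sub>f \<psi>) =
      tright s UNIV UNIV UNIV UNIV D t (ev (\<chi> \<otimes>\<^sub>f \<phi>) \<otimes>\<^sub>f \<psi>)"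
    by (intro tensor_square.tflip12_eval[OF sq] F) auto
  also have "\<dots> = t (\<chi> \<otimes>\<^sub>f (\<lambda>q. D q (\<phi> \<otimes>\<^sub>f \<psi>)))"
    by (rule tensor_cube.tright_eval[OF cube D(1) _ t F(2,1,3) functional_ev_comp[OF D(1)]])
      (auto simp: D(2))
  finally show ?thesis .
qed

lemma dual_assoc: "\<Delta> p ((\<lambda>q. \<Delta> q (\<phi> \<otimes>\<^sub>f \<chi>)) \<otimes>\<^sub>f \<psi>) = \<Delta> p (\<phi> \<otimes>\<^sub>f (\<lambda>q. \<Delta> q (\<chi> \<otimes>\<^sub>f \<psi>)))"
  using fun_cong[OF Delta_coassociative[of p], of "ev (\<phi> \<otimes>\<^sub>f \<chi>) \<otimes>\<^sub>f \<psi>"]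
  by (simp only: nested_eval Delta_linear Delta_in)

lemma dual_jacobi: "\<delta> p (\<phi> \<otimes>\<^sub>f (\<lambda>q. \<delta> q (\<chi> \<otimes>\<^sub>f \<psi>))) =
    \<delta> p ((\<lambda>q. \<delta> q (\<phi> \<otimes>\<^sub>f \<chi>)) \<otimes>\<^sub>f \<psi>) + \<delta> p (\<chi> \<otimes>\<^sub>f (\<lambda>q. \<delta> q (\<phi> \<otimes>\<^sub>f \<psi>)))"
  using fun_cong[OF delta_cojacobi[of p], of "ev (\<phi> \<otimes>\<^sub>f \<chi>) \<otimes>\<^sub>f \<psi>"]
  by (simp only: nested_eval nested_flip_eval minus_apply delta_linear delta_in) (simp add: algebra_simps)

lemma dual_leibniz: "\<delta> p (\<phi> \<otimes>\<^sub>f (\<lambda>q. \<Delta> q (\<chi> \<otimes>\<^sub>f \<psi>))) =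
    \<Delta> p ((\<lambda>q. \<delta> q (\<phi> \<otimes>\<^sub>f \<chi>)) \<otimes>\<^sub>f \<psi>) + \<Delta> p (\<chi> \<otimes>\<^sub>f (\<lambda>q. \<delta> q (\<phi> \<otimes>\<^sub>f \<psi>)))"
  using fun_cong[OF delta_Delta[of p], of "ev (\<phi> \<otimes>\<^sub>f \<chi>) \<otimes>\<^sub>f \<psi>"]
  by (simp only: nested_eval nested_flip_eval plus_fun_apply delta_linear delta_in Delta_linear Delta_in)

text \<open>Antisymmetry of \<open>\<delta>\<close> is an identity between inner functionals; the
  sign leaves \<open>\<Delta>\<close> by homogeneity in its first slot.\<close>

lemma dual_skew: "\<Delta> p ((\<lambda>q. \<delta> q (\<phi> \<otimes>\<^sub>f \<chi>)) \<otimes>\<^sub>f \<psi>) = - \<Delta> p ((\<lambda>q. \<delta> q (\<chi> \<otimes>\<^sub>f \<phi>)) \<otimes>\<^sub>f \<psi>)"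
proof -
  have "(\<lambda>q. \<delta> q (\<phi> \<otimes>\<^sub>f \<chi>)) = (\<lambda>q. -1 * \<delta> q (\<chi> \<otimes>\<^sub>f \<phi>))"
    using delta_antisym[OF F(1,2)] by (simp add: fun_eq_iff)
  then show ?thesis
    using tensor_eval_scale_left[OF tensor_square.vs[OF sq] tensor_square.S[OF sq] Delta_in functional_delta F(3),
        where k = "-1"] by simp
qed

end

text \<open>The derivation rule for the bracket in its second slot, carried to the first slot by
  antisymmetry; the signs of the outer and inner exchanges cancel.\<close>

lemma dual_leibniz_left:
  assumes F: "functional s \<phi>" "functional s \<chi>" "functional s \<psi>"
  shows "\<delta> p ((\<lambda>q. \<Delta> q (\<phi> \<otimes>\<^sub>f \<chi>)) \<otimes>\<^sub>f \<psi>) =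
    \<Delta> p (\<phi> \<otimes>\<^sub>f (\<lambda>q. \<delta> q (\<chi> \<otimes>\<^sub>f \<psi>))) + \<Delta> p (\<chi> \<otimes>\<^sub>f (\<lambda>q. \<delta> q (\<phi> \<otimes>\<^sub>f \<psi>)))"
proof -
  have "\<delta> p ((\<lambda>q. \<Delta> q (\<phi> \<otimes>\<^sub>f \<chi>)) \<otimes>\<^sub>f \<psi>) = - \<delta> p (\<psi> \<otimes>\<^sub>f (\<lambda>q. \<Delta> q (\<phi> \<otimes>\<^sub>f \<chi>)))"
    by (rule delta_antisym[OF functional_Delta F(3)])
  also have "\<dots> = - \<Delta> p ((\<lambda>q. \<delta> q (\<psi> \<otimes>\<^sub>f \<phi>)) \<otimes>\<^sub>f \<chi>) - \<Delta> p ((\<lambda>q. \<delta> q (\<psi> \<otimes>\<^sub>f \<chi>)) \<otimes>\<^sub>f \<phi>)"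
    using dual_leibniz[OF F(3,1,2), of p] Delta_sym[OF F(2) functional_delta, of p] Delta_sym[OF F(1) functional_delta, of p]
    by (simp add: Delta_sym[OF F(1) functional_delta, of p])
  also have "\<dots> = \<Delta> p ((\<lambda>q. \<delta> q (\<phi> \<otimes>\<^sub>f \<psi>)) \<otimes>\<^sub>f \<chi>) + \<Delta> p ((\<lambda>q. \<delta> q (\<chi> \<otimes>\<^sub>f \<psi>)) \<otimes>\<^sub>f \<phi>)"
    using dual_skew[OF F(3,1,2), of p] dual_skew[OF F(3,2,1), of p] by simp
  finally show ?thesis
    by (simp add: Delta_sym[OF functional_delta F(2)] Delta_sym[OF functional_delta F(1)])
qed

end

section \<open>Reduction of multiadditive identities to pure tensors\<close>

context perm_tensor
begin

text \<open>Meant for the difference of the two sides of an identity: additivity alone suffices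
  because every element is a finite sum of homogeneous pure tensors.\<close>

lemma GA_additive:
  assumes "x \<in> GA" and add: "\<And>x y. x \<in> GA \<Longrightarrow> y \<in> GA \<Longrightarrow> T (x + y) = T x + (T y :: 'c::ab_group_add)"
    and "\<And>p b i. b \<in> B i \<Longrightarrow> T (pure p b) = 0"
  shows "T x = 0"
proof (rule GA_induct[OF assms(1), where P = "\<lambda>x. T x = 0"])
  show "T 0 = 0" using add[OF A.G_zero A.G_zero] by (simp only: add_0_left add_cancel_right_right)
qed (simp_all only: assms add_0_left)

lemma GA_biadditive:
  assumes "x \<in> GA" "y \<in> GA"
    and "\<And>x x' y. x \<in> GA \<Longrightarrow> x' \<in> GA \<Longrightarrow> y \<in> GA \<Longrightarrow> T (x + x') y = T x y + (T x' y :: 'c::ab_group_add)"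
    and "\<And>x y y'. x \<in> GA \<Longrightarrow> y \<in> GA \<Longrightarrow> y' \<in> GA \<Longrightarrow> T x (y + y') = T x y + T x y'"
    and "\<And>p b i q c j. b \<in> B i \<Longrightarrow> c \<in> B j \<Longrightarrow> T (pure p b) (pure q c) = 0"
  shows "T x y = 0"
proof (rule GA_additive[OF assms(1), where T = "\<lambda>x. T x y"])
  show "T (pure p b) y = 0" if "b \<in> B i" for p b i
    by (rule GA_additive[OF assms(2), where T = "T (pure p b)"])
      (use that pure_in_GA[OF B.component_in_G[OF that]] assms(4,5) in auto)
qed (use assms in auto)

lemma GA_triadditive:
  assumes "x \<in> GA" "y \<in> GA" "z \<in> GA"
    and "\<And>x x' y z. x \<in> GA \<Longrightarrow> x' \<in> GA \<Longrightarrow> y \<in> GA \<Longrightarrow> z \<in> GA \<Longrightarrow>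
      T (x + x') y z = T x y z + (T x' y z :: 'c::ab_group_add)"
    and "\<And>x y y' z. x \<in> GA \<Longrightarrow> y \<in> GA \<Longrightarrow> y' \<in> GA \<Longrightarrow> z \<in> GA \<Longrightarrow> T x (y + y') z = T x y z + T x y' z"
    and "\<And>x y z z'. x \<in> GA \<Longrightarrow> y \<in> GA \<Longrightarrow> z \<in> GA \<Longrightarrow> z' \<in> GA \<Longrightarrow> T x y (z + z') = T x y z + T x y z'"
    and "\<And>p b i q c j r d k. b \<in> B i \<Longrightarrow> c \<in> B j \<Longrightarrow> d \<in> B k \<Longrightarrow> T (pure p b) (pure q c) (pure r d) = 0"
  shows "T x y z = 0"
proof (rule GA_additive[OF assms(1), where T = "\<lambda>x. T x y z"])
  show "T (pure p b) y z = 0" if "b \<in> B i" for p b i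
    by (rule GA_biadditive[OF assms(2,3), where T = "T (pure p b)"])
      (use that pure_in_GA[OF B.component_in_G[OF that]] assms(5-7) in auto)
qed (use assms in auto)

lemma ctensor3_eqI:
  assumes "\<And>i j k. X i j k \<in> tensor_space fscale fscale (tensor_space fscale fscale (AA i) (AA j)) (AA k)"
    and "\<And>i j k. Y i j k \<in> tensor_space fscale fscale (tensor_space fscale fscale (AA i) (AA j)) (AA k)"
    and "\<And>i j k \<phi> \<chi> \<psi> c d e. functional sP \<phi> \<Longrightarrow> functional sP \<chi> \<Longrightarrow> functional sP \<psi> \<Longrightarrow>
      c \<in> B (- deg - i) \<Longrightarrow> d \<in> B (- deg - j) \<Longrightarrow> e \<in> B (- deg - k) \<Longrightarrow>
      X i j k (ev (pairing \<phi> c \<otimes>\<^sub>f pairing \<chi> d) \<otimes>\<^sub>f pairing \<psi> e) =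
      Y i j k (ev (pairing \<phi> c \<otimes>\<^sub>f pairing \<chi> d) \<otimes>\<^sub>f pairing \<psi> e)"
  shows "X = Y"
proof -
  have "X i j k = Y i j k" for i j k
    by (rule ctensor3_separation) (fact assms(1,2) | erule (5) assms(3))+
  then show ?thesis by (intro ext[of X Y] ext[of "X _" "Y _"] ext[of "X _ _" "Y _ _"])
qed

lemma word_left: "b \<in> H \<Longrightarrow> c \<in> H \<Longrightarrow> d \<in> H \<Longrightarrow> (b \<odot> c) \<odot> d = b \<odot> (c \<odot> d)"
  by (rule B.perm_assoc[symmetric])

text \<open>The form in which both perm identities are used: all letters but the last may be
  permuted.\<close>

lemma word_commute: "b \<in> H \<Longrightarrow> c \<in> H \<Longrightarrow> d \<in> H \<Longrightarrow> b \<odot> (c \<odot> d) = c \<odot> (b \<odot> d)"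
  using B.perm_assoc B.perm_left_commute by metis

text \<open>Pairings with the same letter merge into one, so that a dual identity can be applied to
  the functional inside.\<close>

lemma pairing_add_functional:
  assumes "functional sP \<phi>" "functional sP \<phi>'" "c \<in> H" "x \<in> GA"
  shows "pairing \<phi> c x + pairing \<phi>' c x = pairing (\<lambda>p. \<phi> p + \<phi>' p) c x"
  using tensor_eval_add_left[OF P_vs P_UNIV assms(4)[unfolded GA_eq] assms(1,2) functional_form_at[OF assms(3)]]
  by (simp add: pairing_def)

lemma pairing_neg_functional:
  assumes "functional sP \<phi>" "c \<in> H" "x \<in> GA"
  shows "- pairing \<phi> c x = pairing (\<lambda>p. - \<phi> p) c x"
  using tensor_eval_scale_left[OF P_vs P_UNIV assms(3)[unfolded GA_eq] assms(1) functional_form_at[OF assms(2)], of "-1"]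
  by (simp add: pairing_def)

end

locale poisson_perm = perm_tensor sP sB B circ \<omega> \<nu>\<omega> + PB: poisson_bialgebra sP mult br \<Delta> \<delta>
  for sP :: "'k::field_char_0 \<Rightarrow> 'p::ab_group_add \<Rightarrow> 'p" and sB :: "'k \<Rightarrow> 'b::ab_group_add \<Rightarrow> 'b"
    and B and circ (infixl "\<odot>" 70) and \<omega> \<nu>\<omega> mult br \<Delta> \<delta>
begin

abbreviation (input) cm (infixl "\<circ>\<^sub>A" 70) where "x \<circ>\<^sub>A y \<equiv> tensor_mult sP sB B mult (\<odot>) x y"
abbreviation (input) st (infixl "\<star>\<^sub>A" 70) where "x \<star>\<^sub>A y \<equiv> tensor_mult sP sB B br (\<odot>) x y"
abbreviation (input) "\<nu> \<equiv> tensor_comult sP sB B \<Delta> \<nu>\<omega>"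
abbreviation (input) "\<theta> \<equiv> tensor_comult sP sB B \<delta> \<nu>\<omega>"

lemmas mult_bl = PB.mult_bilinear and br_bl = PB.br_bilinear

lemma br_skew: "br p q = - br q p"
proof -
  have "br (p + q) (p + q) = br p p + br q p + (br p q + br q q)"
    by (simp add: bilinear_on_add_left[OF br_bl] bilinear_on_add_right[OF br_bl])
  then show ?thesis by (simp add: PB.br_alternating eq_neg_iff_add_eq_0 add.commute)
qed

lemma br_neg_right: "br p (- q) = - br p q"
  using bilinear_on_scale_right[OF br_bl, of p q "-1"] by simp

lemma br_leibniz: "br p (br q r) = br (br p q) r + br q (br p r)"
  using PB.br_jacobi[of p q r] br_skew[of r "br p q"] br_skew[of r p]
  by (simp add: br_neg_right algebra_simps eq_neg_iff_add_eq_0)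

lemma mult_neg_left: "mult (- p) q = - mult p q"
  using bilinear_on_scale_left[OF mult_bl, of p q "-1"] by simp

lemma tensor_neg_left: "pure (- p) b = - pure p b"
  using tensor_scale_pure[of sP sB "-1" p b] by (simp add: fscale_def fun_eq_iff)

lemmas products = mult_add_left[OF mult_bl] mult_add_right[OF mult_bl] mult_in[OF mult_bl]
  mult_add_left[OF br_bl] mult_add_right[OF br_bl] mult_in[OF br_bl]
  mult_pure[OF mult_bl] mult_pure[OF br_bl] A.G_add

text \<open>As in the identities that follow, on pure tensors every term has the same
  \<open>B\<close> factor \<open>b \<odot> (c \<odot> d)\<close>, and an identity of the Poisson
  algebra remains in the \<open>P\<close> factor.\<close>

lemma perm_assoc_A:
  assumes "x \<in> GA" "y \<in> GA" "z \<in> GA"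
  shows "x \<circ>\<^sub>A (y \<circ>\<^sub>A z) = (x \<circ>\<^sub>A y) \<circ>\<^sub>A z"
proof -
  have "x \<circ>\<^sub>A (y \<circ>\<^sub>A z) - (x \<circ>\<^sub>A y) \<circ>\<^sub>A z = 0"
    by (rule GA_triadditive[OF assms, where T = "\<lambda>x y z. x \<circ>\<^sub>A (y \<circ>\<^sub>A z) - (x \<circ>\<^sub>A y) \<circ>\<^sub>A z"])
      (simp_all only: products add_diff_add B.component_in_G circ_in, simp add: PB.mult_assoc word_left B.component_in_G)
  then show ?thesis by simp
qed

lemma perm_commute_A:
  assumes "x \<in> GA" "y \<in> GA" "z \<in> GA"
  shows "(x \<circ>\<^sub>A y) \<circ>\<^sub>A z = (y \<circ>\<^sub>A x) \<circ>\<^sub>A z"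
proof -
  have "(x \<circ>\<^sub>A y) \<circ>\<^sub>A z - (y \<circ>\<^sub>A x) \<circ>\<^sub>A z = 0"
  proof (rule GA_triadditive[OF assms, where T = "\<lambda>x y z. (x \<circ>\<^sub>A y) \<circ>\<^sub>A z - (y \<circ>\<^sub>A x) \<circ>\<^sub>A z"])
    show "(pure p b \<circ>\<^sub>A pure q c) \<circ>\<^sub>A pure r d - (pure q c \<circ>\<^sub>A pure p b) \<circ>\<^sub>A pure r d = 0"
      if "b \<in> B i" "c \<in> B j" "d \<in> B k" for p b i q c j r d k
      using that[THEN B.component_in_G]
      by (simp only: products circ_in word_left word_commute[of c b d] PB.mult_commute[of q p] diff_self)
  qed (simp_all only: products add_diff_add)
  then show ?thesis by simp
qed

lemma leibniz_A:
  assumes "x \<in> GA" "y \<in> GA" "z \<in> GA"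
  shows "x \<star>\<^sub>A (y \<star>\<^sub>A z) = (x \<star>\<^sub>A y) \<star>\<^sub>A z + y \<star>\<^sub>A (x \<star>\<^sub>A z)"
proof -
  have "x \<star>\<^sub>A (y \<star>\<^sub>A z) - (x \<star>\<^sub>A y) \<star>\<^sub>A z - y \<star>\<^sub>A (x \<star>\<^sub>A z) = 0"
  proof (rule GA_triadditive[OF assms, where T = "\<lambda>x y z. x \<star>\<^sub>A (y \<star>\<^sub>A z) - (x \<star>\<^sub>A y) \<star>\<^sub>A z - y \<star>\<^sub>A (x \<star>\<^sub>A z)"])
    show "pure p b \<star>\<^sub>A (pure q c \<star>\<^sub>A pure r d) -
      (pure p b \<star>\<^sub>A pure q c) \<star>\<^sub>A pure r d - pure q c \<star>\<^sub>A (pure p b \<star>\<^sub>A pure r d) = 0"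
      if "b \<in> B i" "c \<in> B j" "d \<in> B k" for p b i q c j r d k
      using that[THEN B.component_in_G]
      by (simp only: products circ_in word_left word_commute[of c b d] br_leibniz[of p q r] tensor_add_left add_diff_cancel_left' diff_self)
  qed (simp_all only: products add_diff_add)
  then show ?thesis by (simp only: diff_diff_eq right_minus_eq)
qed

lemma circ_star_A:
  assumes "x \<in> GA" "y \<in> GA" "z \<in> GA"
  shows "(x \<circ>\<^sub>A y) \<star>\<^sub>A z = x \<circ>\<^sub>A (y \<star>\<^sub>A z) + y \<circ>\<^sub>A (x \<star>\<^sub>A z)"
proof -
  have *: "br (mult p q) r = mult p (br q r) + mult q (br p r)" for p q r
    using PB.br_mult[of r p q] br_skew[of r p] br_skew[of r q] br_skew[of r "mult p q"]
      mult_neg_left[of "br p r" q] mult_neg_left[of "br q r" p]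
    by (simp add: PB.mult_commute algebra_simps)
  have "(x \<circ>\<^sub>A y) \<star>\<^sub>A z - x \<circ>\<^sub>A (y \<star>\<^sub>A z) - y \<circ>\<^sub>A (x \<star>\<^sub>A z) = 0"
  proof (rule GA_triadditive[OF assms, where T = "\<lambda>x y z. (x \<circ>\<^sub>A y) \<star>\<^sub>A z - x \<circ>\<^sub>A (y \<star>\<^sub>A z) - y \<circ>\<^sub>A (x \<star>\<^sub>A z)"])
    show "(pure p b \<circ>\<^sub>A pure q c) \<star>\<^sub>A pure r d -
      pure p b \<circ>\<^sub>A (pure q c \<star>\<^sub>A pure r d) - pure q c \<circ>\<^sub>A (pure p b \<star>\<^sub>A pure r d) = 0"
      if "b \<in> B i" "c \<in> B j" "d \<in> B k" for p b i q c j r d k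
      using that[THEN B.component_in_G]
      by (simp only: products circ_in word_left word_commute[of c b d] * tensor_add_left add_diff_cancel_left' diff_self)
  qed (simp_all only: products add_diff_add)
  then show ?thesis by (simp only: diff_diff_eq right_minus_eq)
qed

lemma star_circ_A:
  assumes "x \<in> GA" "y \<in> GA" "z \<in> GA"
  shows "(x \<star>\<^sub>A y) \<circ>\<^sub>A z = x \<star>\<^sub>A (y \<circ>\<^sub>A z) - y \<circ>\<^sub>A (x \<star>\<^sub>A z)"
proof -
  have "x \<star>\<^sub>A (y \<circ>\<^sub>A z) - (x \<star>\<^sub>A y) \<circ>\<^sub>A z - y \<circ>\<^sub>A (x \<star>\<^sub>A z) = 0"
  proof (rule GA_triadditive[OF assms, where T = "\<lambda>x y z. x \<star>\<^sub>A (y \<circ>\<^sub>A z) - (x \<star>\<^sub>A y) \<circ>\<^sub>A z - y \<circ>\<^sub>A (x \<star>\<^sub>A z)"])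
    show "pure p b \<star>\<^sub>A (pure q c \<circ>\<^sub>A pure r d) -
      (pure p b \<star>\<^sub>A pure q c) \<circ>\<^sub>A pure r d - pure q c \<circ>\<^sub>A (pure p b \<star>\<^sub>A pure r d) = 0"
      if "b \<in> B i" "c \<in> B j" "d \<in> B k" for p b i q c j r d k
      using that[THEN B.component_in_G]
      by (simp only: products circ_in word_left word_commute[of c b d] PB.br_mult tensor_add_left add_diff_cancel_left' diff_self)
  qed (simp_all only: products add_diff_add)
  then show ?thesis by (simp only: diff_diff_eq right_minus_eq add_diff_cancel_right')
qed

lemma star_circ_skew_A:
  assumes "x \<in> GA" "y \<in> GA" "z \<in> GA"
  shows "(x \<star>\<^sub>A y) \<circ>\<^sub>A z = - ((y \<star>\<^sub>A x) \<circ>\<^sub>A z)"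
proof -
  have *: "mult (br q p) r = - mult (br p q) r" for p q r
    by (simp only: br_skew[of q p] mult_neg_left)
  have "(x \<star>\<^sub>A y) \<circ>\<^sub>A z + (y \<star>\<^sub>A x) \<circ>\<^sub>A z = 0"
  proof (rule GA_triadditive[OF assms, where T = "\<lambda>x y z. (x \<star>\<^sub>A y) \<circ>\<^sub>A z + (y \<star>\<^sub>A x) \<circ>\<^sub>A z"])
    show "(pure p b \<star>\<^sub>A pure q c) \<circ>\<^sub>A pure r d + (pure q c \<star>\<^sub>A pure p b) \<circ>\<^sub>A pure r d = 0"
      if "b \<in> B i" "c \<in> B j" "d \<in> B k" for p b i q c j r d k
      using that[THEN B.component_in_G]
      by (simp only: products circ_in word_left word_commute[of c b d] *[of p q r] tensor_neg_left add.left_inverse)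
  qed (simp_all only: products add.assoc add.left_commute add.commute)
  then show ?thesis by (simp add: eq_neg_iff_add_eq_0)
qed

lemma graded_DPP: "graded_DPP_algebra fscale AA (tensor_mult sP sB B mult (\<odot>)) (tensor_mult sP sB B br (\<odot>))"
  by unfold_locales
    (fact A.subspace_G mult_in[OF mult_bl] mult_in[OF br_bl] mult_bilinear[OF mult_bl] mult_bilinear[OF br_bl]
      perm_assoc_A perm_commute_A leibniz_A circ_star_A star_circ_A star_circ_skew_A
      mult_graded[OF mult_bl] mult_graded[OF br_bl])+

section \<open>The coalgebra identities, tested on products of three pairings\<close>

lemmas \<nu>_in = comult_in[OF PB.Delta_linear PB.Delta_in]
  and \<theta>_in = comult_in[OF PB.delta_linear PB.delta_in]

lemmas cube_in =
  cleft_in[OF PB.Delta_linear PB.Delta_in] cleft_in[OF PB.delta_linear PB.delta_in]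
  cright_in[OF PB.Delta_linear PB.Delta_in] cright_in[OF PB.delta_linear PB.delta_in]
  A.cflip12_in \<nu>_in \<theta>_in

lemmas cube_eval =
  cleft_eval[OF PB.Delta_linear PB.Delta_in PB.Delta_linear PB.Delta_in]
  cleft_eval[OF PB.Delta_linear PB.Delta_in PB.delta_linear PB.delta_in]
  cleft_eval[OF PB.delta_linear PB.delta_in PB.Delta_linear PB.Delta_in]
  cleft_eval[OF PB.delta_linear PB.delta_in PB.delta_linear PB.delta_in]
  cright_eval[OF PB.Delta_linear PB.Delta_in PB.Delta_linear PB.Delta_in]
  cright_eval[OF PB.Delta_linear PB.Delta_in PB.delta_linear PB.delta_in]
  cright_eval[OF PB.delta_linear PB.delta_in PB.Delta_linear PB.Delta_in]
  cright_eval[OF PB.delta_linear PB.delta_in PB.delta_linear PB.delta_in]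

lemma nu_coassociative_A:
  assumes "x \<in> GA"
  shows "cleft fscale AA \<nu> (\<nu> x) = cright fscale AA \<nu> (\<nu> x)"
  by (rule ctensor3_eqI) (simp_all only: cube_in assms cube_eval PB.dual_assoc)

text \<open>The flip exchanges the first two functionals and the first two letters at once.
  Commutativity of the dual product undoes the former, \<open>word_commute\<close> the
  latter.\<close>

lemma nu_coperm_A:
  assumes "x \<in> GA"
  shows "cright fscale AA \<nu> (\<nu> x) = cflip12 fscale AA (cleft fscale AA \<nu> (\<nu> x))"
proof (rule ctensor3_eqI)
  fix i j k \<phi> \<chi> \<psi> c d e
  assume F: "functional sP \<phi>" "functional sP \<chi>" "functional sP \<psi>"
    and c: "c \<in> B (- deg - i)" "d \<in> B (- deg - j)" "e \<in> B (- deg - k)"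
  note H = c[THEN B.component_in_G]
  have "\<Delta> q (\<chi> \<otimes>\<^sub>f \<phi>) = \<Delta> q (\<phi> \<otimes>\<^sub>f \<chi>)" for q by (rule PB.Delta_sym[OF F(2,1)])
  then show "cright fscale AA \<nu> (\<nu> x) i j k (ev (pairing \<phi> c \<otimes>\<^sub>f pairing \<chi> d) \<otimes>\<^sub>f pairing \<psi> e) =
    cflip12 fscale AA (cleft fscale AA \<nu> (\<nu> x)) i j k (ev (pairing \<phi> c \<otimes>\<^sub>f pairing \<chi> d) \<otimes>\<^sub>f pairing \<psi> e)"
    using F c H
    by (simp only: A.cflip12_eval functional_pairing cube_in assms cube_eval PB.dual_assoc word_commute[of d c e])
qed (simp_all only: cube_in assms)

lemma theta_coleibniz_A:
  assumes "x \<in> GA"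
  shows "cright fscale AA \<theta> (\<theta> x) = cleft fscale AA \<theta> (\<theta> x) + cflip12 fscale AA (cright fscale AA \<theta> (\<theta> x))"
proof (rule ctensor3_eqI)
  fix i j k \<phi> \<chi> \<psi> c d e
  assume F: "functional sP \<phi>" "functional sP \<chi>" "functional sP \<psi>"
    and c: "c \<in> B (- deg - i)" "d \<in> B (- deg - j)" "e \<in> B (- deg - k)"
  note H = c[THEN B.component_in_G]
  show "cright fscale AA \<theta> (\<theta> x) i j k (ev (pairing \<phi> c \<otimes>\<^sub>f pairing \<chi> d) \<otimes>\<^sub>f pairing \<psi> e) =
    (cleft fscale AA \<theta> (\<theta> x) + cflip12 fscale AA (cright fscale AA \<theta> (\<theta> x))) i j k
      (ev (pairing \<phi> c \<otimes>\<^sub>f pairing \<chi> d) \<otimes>\<^sub>f pairing \<psi> e)"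
    using F c H assms
    by (simp only: plus_fun_apply A.cflip12_eval functional_pairing cube_in cube_eval
        word_commute[of d c e] pairing_add_functional PB.functional_delta circ_in PB.dual_jacobi[of \<phi> \<chi> \<psi>])
qed (simp_all only: cube_in assms plus_fun_apply tensor_space_add)

lemma nu_theta_right_A:
  assumes "x \<in> GA"
  shows "cright fscale AA \<nu> (\<theta> x) = cleft fscale AA \<theta> (\<nu> x) + cflip12 fscale AA (cright fscale AA \<theta> (\<nu> x))"
proof (rule ctensor3_eqI)
  fix i j k \<phi> \<chi> \<psi> c d e
  assume F: "functional sP \<phi>" "functional sP \<chi>" "functional sP \<psi>"
    and c: "c \<in> B (- deg - i)" "d \<in> B (- deg - j)" "e \<in> B (- deg - k)"
  note H = c[THEN B.component_in_G]
  show "cright fscale AA \<nu> (\<theta> x) i j k (ev (pairing \<phi> c \<otimes>\<^sub>f pairing \<chi> d) \<otimes>\<^sub>f pairing \<psi> e) =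
    (cleft fscale AA \<theta> (\<nu> x) + cflip12 fscale AA (cright fscale AA \<theta> (\<nu> x))) i j k
      (ev (pairing \<phi> c \<otimes>\<^sub>f pairing \<chi> d) \<otimes>\<^sub>f pairing \<psi> e)"
    using F c H assms
    by (simp only: plus_fun_apply A.cflip12_eval functional_pairing cube_in cube_eval
        word_commute[of d c e] pairing_add_functional PB.functional_Delta circ_in PB.dual_leibniz[of \<phi> \<chi> \<psi>])
qed (simp_all only: cube_in assms plus_fun_apply tensor_space_add)

text \<open>Dual to the derivation rule in the first slot of the bracket;
  \<open>word_commute\<close> again gives both terms on the right the same word.\<close>

lemma nu_theta_left_A:
  assumes "x \<in> GA"
  shows "cleft fscale AA \<nu> (\<theta> x) = cright fscale AA \<theta> (\<nu> x) + cflip12 fscale AA (cright fscale AA \<theta> (\<nu> x))"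
proof (rule ctensor3_eqI)
  fix i j k \<phi> \<chi> \<psi> c d e
  assume F: "functional sP \<phi>" "functional sP \<chi>" "functional sP \<psi>"
    and c: "c \<in> B (- deg - i)" "d \<in> B (- deg - j)" "e \<in> B (- deg - k)"
  note H = c[THEN B.component_in_G]
  show "cleft fscale AA \<nu> (\<theta> x) i j k (ev (pairing \<phi> c \<otimes>\<^sub>f pairing \<chi> d) \<otimes>\<^sub>f pairing \<psi> e) =
    (cright fscale AA \<theta> (\<nu> x) + cflip12 fscale AA (cright fscale AA \<theta> (\<nu> x))) i j k
      (ev (pairing \<phi> c \<otimes>\<^sub>f pairing \<chi> d) \<otimes>\<^sub>f pairing \<psi> e)"
    using F c H assms
    by (simp only: plus_fun_apply A.cflip12_eval functional_pairing cube_in cube_eval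
        word_commute[of d c e] pairing_add_functional PB.functional_Delta circ_in PB.dual_leibniz_left[of \<phi> \<chi> \<psi>])
qed (simp_all only: cube_in assms plus_fun_apply tensor_space_add)

text \<open>The flip does not change the word, so the sign comes entirely from the antisymmetry of
  the dual bracket of \<open>\<phi>\<close> and \<open>\<chi>\<close>.\<close>

lemma theta_nu_skew_A:
  assumes "x \<in> GA"
  shows "cleft fscale AA \<theta> (\<nu> x) = - cflip12 fscale AA (cleft fscale AA \<theta> (\<nu> x))"
proof (rule ctensor3_eqI)
  fix i j k \<phi> \<chi> \<psi> c d e
  assume F: "functional sP \<phi>" "functional sP \<chi>" "functional sP \<psi>"
    and c: "c \<in> B (- deg - i)" "d \<in> B (- deg - j)" "e \<in> B (- deg - k)"
  note H = c[THEN B.component_in_G]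
  show "cleft fscale AA \<theta> (\<nu> x) i j k (ev (pairing \<phi> c \<otimes>\<^sub>f pairing \<chi> d) \<otimes>\<^sub>f pairing \<psi> e) =
    (- cflip12 fscale AA (cleft fscale AA \<theta> (\<nu> x))) i j k
      (ev (pairing \<phi> c \<otimes>\<^sub>f pairing \<chi> d) \<otimes>\<^sub>f pairing \<psi> e)"
    using F c H assms
    by (simp only: uminus_apply A.cflip12_eval functional_pairing cube_in cube_eval
        word_commute[of d c e] pairing_neg_functional PB.functional_Delta circ_in PB.dual_skew[of \<phi> \<chi> \<psi>])
qed (simp_all only: cube_in assms uminus_apply tensor_space_neg)

lemma composites_finite_A:
  assumes "f \<in> {\<nu>, \<theta>}" "g \<in> {\<nu>, \<theta>}" "a \<in> GA"
  shows "cleft_finite fscale AA f (g a) \<and> cright_finite fscale AA f (g a)"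
proof -
  have "g a \<in> ctensor_space fscale AA" using assms \<nu>_in \<theta>_in by auto
  then show ?thesis
    using assms(1) cleft_finite[OF PB.Delta_linear PB.Delta_in] cleft_finite[OF PB.delta_linear PB.delta_in]
      cright_finite[OF PB.Delta_linear PB.Delta_in] cright_finite[OF PB.delta_linear PB.delta_in] by auto
qed

lemma completed_coalgebra: "completed_DPP_coalgebra fscale AA \<nu> \<theta>"
  apply (rule completed_DPP_coalgebra.intro[OF A.graded_space_axioms completed_DPP_coalgebra_axioms.intro])
           apply (rule comult_linear[OF PB.Delta_linear PB.Delta_in])
          apply (erule \<nu>_in)
         apply (rule comult_linear[OF PB.delta_linear PB.delta_in])
        apply (erule \<theta>_in)
       apply (drule (2) composites_finite_A, assumption)
      apply (erule nu_coassociative_A nu_coperm_A theta_coleibniz_A nu_theta_right_A nu_theta_left_A theta_nu_skew_A)+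
  done

end

section \<open>The compatibility conditions\<close>

context perm_tensor
begin

lemma biadditive_zero:
  assumes "x \<in> GA" "y \<in> GA" "A.biadditive T"
    and "\<And>p b i q c j. b \<in> B i \<Longrightarrow> c \<in> B j \<Longrightarrow> T (pure p b) (pure q c) = 0"
  shows "T x y = 0"
  by (rule GA_biadditive[OF assms(1,2)]) (use assms(3,4) in \<open>auto simp only: A.biadditive_def\<close>)

lemma mult_family:
  assumes M: "bilinear_on sP sP sP UNIV UNIV M"
  shows "A.map_family (tensor_mult sP sB B M (\<odot>))" "A.map_family (\<lambda>a y. tensor_mult sP sB B M (\<odot>) y a)"
    "A.biadditive (tensor_mult sP sB B M (\<odot>))"
  unfolding A.map_family_def A.biadditive_def
  using bounded_mult[OF M] mult_add_left[OF M] mult_add_right[OF M] by blast+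

lemma comult_family:
  assumes "linear_on sP fscale UNIV D" "\<And>p. D p \<in> tensor_space sP sP UNIV UNIV"
  shows "A.tensor_family (tensor_comult sP sB B D \<nu>\<omega>)"
  unfolding A.tensor_family_def using comult_in[OF assms] comult_add[OF assms] by blast

lemma pairing_diff_right:
  assumes "functional sP \<phi>" "c \<in> H" "c' \<in> H" "x \<in> GA"
  shows "pairing \<phi> (c - c') x = pairing \<phi> c x - pairing \<phi> c' x"
proof (rule GA_induct[OF assms(4), where P = "\<lambda>x. pairing \<phi> (c - c') x = pairing \<phi> c x - pairing \<phi> c' x"])
  show "pairing \<phi> (c - c') (pure p b) = pairing \<phi> c (pure p b) - pairing \<phi> c' (pure p b)" if "b \<in> B i" for p b i
    using B.component_in_G[OF that] assms(1-3)
      linear_on_add[OF form_linear_right, of b "c - c'" c']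
    by (simp add: pairing_pure B.G_diff algebra_simps)
qed (simp_all only: pairing_zero pairing_add add_diff_add diff_self)

text \<open>Whatever adjoint acts on the letter, it stays dual to the degree \<open>k - n\<close>
  that \<open>cmap\<close> reads for a shift by \<open>n\<close>, so \<open>comult_pure_eval\<close>
  remains applicable.\<close>

lemma op_component:
  assumes "b \<in> B n" "c \<in> B (- deg - k)"
  shows "b \<odot> c \<in> B (- deg - (k - n))" "c \<odot> b \<in> B (- deg - (k - n))"
    "b \<odot> c - c \<odot> b \<in> B (- deg - (k - n))" "c \<odot> b - b \<odot> c \<in> B (- deg - (k - n))"
proof -
  have n: "- deg - (k - n) = n + (- deg - k)" "- deg - (k - n) = (- deg - k) + n" by simp_all
  show 1: "b \<odot> c \<in> B (- deg - (k - n))" unfolding n(1) by (rule B.circ_graded[OF assms])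
  show 2: "c \<odot> b \<in> B (- deg - (k - n))" unfolding n(2) by (rule B.circ_graded[OF assms(2,1)])
  show "b \<odot> c - c \<odot> b \<in> B (- deg - (k - n))" "c \<odot> b - b \<odot> c \<in> B (- deg - (k - n))"
    using B.subspace_diff[OF B.component_subspace] 1 2 by blast+
qed

lemma cmap_left_eval:
  assumes "A.shift_map n f" "X \<in> ctensor_space fscale AA"
    and "\<And>u. u \<in> GA \<Longrightarrow> pairing \<phi> c (f u) = pairing \<phi>' c' u"
  shows "cmap fscale AA f id X k l (pairing \<phi> c \<otimes>\<^sub>f pairing \<psi> d) =
    X (k - n) l (pairing \<phi>' c' \<otimes>\<^sub>f pairing \<psi> d)"
proof -
  have "cmap fscale AA f id X k l (pairing \<phi> c \<otimes>\<^sub>f pairing \<psi> d) =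
      X (k - n) (l - 0) (pairing \<phi>' c' \<otimes>\<^sub>f pairing \<psi> d)"
    by (rule A.cmap_eval[where n = n and f = f and g = id and F = "pairing \<phi> c" and H = "pairing \<psi> d"])
      (simp_all only: assms A.shift_map_id functional_pairing id_apply)
  then show ?thesis by simp
qed

lemma cmap_right_eval:
  assumes "A.shift_map n f" "X \<in> ctensor_space fscale AA"
    and "\<And>u. u \<in> GA \<Longrightarrow> pairing \<psi> d (f u) = pairing \<psi>' d' u"
  shows "cmap fscale AA id f X k l (pairing \<phi> c \<otimes>\<^sub>f pairing \<psi> d) =
    X k (l - n) (pairing \<phi> c \<otimes>\<^sub>f pairing \<psi>' d')"
proof -
  have "cmap fscale AA id f X k l (pairing \<phi> c \<otimes>\<^sub>f pairing \<psi> d) =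
      X (k - 0) (l - n) (pairing \<phi> c \<otimes>\<^sub>f pairing \<psi>' d')"
    by (rule A.cmap_eval[where m = n and f = id and g = f and F = "pairing \<phi> c" and H = "pairing \<psi> d"])
      (simp_all only: assms A.shift_map_id functional_pairing id_apply)
  then show ?thesis by simp
qed

end

section \<open>The bialgebra conditions of the Poisson side in scalar form\<close>

context poisson_bialgebra
begin

lemma tmap_UNIV_eval:
  assumes "bilinear_on s s s UNIV UNIV M" "t \<in> tensor_space s s UNIV UNIV"
    and "functional s \<phi>" "functional s \<psi>"
  shows "tmap s UNIV UNIV (M q) id t (\<phi> \<otimes>\<^sub>f \<psi>) = t ((\<lambda>p. \<phi> (M q p)) \<otimes>\<^sub>f \<psi>)"
    and "tmap s UNIV UNIV id (M q) t (\<phi> \<otimes>\<^sub>f \<psi>) = t (\<phi> \<otimes>\<^sub>f (\<lambda>p. \<psi> (M q p)))"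
proof -
  have M: "linear_on s s UNIV (M q)" using assms(1) by (simp add: bilinear_on_def)
  have id: "linear_on s s UNIV id" by (simp add: linear_on_def)
  show "tmap s UNIV UNIV (M q) id t (\<phi> \<otimes>\<^sub>f \<psi>) = t ((\<lambda>p. \<phi> (M q p)) \<otimes>\<^sub>f \<psi>)"
    by (rule tensor_square.tmap_eval[OF sq M id assms(2-4) functional_comp[OF M assms(3)] assms(4)]) simp_all
  show "tmap s UNIV UNIV id (M q) t (\<phi> \<otimes>\<^sub>f \<psi>) = t (\<phi> \<otimes>\<^sub>f (\<lambda>p. \<psi> (M q p)))"
    by (rule tensor_square.tmap_eval[OF sq id M assms(2-4) assms(3) functional_comp[OF M assms(4)]]) simp_all
qed

context
  fixes \<phi> \<psi> assumes F: "functional s \<phi>" "functional s \<psi>"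
begin

lemmas evals = tmap_UNIV_eval[OF mult_bilinear _ F] tmap_UNIV_eval[OF br_bilinear _ F]

lemma Delta_mult_eval: "\<Delta> (mult q p) (\<phi> \<otimes>\<^sub>f \<psi>) =
    \<Delta> q ((\<lambda>x. \<phi> (mult p x)) \<otimes>\<^sub>f \<psi>) + \<Delta> p (\<phi> \<otimes>\<^sub>f (\<lambda>x. \<psi> (mult q x)))"
  by (simp only: Delta_mult plus_fun_apply evals Delta_in)

lemma delta_br_eval: "\<delta> (br q p) (\<phi> \<otimes>\<^sub>f \<psi>) =
    \<delta> p ((\<lambda>x. \<phi> (br q x)) \<otimes>\<^sub>f \<psi>) + \<delta> p (\<phi> \<otimes>\<^sub>f (\<lambda>x. \<psi> (br q x))) -
    (\<delta> q ((\<lambda>x. \<phi> (br p x)) \<otimes>\<^sub>f \<psi>) + \<delta> q (\<phi> \<otimes>\<^sub>f (\<lambda>x. \<psi> (br p x))))"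
  by (simp only: delta_br plus_fun_apply minus_apply evals delta_in)

lemma Delta_br_eval: "\<Delta> (br q p) (\<phi> \<otimes>\<^sub>f \<psi>) =
    \<Delta> p ((\<lambda>x. \<phi> (br q x)) \<otimes>\<^sub>f \<psi>) + \<Delta> p (\<phi> \<otimes>\<^sub>f (\<lambda>x. \<psi> (br q x))) +
    (\<delta> q ((\<lambda>x. \<phi> (mult p x)) \<otimes>\<^sub>f \<psi>) - \<delta> q (\<phi> \<otimes>\<^sub>f (\<lambda>x. \<psi> (mult p x))))"
  by (simp only: Delta_br plus_fun_apply minus_apply evals delta_in Delta_in)

lemma delta_mult_eval: "\<delta> (mult q p) (\<phi> \<otimes>\<^sub>f \<psi>) =
    \<delta> p ((\<lambda>x. \<phi> (mult q x)) \<otimes>\<^sub>f \<psi>) + \<delta> q ((\<lambda>x. \<phi> (mult p x)) \<otimes>\<^sub>f \<psi>) +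
    \<Delta> p (\<phi> \<otimes>\<^sub>f (\<lambda>x. \<psi> (br q x))) + \<Delta> q (\<phi> \<otimes>\<^sub>f (\<lambda>x. \<psi> (br p x)))"
  by (simp only: delta_mult plus_fun_apply evals delta_in Delta_in)

end

end

section \<open>Adjoints of the six one-sided operators\<close>

context poisson_perm
begin

lemma functional_ops:
  "functional sP \<phi> \<Longrightarrow> functional sP (\<lambda>x. \<phi> (mult q x))" "functional sP \<phi> \<Longrightarrow> functional sP (\<lambda>x. \<phi> (br q x))"
  by (rule functional_M_left[OF mult_bl] functional_M_left[OF br_bl]; assumption)+

abbreviation (input) Lm where "Lm a \<equiv> tensor_mult sP sB B mult (\<odot>) a"
abbreviation (input) Rm where "Rm a \<equiv> \<lambda>y. tensor_mult sP sB B mult (\<odot>) y a"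
abbreviation (input) Lb where "Lb a \<equiv> tensor_mult sP sB B br (\<odot>) a"
abbreviation (input) Rb where "Rb a \<equiv> \<lambda>y. tensor_mult sP sB B br (\<odot>) y a"

lemma op_shift:
  assumes "b \<in> B n"
  shows "A.shift_map n (Lm (pure q b))" "A.shift_map n (Rm (pure q b))" "A.shift_map n (Lm (pure q b) - Rm (pure q b))"
    "A.shift_map n (Lb (pure q b))" "A.shift_map n (Rb (pure q b))" "A.shift_map n (Lb (pure q b) + Rb (pure q b))"
  by (intro A.shift_map_add A.shift_map_diff shift_mult_left[OF mult_bl] shift_mult_right[OF mult_bl]
      shift_mult_left[OF br_bl] shift_mult_right[OF br_bl] pure_in_AA assms)+

text \<open>Commutativity of \<open>mult\<close> and skewness of \<open>br\<close> let every
  functional be written with \<open>q\<close> on the left. The sign of \<open>br\<close> is why the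
  sum L + R of the bracket, and the difference L - R of the product, both lead to the single word
  \<open>c \<odot> b\<close>.\<close>

lemma op_pairing:
  assumes b: "b \<in> H" and \<phi>: "functional sP \<phi>" and c: "c \<in> H" and u: "u \<in> GA"
  shows "pairing \<phi> c (Lm (pure q b) u) = pairing (\<lambda>x. \<phi> (mult q x)) (b \<odot> c) u"
    "pairing \<phi> c (Rm (pure q b) u) = pairing (\<lambda>x. \<phi> (mult q x)) (b \<odot> c - c \<odot> b) u"
    "pairing \<phi> c ((Lm (pure q b) - Rm (pure q b)) u) = pairing (\<lambda>x. \<phi> (mult q x)) (c \<odot> b) u"
    "pairing \<phi> c (Lb (pure q b) u) = pairing (\<lambda>x. \<phi> (br q x)) (b \<odot> c) u"
    "pairing \<phi> c (Rb (pure q b) u) = pairing (\<lambda>x. \<phi> (br q x)) (c \<odot> b - b \<odot> c) u"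
    "pairing \<phi> c ((Lb (pure q b) + Rb (pure q b)) u) = pairing (\<lambda>x. \<phi> (br q x)) (c \<odot> b) u"
proof -
  note H = circ_in[OF b c] circ_in[OF c b] u
  note \<phi>m = functional_ops(1)[OF \<phi>, of q] and \<phi>b = functional_ops(2)[OF \<phi>, of q]
  show 1: "pairing \<phi> c (Lm (pure q b) u) = pairing (\<lambda>x. \<phi> (mult q x)) (b \<odot> c) u"
    by (rule pairing_mult_left[OF mult_bl \<phi> b c u])
  show 2: "pairing \<phi> c (Rm (pure q b) u) = pairing (\<lambda>x. \<phi> (mult q x)) (b \<odot> c - c \<odot> b) u"
    unfolding PB.mult_commute[of q] by (rule pairing_mult_right[OF mult_bl \<phi> b c u])
  show "pairing \<phi> c ((Lm (pure q b) - Rm (pure q b)) u) = pairing (\<lambda>x. \<phi> (mult q x)) (c \<odot> b) u"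
    unfolding minus_apply functional_diff[OF functional_pairing] 1 2
    by (simp add: pairing_diff_right[OF \<phi>m H])
  show 4: "pairing \<phi> c (Lb (pure q b) u) = pairing (\<lambda>x. \<phi> (br q x)) (b \<odot> c) u"
    by (rule pairing_mult_left[OF br_bl \<phi> b c u])
  have *: "(\<lambda>p. \<phi> (br p q)) = (\<lambda>p. - \<phi> (br q p))"
    using br_skew[of _ q] functional_neg[OF \<phi>] by (metis (no_types))
  \<comment> \<open>The sign from the skew bracket is next absorbed by reversing the commutator of
    letters.\<close>
  have "pairing \<phi> c (Rb (pure q b) u) = - pairing (\<lambda>x. \<phi> (br q x)) (b \<odot> c - c \<odot> b) u"
    unfolding pairing_neg_functional[OF \<phi>b B.G_diff[OF H(1,2)] u] *[symmetric]
    by (rule pairing_mult_right[OF br_bl \<phi> b c u])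
  then show 5: "pairing \<phi> c (Rb (pure q b) u) = pairing (\<lambda>x. \<phi> (br q x)) (c \<odot> b - b \<odot> c) u"
    by (simp add: pairing_diff_right[OF \<phi>b H] pairing_diff_right[OF \<phi>b H(2,1,3)])
  show "pairing \<phi> c ((Lb (pure q b) + Rb (pure q b)) u) = pairing (\<lambda>x. \<phi> (br q x)) (c \<odot> b) u"
    unfolding plus_fun_apply linear_on_add[OF functional_pairing UNIV_I UNIV_I] 4 5
    by (simp add: pairing_diff_right[OF \<phi>b H(2,1,3)])
qed

context
  fixes b n assumes b: "b \<in> B n"
begin

lemmas op_in =
  A.cmap_in_shift[OF op_shift(1)[OF b] A.shift_map_id] A.cmap_in_shift[OF op_shift(2)[OF b] A.shift_map_id]
  A.cmap_in_shift[OF op_shift(3)[OF b] A.shift_map_id] A.cmap_in_shift[OF op_shift(4)[OF b] A.shift_map_id]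
  A.cmap_in_shift[OF op_shift(5)[OF b] A.shift_map_id] A.cmap_in_shift[OF op_shift(6)[OF b] A.shift_map_id]
  A.cmap_in_shift[OF A.shift_map_id op_shift(1)[OF b]] A.cmap_in_shift[OF A.shift_map_id op_shift(2)[OF b]]
  A.cmap_in_shift[OF A.shift_map_id op_shift(3)[OF b]] A.cmap_in_shift[OF A.shift_map_id op_shift(4)[OF b]]
  A.cmap_in_shift[OF A.shift_map_id op_shift(5)[OF b]] A.cmap_in_shift[OF A.shift_map_id op_shift(6)[OF b]]

context
  fixes X \<phi> c
  assumes X: "X \<in> ctensor_space fscale AA" and \<phi>: "functional sP \<phi>" and c: "c \<in> H"
begin

lemmas op_eval =
  cmap_left_eval[OF op_shift(1)[OF b] X op_pairing(1)[OF B.component_in_G[OF b] \<phi> c]]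
  cmap_left_eval[OF op_shift(2)[OF b] X op_pairing(2)[OF B.component_in_G[OF b] \<phi> c]]
  cmap_left_eval[OF op_shift(3)[OF b] X op_pairing(3)[OF B.component_in_G[OF b] \<phi> c]]
  cmap_left_eval[OF op_shift(4)[OF b] X op_pairing(4)[OF B.component_in_G[OF b] \<phi> c]]
  cmap_left_eval[OF op_shift(5)[OF b] X op_pairing(5)[OF B.component_in_G[OF b] \<phi> c]]
  cmap_left_eval[OF op_shift(6)[OF b] X op_pairing(6)[OF B.component_in_G[OF b] \<phi> c]]
  cmap_right_eval[OF op_shift(1)[OF b] X op_pairing(1)[OF B.component_in_G[OF b] \<phi> c]]
  cmap_right_eval[OF op_shift(2)[OF b] X op_pairing(2)[OF B.component_in_G[OF b] \<phi> c]]
  cmap_right_eval[OF op_shift(3)[OF b] X op_pairing(3)[OF B.component_in_G[OF b] \<phi> c]]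
  cmap_right_eval[OF op_shift(4)[OF b] X op_pairing(4)[OF B.component_in_G[OF b] \<phi> c]]
  cmap_right_eval[OF op_shift(5)[OF b] X op_pairing(5)[OF B.component_in_G[OF b] \<phi> c]]
  cmap_right_eval[OF op_shift(6)[OF b] X op_pairing(6)[OF B.component_in_G[OF b] \<phi> c]]

end

end

text \<open>Cocommutativity and coskewness turn the flip into an exchange of letters, with opposite
  signs for \<open>\<Delta>\<close> and \<open>\<delta>\<close>. Hence both
  \<open>\<nu>\<^sup>-\<close> and \<open>\<theta>\<^sup>+\<close> pair with the commutator of
  \<open>c\<close> and \<open>d\<close>.\<close>

lemma comult_pure_eval:
  assumes "e \<in> H" "functional sP \<phi>" "functional sP \<psi>" "c \<in> B (- deg - k)" "d \<in> B (- deg - l)"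
  shows "\<nu> (pure p e) k l (pairing \<phi> c \<otimes>\<^sub>f pairing \<psi> d) = - (\<Delta> p (\<phi> \<otimes>\<^sub>f \<psi>) * \<omega> e (c \<odot> d))"
    and "\<theta> (pure p e) k l (pairing \<phi> c \<otimes>\<^sub>f pairing \<psi> d) = - (\<delta> p (\<phi> \<otimes>\<^sub>f \<psi>) * \<omega> e (c \<odot> d))"
    and "cflip fscale AA (\<nu> (pure p e)) k l (pairing \<phi> c \<otimes>\<^sub>f pairing \<psi> d) = - (\<Delta> p (\<phi> \<otimes>\<^sub>f \<psi>) * \<omega> e (d \<odot> c))"
    and "cflip fscale AA (\<theta> (pure p e)) k l (pairing \<phi> c \<otimes>\<^sub>f pairing \<psi> d) = \<delta> p (\<phi> \<otimes>\<^sub>f \<psi>) * \<omega> e (d \<odot> c)"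
proof -
  note cd = circ_in[OF assms(4,5)[THEN B.component_in_G]] circ_in[OF assms(5,4)[THEN B.component_in_G]]
  note e = pure_in_GA[OF assms(1), of p]
  show "\<nu> (pure p e) k l (pairing \<phi> c \<otimes>\<^sub>f pairing \<psi> d) = - (\<Delta> p (\<phi> \<otimes>\<^sub>f \<psi>) * \<omega> e (c \<odot> d))"
    by (simp add: comult_eval[OF PB.Delta_linear PB.Delta_in e assms(2-5)] pairing_pure PB.functional_Delta cd assms(1))
  show "\<theta> (pure p e) k l (pairing \<phi> c \<otimes>\<^sub>f pairing \<psi> d) = - (\<delta> p (\<phi> \<otimes>\<^sub>f \<psi>) * \<omega> e (c \<odot> d))"
    by (simp add: comult_eval[OF PB.delta_linear PB.delta_in e assms(2-5)] pairing_pure PB.functional_delta cd assms(1))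
  show "cflip fscale AA (\<nu> (pure p e)) k l (pairing \<phi> c \<otimes>\<^sub>f pairing \<psi> d) = - (\<Delta> p (\<phi> \<otimes>\<^sub>f \<psi>) * \<omega> e (d \<odot> c))"
    by (simp add: A.cflip_eval[OF \<nu>_in[OF e] functional_pairing functional_pairing]
        comult_eval[OF PB.Delta_linear PB.Delta_in e assms(3,2,5,4)] pairing_pure PB.functional_Delta cd assms(1)
        PB.Delta_sym[OF assms(3,2)])
  show "cflip fscale AA (\<theta> (pure p e)) k l (pairing \<phi> c \<otimes>\<^sub>f pairing \<psi> d) = \<delta> p (\<phi> \<otimes>\<^sub>f \<psi>) * \<omega> e (d \<odot> c)"
    by (simp only: A.cflip_eval[OF \<theta>_in[OF e] functional_pairing functional_pairing]
        comult_eval[OF PB.delta_linear PB.delta_in e assms(3,2,5,4)] pairing_pure[OF PB.functional_delta cd(2) assms(1)])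
      (simp add: PB.delta_antisym[OF assms(3,2)])
qed

lemma form_diff_right: "e \<in> H \<Longrightarrow> x \<in> H \<Longrightarrow> y \<in> H \<Longrightarrow> \<omega> e (x - y) = \<omega> e x - \<omega> e y"
  using linear_on_add[OF form_linear_right, of e "x - y" y] by (simp add: B.G_diff)

lemma circ_diff: "x \<in> H \<Longrightarrow> y \<in> H \<Longrightarrow> z \<in> H \<Longrightarrow> (x - y) \<odot> z = x \<odot> z - y \<odot> z"
    "x \<in> H \<Longrightarrow> y \<in> H \<Longrightarrow> z \<in> H \<Longrightarrow> z \<odot> (x - y) = z \<odot> x - z \<odot> y"
  using circ_add_left[of "x - y" y z] circ_add_right[of z "x - y" y] by (auto simp: B.G_diff algebra_simps)

text \<open>Skewness brings \<open>e \<odot> z\<close> to the first argument, and invariance strips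
  off the right factor \<open>z\<close>. With \<open>form_last\<close>, which does the same for left
  factors, any value starting with \<open>b\<close> is expressed by values starting with
  \<open>e\<close>.\<close>

lemma form_swap:
  assumes "b \<in> H" "e \<in> H" "z \<in> H"
  shows "\<omega> b (e \<odot> z) = \<omega> e (b \<odot> z) - \<omega> e (z \<odot> b)"
  using form_right[OF assms(2,3,1)] form_left[OF assms(2,3,1)] B.form_skew[OF assms(1) circ_in[OF assms(2,3)]]
    form_diff_right[OF assms(2) circ_in[OF assms(3,1)] circ_in[OF assms(1,3)]] by (simp add: algebra_simps)

lemma form_last: "b \<in> H \<Longrightarrow> e \<in> H \<Longrightarrow> z \<in> H \<Longrightarrow> \<omega> b (z \<odot> e) = - \<omega> e (z \<odot> b)"
  using form_left[of z e b] B.form_skew[of b "z \<odot> e"] circ_in by simp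

text \<open>A word in a perm algebra depends only on its last letter, so by invariance of the form all
  words in \<open>b\<close>, \<open>c\<close>, \<open>d\<close>, \<open>e\<close> paired by \<open>\<omega>\<close> reduce to three.\<close>

lemma form_words:
  assumes "b \<in> H" "e \<in> H" "c \<in> H" "d \<in> H"
  shows "\<omega> e ((b \<odot> c) \<odot> d) = \<omega> e (b \<odot> (c \<odot> d))" "\<omega> e ((c \<odot> b) \<odot> d) = \<omega> e (b \<odot> (c \<odot> d))"
    "\<omega> e (c \<odot> (b \<odot> d)) = \<omega> e (b \<odot> (c \<odot> d))" "\<omega> e (d \<odot> (b \<odot> c)) = \<omega> e (b \<odot> (d \<odot> c))"
    "\<omega> e ((b \<odot> d) \<odot> c) = \<omega> e (b \<odot> (d \<odot> c))" "\<omega> e ((d \<odot> b) \<odot> c) = \<omega> e (b \<odot> (d \<odot> c))"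
    "\<omega> e (d \<odot> (c \<odot> b)) = \<omega> e (c \<odot> (d \<odot> b))"
    "\<omega> b ((e \<odot> c) \<odot> d) = \<omega> e (b \<odot> (c \<odot> d)) - \<omega> e (c \<odot> (d \<odot> b))"
    "\<omega> b ((c \<odot> e) \<odot> d) = \<omega> e (b \<odot> (c \<odot> d)) - \<omega> e (c \<odot> (d \<odot> b))"
    "\<omega> b (c \<odot> (e \<odot> d)) = \<omega> e (b \<odot> (c \<odot> d)) - \<omega> e (c \<odot> (d \<odot> b))"
    "\<omega> b (d \<odot> (e \<odot> c)) = \<omega> e (b \<odot> (d \<odot> c)) - \<omega> e (c \<odot> (d \<odot> b))"
    "\<omega> b ((e \<odot> d) \<odot> c) = \<omega> e (b \<odot> (d \<odot> c)) - \<omega> e (c \<odot> (d \<odot> b))"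
    "\<omega> b ((d \<odot> e) \<odot> c) = \<omega> e (b \<odot> (d \<odot> c)) - \<omega> e (c \<odot> (d \<odot> b))"
    "\<omega> b (c \<odot> (d \<odot> e)) = - \<omega> e (c \<odot> (d \<odot> b))" "\<omega> b (d \<odot> (c \<odot> e)) = - \<omega> e (c \<odot> (d \<odot> b))"
    "\<omega> (b \<odot> e) (c \<odot> d) = \<omega> e (b \<odot> (c \<odot> d))" "\<omega> (b \<odot> e) (d \<odot> c) = \<omega> e (b \<odot> (d \<odot> c))"
    "\<omega> (e \<odot> b) (c \<odot> d) = \<omega> e (b \<odot> (c \<odot> d)) - \<omega> e (c \<odot> (d \<odot> b))"
  using form_last[OF assms(1,2) circ_in[OF assms(3,4)]] form_swap[OF assms(1,2) circ_in[OF assms(3,4)]]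
    form_swap[OF assms(1,2) circ_in[OF assms(4,3)]] assms
  by (simp_all add: word_left word_commute[of c b d] word_commute[of d b c] word_commute[of d c b]
      word_commute[of c e d] word_commute[of d e c] word_commute[of d c e] form_left circ_in)

section \<open>The compatibility conditions as scalar identities\<close>

abbreviation (input) lmap where "lmap f \<equiv> cmap fscale AA f id"
abbreviation (input) rmap where "rmap f \<equiv> cmap fscale AA id f"
abbreviation (input) flip where "flip \<equiv> cflip fscale AA"

context
  fixes b e :: 'b and n m :: int and q p :: 'p
  assumes b: "b \<in> B n" and e: "e \<in> B m"
begin

lemmas pure_membership =
  op_in[OF b] op_in[OF e] mult_pure[OF mult_bl] mult_pure[OF br_bl] \<nu>_in \<theta>_in A.cflip_in
  A.ctensor_space_add A.ctensor_space_diff pure_in_GA circ_in B.component_in_G[OF b] B.component_in_G[OF e] A.G_add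

context
  fixes \<phi> \<psi> c d and k l :: int
  assumes F: "functional sP \<phi>" "functional sP \<psi>" and c: "c \<in> B (- deg - k)" "d \<in> B (- deg - l)"
begin

lemmas pure_H = B.component_in_G[OF b] B.component_in_G[OF e] B.component_in_G[OF c(1)] B.component_in_G[OF c(2)]

lemmas pure_eval = plus_fun_apply minus_apply mult_pure[OF mult_bl] mult_pure[OF br_bl]
  comult_add[OF PB.Delta_linear PB.Delta_in] pure_in_GA circ_in B.G_diff pure_H F c functional_ops
  op_eval[OF b] op_eval[OF e] comult_pure_eval
  \<nu>_in \<theta>_in A.cflip_in A.ctensor_space_add A.ctensor_space_diff
  op_component[OF b c(1)] op_component[OF b c(2)] op_component[OF e c(1)] op_component[OF e c(2)]

text \<open>The formula for \<open>\<Delta>\<close> of a product is not visibly symmetric; comparing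
  it for \<open>q\<close>, \<open>p\<close> and for \<open>p\<close>, \<open>q\<close> gives a
  linear relation among the four terms, solved here for one of them.\<close>

lemma Delta_mult_relation: "\<Delta> q ((\<lambda>x. \<phi> (mult p x)) \<otimes>\<^sub>f \<psi>) =
    \<Delta> p ((\<lambda>x. \<phi> (mult q x)) \<otimes>\<^sub>f \<psi>) - \<Delta> p (\<phi> \<otimes>\<^sub>f (\<lambda>x. \<psi> (mult q x))) + \<Delta> q (\<phi> \<otimes>\<^sub>f (\<lambda>x. \<psi> (mult p x)))"
  using PB.Delta_mult_eval[OF F, of q p] PB.Delta_mult_eval[OF F, of p q] PB.mult_commute[of p q]
  by (simp add: algebra_simps)

text \<open>In the same way, skewness of the bracket relates the two expansions of
  \<open>\<Delta>\<close>. This is the source of the mirrored form of the rule for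
  \<open>\<delta>\<close> of a product.\<close>

lemma Delta_br_relation: "\<Delta> q ((\<lambda>x. \<phi> (br p x)) \<otimes>\<^sub>f \<psi>) =
    - (\<Delta> p ((\<lambda>x. \<phi> (br q x)) \<otimes>\<^sub>f \<psi>) + \<Delta> p (\<phi> \<otimes>\<^sub>f (\<lambda>x. \<psi> (br q x))) +
       \<delta> q ((\<lambda>x. \<phi> (mult p x)) \<otimes>\<^sub>f \<psi>) - \<delta> q (\<phi> \<otimes>\<^sub>f (\<lambda>x. \<psi> (mult p x))) +
       \<Delta> q (\<phi> \<otimes>\<^sub>f (\<lambda>x. \<psi> (br p x))) +
       \<delta> p ((\<lambda>x. \<phi> (mult q x)) \<otimes>\<^sub>f \<psi>) - \<delta> p (\<phi> \<otimes>\<^sub>f (\<lambda>x. \<psi> (mult q x))))"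
proof -
  have "\<Delta> (br q p) (\<phi> \<otimes>\<^sub>f \<psi>) = - \<Delta> (br p q) (\<phi> \<otimes>\<^sub>f \<psi>)"
    unfolding br_skew[of q p] by (rule functional_neg[OF PB.functional_Delta])
  then show ?thesis
    unfolding PB.Delta_br_eval[OF F] by (simp add: algebra_simps eq_neg_iff_add_eq_0)
qed

text \<open>Words are reduced to the three values of \<open>\<omega> e\<close> at
  \<open>b \<odot> (c \<odot> d)\<close>, \<open>b \<odot> (d \<odot> c)\<close> and
  \<open>c \<odot> (d \<odot> b)\<close>, one for each possible last letter; the remaining rules
  reduce their coefficients.\<close>

lemmas pure_scalar = circ_diff form_diff_right form_words[OF pure_H] circ_in B.G_diff pure_H
  PB.Delta_mult_eval[OF F, of q p] PB.delta_br_eval[OF F, of q p] PB.delta_mult_eval[OF F, of q p]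
  PB.Delta_br_eval[OF F, of q p] PB.Delta_br_eval[OF F, of p q] Delta_mult_relation Delta_br_relation

text \<open>Right multiplication has a commutator of letters as adjoint. In each case, for the third
  after the flip, it stands before the other letter, where left commutativity kills it.\<close>

lemma multiplication_vanishes_pure:
  "lmap (Rm (pure q b)) (\<nu> (pure p e)) k l (pairing \<phi> c \<otimes>\<^sub>f pairing \<psi> d) = 0"
  "lmap (Rb (pure q b)) (\<theta> (pure p e)) k l (pairing \<phi> c \<otimes>\<^sub>f pairing \<psi> d) = 0"
  "rmap (Rb (pure q b)) (flip (\<nu> (pure p e))) k l (pairing \<phi> c \<otimes>\<^sub>f pairing \<psi> d) = 0"
  "lmap (Rm (pure q b)) (\<theta> (pure p e)) k l (pairing \<phi> c \<otimes>\<^sub>f pairing \<psi> d) = 0"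
  by (simp_all only: pure_eval) (simp_all add: pure_scalar)

text \<open>The words ending in \<open>b\<close> cancel, every term carries
  \<open>b \<odot> (c \<odot> d)\<close>, and the coefficients are those of \<open>\<Delta>\<close>
  of the product of \<open>p\<close> and \<open>q\<close>.\<close>

lemma perm_bialgebra2_pure:
  "(\<nu> (Lm (pure q b) (pure p e))) k l (pairing \<phi> c \<otimes>\<^sub>f pairing \<psi> d) =
   (lmap (Lm (pure q b) - Rm (pure q b)) (\<nu> (pure p e)) + rmap (Rm (pure p e)) (\<nu> (pure q b))) k l (pairing \<phi> c \<otimes>\<^sub>f pairing \<psi> d)"
  by (simp only: pure_eval) (simp add: pure_scalar algebra_simps)

lemma perm_bialgebra3_pure:
  "(\<nu> (Lm (pure q b) (pure p e))) k l (pairing \<phi> c \<otimes>\<^sub>f pairing \<psi> d) =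
   (rmap (Lm (pure q b)) (\<nu> (pure p e)) + lmap (Lm (pure p e) - Rm (pure p e)) (\<nu> (pure q b) - flip (\<nu> (pure q b)))) k l (pairing \<phi> c \<otimes>\<^sub>f pairing \<psi> d)"
  by (simp only: pure_eval) (simp add: pure_scalar algebra_simps)

text \<open>Again only \<open>b \<odot> (c \<odot> d)\<close> survives; the coefficients form the
  cocycle condition of \<open>\<delta>\<close> for the bracket.\<close>

lemma leibniz_bialgebra2_pure:
  "(\<theta> (Lb (pure q b) (pure p e))) k l (pairing \<phi> c \<otimes>\<^sub>f pairing \<psi> d) =
   ((rmap (Rb (pure p e)) (\<theta> (pure q b) + flip (\<theta> (pure q b))) - lmap (Lb (pure p e) + Rb (pure p e)) (\<theta> (pure q b) + flip (\<theta> (pure q b)))) + (rmap (Lb (pure q b)) (\<theta> (pure p e)) + lmap (Lb (pure q b)) (\<theta> (pure p e)))) k l (pairing \<phi> c \<otimes>\<^sub>f pairing \<psi> d)"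
  by (simp only: pure_eval) (simp add: pure_scalar algebra_simps)

text \<open>With the single word \<open>b \<odot> (c \<odot> d)\<close>, this is the formula for
  \<open>\<Delta>\<close> of the bracket of \<open>q\<close> and \<open>p\<close>.\<close>

lemma DPP_bialgebra1_pure:
  "(\<nu> (Lb (pure q b) (pure p e))) k l (pairing \<phi> c \<otimes>\<^sub>f pairing \<psi> d) =
   ((rmap (Lb (pure q b)) (\<nu> (pure p e)) + lmap (Lb (pure q b)) (\<nu> (pure p e))) + (lmap (Lm (pure p e) - Rm (pure p e)) (\<theta> (pure q b) + flip (\<theta> (pure q b))) - rmap (Rm (pure p e)) (\<theta> (pure q b) + flip (\<theta> (pure q b))))) k l (pairing \<phi> c \<otimes>\<^sub>f pairing \<psi> d)"
  by (simp only: pure_eval) (simp add: pure_scalar algebra_simps)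

text \<open>The coefficients give the rule for \<open>\<delta>\<close> of a product with the two
  tensor slots exchanged. It differs from the given rule by
  \<open>Delta_br_relation\<close>.\<close>

lemma DPP_bialgebra2_pure:
  "(\<theta> (Lm (pure q b) (pure p e))) k l (pairing \<phi> c \<otimes>\<^sub>f pairing \<psi> d) =
   (rmap (Lm (pure q b)) (\<theta> (pure p e)) + rmap (Rm (pure p e)) (\<theta> (pure q b)) - lmap (Lb (pure q b) + Rb (pure q b)) (\<nu> (pure p e)) - lmap (Lb (pure p e) + Rb (pure p e)) (\<nu> (pure q b) - flip (\<nu> (pure q b)))) k l (pairing \<phi> c \<otimes>\<^sub>f pairing \<psi> d)"
  by (simp only: pure_eval) (simp add: pure_scalar algebra_simps)

text \<open>The right side is minus the expansion of \<open>\<Delta>\<close> of the bracket of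
  \<open>p\<close> and \<open>q\<close>, so skewness of \<open>br\<close> finishes.\<close>

lemma DPP_bialgebra4_pure:
  "(\<nu> (Lb (pure q b) (pure p e))) k l (pairing \<phi> c \<otimes>\<^sub>f pairing \<psi> d) =
   ((rmap (Lm (pure q b)) (\<theta> (pure p e)) - lmap (Lm (pure q b)) (\<theta> (pure p e))) + (rmap (Rb (pure p e)) (\<nu> (pure q b) - flip (\<nu> (pure q b))) - lmap (Lb (pure p e) + Rb (pure p e)) (\<nu> (pure q b) - flip (\<nu> (pure q b))))) k l (pairing \<phi> c \<otimes>\<^sub>f pairing \<psi> d)"
  by (simp only: pure_eval) (simp add: pure_scalar algebra_simps)

text \<open>The coefficient identity is that of condition 2; every term now carries the difference
  of the words ending in \<open>d\<close> and in \<open>c\<close>.\<close>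

lemma DPP_bialgebra5_pure:
  "(\<theta> (Lm (pure q b) (pure p e)) + flip (\<theta> (Lm (pure q b) (pure p e)))) k l (pairing \<phi> c \<otimes>\<^sub>f pairing \<psi> d) =
   (rmap (Lm (pure q b)) (\<theta> (pure p e) + flip (\<theta> (pure p e))) + rmap (Lm (pure p e)) (\<theta> (pure q b) + flip (\<theta> (pure q b))) - lmap (Lb (pure q b)) (\<nu> (pure p e) - flip (\<nu> (pure p e))) - lmap (Lb (pure p e)) (\<nu> (pure q b) - flip (\<nu> (pure q b)))) k l (pairing \<phi> c \<otimes>\<^sub>f pairing \<psi> d)"
  by (simp only: pure_eval) (simp add: pure_scalar algebra_simps)

text \<open>Here the coefficients are the rule for \<open>\<delta>\<close> of a product as given, on
  the single word \<open>b \<odot> (c \<odot> d)\<close>.\<close>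

lemma DPP_bialgebra6_pure:
  "(\<theta> (Lm (pure q b) (pure p e))) k l (pairing \<phi> c \<otimes>\<^sub>f pairing \<psi> d) =
   (lmap (Lm (pure q b)) (\<theta> (pure p e)) - rmap (Rb (pure p e)) (\<nu> (pure q b) - flip (\<nu> (pure q b))) + rmap (Lb (pure q b)) (\<nu> (pure p e)) + lmap (Lm (pure p e) - Rm (pure p e)) (\<theta> (pure q b) + flip (\<theta> (pure q b)))) k l (pairing \<phi> c \<otimes>\<^sub>f pairing \<psi> d)"
  by (simp only: pure_eval) (simp add: pure_scalar algebra_simps)

text \<open>The two brackets on the left are opposite, so the words of b e and e b are subtracted
  and only the word ending in \<open>b\<close> is left; its coefficients are those of
  \<open>\<Delta>\<close> of the bracket.\<close>

lemma DPP_bialgebra7_pure: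
  "(\<nu> (Lb (pure q b) (pure p e) + Lb (pure p e) (pure q b))) k l (pairing \<phi> c \<otimes>\<^sub>f pairing \<psi> d) =
   (rmap (Lb (pure q b) + Rb (pure q b)) (\<nu> (pure p e)) + lmap (Lb (pure q b) + Rb (pure q b)) (flip (\<nu> (pure p e))) + rmap (Lm (pure p e) - Rm (pure p e)) (\<theta> (pure q b)) + lmap (Lm (pure p e) - Rm (pure p e)) (flip (\<theta> (pure q b)))) k l (pairing \<phi> c \<otimes>\<^sub>f pairing \<psi> d)"
  by (simp only: pure_eval) (simp add: pure_scalar algebra_simps)

end

end

section \<open>The compatibility conditions on homogeneous pure tensors\<close>

context
  fixes b e :: 'b and n m :: int and q p :: 'p
  assumes b: "b \<in> B n" and e: "e \<in> B m"
begin

lemmas membership = pure_membership[OF b e]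

lemma multiplication_vanishes_pure':
  "lmap (Rm (pure q b)) (\<nu> (pure p e)) = 0"
  "lmap (Rb (pure q b)) (\<theta> (pure p e)) = 0"
  "rmap (Rb (pure q b)) (flip (\<nu> (pure p e))) = 0"
  "lmap (Rm (pure q b)) (\<theta> (pure p e)) = 0"
  by (rule ctensor_separation; (simp only: membership A.ctensor_space_zero; fail |
        (unfold zero_fun_apply, rule multiplication_vanishes_pure[OF b e]; assumption)))+

lemma perm_bialgebra2_pure':
  "\<nu> (Lm (pure q b) (pure p e)) =
   lmap (Lm (pure q b) - Rm (pure q b)) (\<nu> (pure p e)) + rmap (Rm (pure p e)) (\<nu> (pure q b))"
  by (rule ctensor_separation) (simp only: membership; fail | rule perm_bialgebra2_pure[OF b e]; assumption)+

lemma perm_bialgebra3_pure':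
  "\<nu> (Lm (pure q b) (pure p e)) =
   rmap (Lm (pure q b)) (\<nu> (pure p e)) + lmap (Lm (pure p e) - Rm (pure p e)) (\<nu> (pure q b) - flip (\<nu> (pure q b)))"
  by (rule ctensor_separation) (simp only: membership; fail | rule perm_bialgebra3_pure[OF b e]; assumption)+

lemma leibniz_bialgebra2_pure':
  "\<theta> (Lb (pure q b) (pure p e)) =
   (rmap (Rb (pure p e)) (\<theta> (pure q b) + flip (\<theta> (pure q b))) - lmap (Lb (pure p e) + Rb (pure p e)) (\<theta> (pure q b) + flip (\<theta> (pure q b)))) + (rmap (Lb (pure q b)) (\<theta> (pure p e)) + lmap (Lb (pure q b)) (\<theta> (pure p e)))"
  by (rule ctensor_separation) (simp only: membership; fail | rule leibniz_bialgebra2_pure[OF b e]; assumption)+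

lemma DPP_bialgebra1_pure':
  "\<nu> (Lb (pure q b) (pure p e)) =
   (rmap (Lb (pure q b)) (\<nu> (pure p e)) + lmap (Lb (pure q b)) (\<nu> (pure p e))) + (lmap (Lm (pure p e) - Rm (pure p e)) (\<theta> (pure q b) + flip (\<theta> (pure q b))) - rmap (Rm (pure p e)) (\<theta> (pure q b) + flip (\<theta> (pure q b))))"
  by (rule ctensor_separation) (simp only: membership; fail | rule DPP_bialgebra1_pure[OF b e]; assumption)+

lemma DPP_bialgebra2_pure':
  "\<theta> (Lm (pure q b) (pure p e)) =
   rmap (Lm (pure q b)) (\<theta> (pure p e)) + rmap (Rm (pure p e)) (\<theta> (pure q b)) - lmap (Lb (pure q b) + Rb (pure q b)) (\<nu> (pure p e)) - lmap (Lb (pure p e) + Rb (pure p e)) (\<nu> (pure q b) - flip (\<nu> (pure q b)))"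
  by (rule ctensor_separation) (simp only: membership; fail | rule DPP_bialgebra2_pure[OF b e]; assumption)+

lemma DPP_bialgebra4_pure':
  "\<nu> (Lb (pure q b) (pure p e)) =
   (rmap (Lm (pure q b)) (\<theta> (pure p e)) - lmap (Lm (pure q b)) (\<theta> (pure p e))) + (rmap (Rb (pure p e)) (\<nu> (pure q b) - flip (\<nu> (pure q b))) - lmap (Lb (pure p e) + Rb (pure p e)) (\<nu> (pure q b) - flip (\<nu> (pure q b))))"
  by (rule ctensor_separation) (simp only: membership; fail | rule DPP_bialgebra4_pure[OF b e]; assumption)+

lemma DPP_bialgebra5_pure':
  "\<theta> (Lm (pure q b) (pure p e)) + flip (\<theta> (Lm (pure q b) (pure p e))) =
   rmap (Lm (pure q b)) (\<theta> (pure p e) + flip (\<theta> (pure p e))) + rmap (Lm (pure p e)) (\<theta> (pure q b) + flip (\<theta> (pure q b))) - lmap (Lb (pure q b)) (\<nu> (pure p e) - flip (\<nu> (pure p e))) - lmap (Lb (pure p e)) (\<nu> (pure q b) - flip (\<nu> (pure q b)))"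
  by (rule ctensor_separation) (simp only: membership; fail | rule DPP_bialgebra5_pure[OF b e]; assumption)+

lemma DPP_bialgebra6_pure':
  "\<theta> (Lm (pure q b) (pure p e)) =
   lmap (Lm (pure q b)) (\<theta> (pure p e)) - rmap (Rb (pure p e)) (\<nu> (pure q b) - flip (\<nu> (pure q b))) + rmap (Lb (pure q b)) (\<nu> (pure p e)) + lmap (Lm (pure p e) - Rm (pure p e)) (\<theta> (pure q b) + flip (\<theta> (pure q b)))"
  by (rule ctensor_separation) (simp only: membership; fail | rule DPP_bialgebra6_pure[OF b e]; assumption)+

lemma DPP_bialgebra7_pure':
  "\<nu> (Lb (pure q b) (pure p e) + Lb (pure p e) (pure q b)) =
   rmap (Lb (pure q b) + Rb (pure q b)) (\<nu> (pure p e)) + lmap (Lb (pure q b) + Rb (pure q b)) (flip (\<nu> (pure p e))) + rmap (Lm (pure p e) - Rm (pure p e)) (\<theta> (pure q b)) + lmap (Lm (pure p e) - Rm (pure p e)) (flip (\<theta> (pure q b)))"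
  by (rule ctensor_separation) (simp only: membership; fail | rule DPP_bialgebra7_pure[OF b e]; assumption)+

end

section \<open>Extension to all elements by biadditivity\<close>

lemma biadditive_eqI:
  assumes "x \<in> GA" "y \<in> GA" "A.biadditive (\<lambda>x y. L x y - R x y)"
    and "\<And>p b i q c j. b \<in> B i \<Longrightarrow> c \<in> B j \<Longrightarrow> L (pure p b) (pure q c) = R (pure p b) (pure q c)"
  shows "L x y = R x y"
proof -
  have "L x y - R x y = 0"
    by (rule biadditive_zero[OF assms(1-3)]) (simp only: assms(4) diff_self)
  then show ?thesis by (simp only: right_minus_eq)
qed

lemmas family_intros = A.biadditive_intros mult_family[OF mult_bl] mult_family[OF br_bl]
  comult_family[OF PB.Delta_linear PB.Delta_in] comult_family[OF PB.delta_linear PB.delta_in]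
  A.biadditive_tensor_family[OF comult_family[OF PB.Delta_linear PB.Delta_in] mult_in[OF mult_bl] mult_family(3)[OF mult_bl]]
  A.biadditive_tensor_family[OF comult_family[OF PB.Delta_linear PB.Delta_in] mult_in[OF br_bl] mult_family(3)[OF br_bl]]
  A.biadditive_tensor_family[OF comult_family[OF PB.delta_linear PB.delta_in] mult_in[OF mult_bl] mult_family(3)[OF mult_bl]]
  A.biadditive_tensor_family[OF comult_family[OF PB.delta_linear PB.delta_in] mult_in[OF br_bl] mult_family(3)[OF br_bl]]
  A.biadditive_tensor_family[OF A.tensor_family_flip[OF comult_family[OF PB.delta_linear PB.delta_in]]
    mult_in[OF mult_bl] mult_family(3)[OF mult_bl]]
  A.biadditive_tensor_family[OF comult_family[OF PB.Delta_linear PB.Delta_in]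
    A.G_add[OF mult_in[OF br_bl] mult_in[OF br_bl]]
    A.biadditive_add[OF mult_family(3)[OF br_bl] A.biadditive_swap[OF mult_family(3)[OF br_bl]]]]

context
  fixes x y assumes x: "x \<in> GA" and y: "y \<in> GA"
begin

lemma multiplication_vanishes:
  "lmap (Rm x) (\<nu> y) = 0"
  "lmap (Rb x) (\<theta> y) = 0"
  "rmap (Rb x) (flip (\<nu> y)) = 0"
  "lmap (Rm x) (\<theta> y) = 0"
  by (rule biadditive_zero[OF x y, where T = "\<lambda>x y. lmap (Rm x) (\<nu> y)"]
        biadditive_zero[OF x y, where T = "\<lambda>x y. lmap (Rb x) (\<theta> y)"]
        biadditive_zero[OF x y, where T = "\<lambda>x y. rmap (Rb x) (flip (\<nu> y))"]
        biadditive_zero[OF x y, where T = "\<lambda>x y. lmap (Rm x) (\<theta> y)"],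
      (intro family_intros; fail), rule multiplication_vanishes_pure'; assumption)+

lemma perm_bialgebra2_A:
  "\<nu> (Lm x y) =
   lmap (Lm x - Rm x) (\<nu> y) + rmap (Rm y) (\<nu> x)"
  by (rule biadditive_eqI[OF x y,
        where L = "\<lambda>x y. \<nu> (Lm x y)"
          and R = "\<lambda>x y. lmap (Lm x - Rm x) (\<nu> y) + rmap (Rm y) (\<nu> x)"],
      intro family_intros)
    (assumption | rule perm_bialgebra2_pure')+

lemma perm_bialgebra3_A:
  "\<nu> (Lm x y) =
   rmap (Lm x) (\<nu> y) + lmap (Lm y - Rm y) (\<nu> x - flip (\<nu> x))"
  by (rule biadditive_eqI[OF x y,
        where L = "\<lambda>x y. \<nu> (Lm x y)"
          and R = "\<lambda>x y. rmap (Lm x) (\<nu> y) + lmap (Lm y - Rm y) (\<nu> x - flip (\<nu> x))"],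
      intro family_intros)
    (assumption | rule perm_bialgebra3_pure')+

lemma leibniz_bialgebra2_A:
  "\<theta> (Lb x y) =
   (rmap (Rb y) (\<theta> x + flip (\<theta> x)) - lmap (Lb y + Rb y) (\<theta> x + flip (\<theta> x))) + (rmap (Lb x) (\<theta> y) + lmap (Lb x) (\<theta> y))"
  by (rule biadditive_eqI[OF x y,
        where L = "\<lambda>x y. \<theta> (Lb x y)"
          and R = "\<lambda>x y. (rmap (Rb y) (\<theta> x + flip (\<theta> x)) - lmap (Lb y + Rb y) (\<theta> x + flip (\<theta> x))) + (rmap (Lb x) (\<theta> y) + lmap (Lb x) (\<theta> y))"],
      intro family_intros)
    (assumption | rule leibniz_bialgebra2_pure')+

lemma DPP_bialgebra1_A:
  "\<nu> (Lb x y) =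
   (rmap (Lb x) (\<nu> y) + lmap (Lb x) (\<nu> y)) + (lmap (Lm y - Rm y) (\<theta> x + flip (\<theta> x)) - rmap (Rm y) (\<theta> x + flip (\<theta> x)))"
  by (rule biadditive_eqI[OF x y,
        where L = "\<lambda>x y. \<nu> (Lb x y)"
          and R = "\<lambda>x y. (rmap (Lb x) (\<nu> y) + lmap (Lb x) (\<nu> y)) + (lmap (Lm y - Rm y) (\<theta> x + flip (\<theta> x)) - rmap (Rm y) (\<theta> x + flip (\<theta> x)))"],
      intro family_intros)
    (assumption | rule DPP_bialgebra1_pure')+

lemma DPP_bialgebra2_A:
  "\<theta> (Lm x y) =
   rmap (Lm x) (\<theta> y) + rmap (Rm y) (\<theta> x) - lmap (Lb x + Rb x) (\<nu> y) - lmap (Lb y + Rb y) (\<nu> x - flip (\<nu> x))"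
  by (rule biadditive_eqI[OF x y,
        where L = "\<lambda>x y. \<theta> (Lm x y)"
          and R = "\<lambda>x y. rmap (Lm x) (\<theta> y) + rmap (Rm y) (\<theta> x) - lmap (Lb x + Rb x) (\<nu> y) - lmap (Lb y + Rb y) (\<nu> x - flip (\<nu> x))"],
      intro family_intros)
    (assumption | rule DPP_bialgebra2_pure')+

lemma DPP_bialgebra4_A:
  "\<nu> (Lb x y) =
   (rmap (Lm x) (\<theta> y) - lmap (Lm x) (\<theta> y)) + (rmap (Rb y) (\<nu> x - flip (\<nu> x)) - lmap (Lb y + Rb y) (\<nu> x - flip (\<nu> x)))"
  by (rule biadditive_eqI[OF x y,
        where L = "\<lambda>x y. \<nu> (Lb x y)"
          and R = "\<lambda>x y. (rmap (Lm x) (\<theta> y) - lmap (Lm x) (\<theta> y)) + (rmap (Rb y) (\<nu> x - flip (\<nu> x)) - lmap (Lb y + Rb y) (\<nu> x - flip (\<nu> x)))"],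
      intro family_intros)
    (assumption | rule DPP_bialgebra4_pure')+

lemma DPP_bialgebra5_A:
  "\<theta> (Lm x y) + flip (\<theta> (Lm x y)) =
   rmap (Lm x) (\<theta> y + flip (\<theta> y)) + rmap (Lm y) (\<theta> x + flip (\<theta> x)) - lmap (Lb x) (\<nu> y - flip (\<nu> y)) - lmap (Lb y) (\<nu> x - flip (\<nu> x))"
  by (rule biadditive_eqI[OF x y,
        where L = "\<lambda>x y. \<theta> (Lm x y) + flip (\<theta> (Lm x y))"
          and R = "\<lambda>x y. rmap (Lm x) (\<theta> y + flip (\<theta> y)) + rmap (Lm y) (\<theta> x + flip (\<theta> x)) - lmap (Lb x) (\<nu> y - flip (\<nu> y)) - lmap (Lb y) (\<nu> x - flip (\<nu> x))"],
      intro family_intros)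
    (assumption | rule DPP_bialgebra5_pure')+

lemma DPP_bialgebra6_A:
  "\<theta> (Lm x y) =
   lmap (Lm x) (\<theta> y) - rmap (Rb y) (\<nu> x - flip (\<nu> x)) + rmap (Lb x) (\<nu> y) + lmap (Lm y - Rm y) (\<theta> x + flip (\<theta> x))"
  by (rule biadditive_eqI[OF x y,
        where L = "\<lambda>x y. \<theta> (Lm x y)"
          and R = "\<lambda>x y. lmap (Lm x) (\<theta> y) - rmap (Rb y) (\<nu> x - flip (\<nu> x)) + rmap (Lb x) (\<nu> y) + lmap (Lm y - Rm y) (\<theta> x + flip (\<theta> x))"],
      intro family_intros)
    (assumption | rule DPP_bialgebra6_pure')+

lemma DPP_bialgebra7_A:
  "\<nu> (Lb x y + Lb y x) =
   rmap (Lb x + Rb x) (\<nu> y) + lmap (Lb x + Rb x) (flip (\<nu> y)) + rmap (Lm y - Rm y) (\<theta> x) + lmap (Lm y - Rm y) (flip (\<theta> x))"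
  by (rule biadditive_eqI[OF x y,
        where L = "\<lambda>x y. \<nu> (Lb x y + Lb y x)"
          and R = "\<lambda>x y. rmap (Lb x + Rb x) (\<nu> y) + lmap (Lb x + Rb x) (flip (\<nu> y)) + rmap (Lm y - Rm y) (\<theta> x) + lmap (Lm y - Rm y) (flip (\<theta> x))"],
      intro family_intros)
    (assumption | rule DPP_bialgebra7_pure')+

end

lemma completed_bialgebra:
  "completed_DPP_bialgebra fscale AA (tensor_mult sP sB B mult (\<odot>)) (tensor_mult sP sB B br (\<odot>)) \<nu> \<theta>"
proof (rule completed_DPP_bialgebra.intro[OF graded_DPP completed_coalgebra], unfold_locales)
  \<comment> \<open>In this condition and the next two, both sides are zero by
    \<open>multiplication_vanishes\<close>.\<close>
  show "lmap (Rm a) (\<nu> b) = flip (lmap (Rm b) (\<nu> a))"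
    if "a \<in> GA" "b \<in> GA" for a b
    by (simp only: multiplication_vanishes that A.cflip_zero)
  show "flip (lmap (Rb b) (\<theta> a)) = lmap (Rb a) (\<theta> b)"
    if "a \<in> GA" "b \<in> GA" for a b
    by (simp only: multiplication_vanishes that A.cflip_zero)
  show "rmap (Rb a) (flip (\<nu> b)) = - lmap (Rm b) (\<theta> a)"
    if "a \<in> GA" "b \<in> GA" for a b
    by (simp only: multiplication_vanishes that minus_zero)
qed (fact perm_bialgebra2_A perm_bialgebra3_A leibniz_bialgebra2_A DPP_bialgebra1_A DPP_bialgebra2_A
  DPP_bialgebra4_A DPP_bialgebra5_A DPP_bialgebra6_A DPP_bialgebra7_A)+

end

theorem theorem4p16:
  fixes sP :: "'k::field_char_0 \<Rightarrow> 'p::ab_group_add \<Rightarrow> 'p"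
    and mult br :: "'p \<Rightarrow> 'p \<Rightarrow> 'p"
    and \<Delta> \<delta> :: "'p \<Rightarrow> ('p, 'p, 'k) tensor"
    and sB :: "'k \<Rightarrow> 'b::ab_group_add \<Rightarrow> 'b"
    and B :: "int \<Rightarrow> 'b set"
    and mB :: "'b \<Rightarrow> 'b \<Rightarrow> 'b"
    and \<omega> :: "'b \<Rightarrow> 'b \<Rightarrow> 'k"
    and \<nu>\<omega> :: "'b \<Rightarrow> ('b, 'k) ctensor2"
  assumes "poisson_bialgebra sP mult br \<Delta> \<delta>"
    and "fin_dim sP (UNIV :: 'p set)"
    and "quadratic_graded_perm_algebra sB B mB \<omega>"
    and "linear_on sB cscale (gcarrier sB B) \<nu>\<omega>"
    and "\<And>b. b \<in> gcarrier sB B \<Longrightarrow> \<nu>\<omega> b \<in> ctensor_space sB B"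
    and "\<And>b1 b2 b3. \<lbrakk>b1 \<in> gcarrier sB B; b2 \<in> gcarrier sB B; b3 \<in> gcarrier sB B\<rbrakk> \<Longrightarrow>
           form_hat sB B \<omega> (\<nu>\<omega> b1) b2 b3 = - \<omega> b1 (mB b2 b3)"
  shows "completed_DPP_bialgebra fscale (tensor_grading sP sB B)
           (tensor_mult sP sB B mult mB) (tensor_mult sP sB B br mB)
           (tensor_comult sP sB B \<Delta> \<nu>\<omega>) (tensor_comult sP sB B \<delta> \<nu>\<omega>)"
proof -
  interpret PB: poisson_bialgebra sP mult br \<Delta> \<delta> by fact
  interpret QB: quadratic_graded_perm_algebra sB B mB \<omega> by fact
  interpret poisson_perm sP sB B mB \<omega> \<nu>\<omega> mult br \<Delta> \<delta>
    by unfold_locales (fact assms)+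
  show ?thesis by (rule completed_bialgebra)
qed

end
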